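(* Let $n\ge 2$, $\sigma>0$ and $\widehat A\in\mathbb{C}^{n\times n}$. Then \[ \mathbb{E}_{A\sim\mathcal{G}(n,\sigma^2)_{\widehat{A}}}\Big(\frac{1}{n}\sum_{(\lambda,v):Av=\lambda v}\frac{\mu^2(A,\lambda,v)}{\|A\|_F^2}\Big)\le \mathbb{E}_{A\sim\mathcal{G}(n,\sigma^2)_{\widehat{A}}}\Big(\frac{1}{n}\sum_{(\lambda,v):Av=\lambda v}\frac{\mu_F^2(A,\lambda,v)}{\|A\|_F^2}\Big)\le \frac{n}{\sigma^2}. \] Moreover, if $A$ is chosen uniformly at random in the unit sphere $\mathbb{S}(\mathbb{C}^{n\times n})$ (for the Frobenius norm), then \[ \mathbb{E}_{A\in\mathbb{S}(\mathbb{C}^{n\times n})}\Big(\frac{1}{n}\sum_{(\lambda,v):Av=\lambda v}\mu^2(A,\lambda,v)\Big)\le \mathbb{E}_{A\in\mathbb{S}(\mathbb{C}^{n\times n})}\Big(\frac{1}{n}\sum_{(\lambda,v):Av=\lambda v}\mu_F^2(A,\lambda,v)\Big)\le n^3 . \]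
   Context: A complex random variable is $\mathcal N_{\mathbb C}(\hat\eta,\sigma^2)$ if it has density $\frac{1}{\pi\sigma^2}e^{-|z-\hat\eta|^2/\sigma^2}$ on $\mathbb C$. $\mathcal{G}(n,\sigma^2)_{\widehat A}$ denotes the distribution of an $n\times n$ complex matrix whose entries $a_{jk}$ are independent $\mathcal N_{\mathbb C}(\widehat a_{jk},\sigma^2)$; $\mathcal G(n)=\mathcal G(n,1)_0$. Eigenpairs are pairs $(\lambda,v)\in\mathbb C\times\mathbb P(\mathbb C^n)$ with $Av=\lambda v$; the sums run over all eigenpairs of $A$ (for almost every $A$ there are exactly $n$ of them, the set of matrices with a multiple eigenvalue having measure zero). For $(A,\lambda,v)$ with $v\neq0$ let $A_{\lambda,v}=\Pi_{v^\perp}(\lambda I_n-A)|_{v^\perp}:v^\perp\to v^\perp$, with $\Pi_{v^\perp}$ the orthogonal projection onto the Hermitian complement $v^\perp$. For an eigenpair with $A_{\lambda,v}$ invertible, $\mu(A,\lambda,v)=\max(1,\|A\|_F\|A_{\lambda,v}^{-1}\|)$ and $\mu_F(A,\lambda,v)=\max(1,\|A\|_F\|A_{\lambda,v}^{-1}\|_F)$ ($\|\cdot\|$ operator norm, $\|\cdot\|_F$ Frobenius norm); they are set to $\infty$ when $A_{\lambda,v}$ is not invertible. *)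

theory Defs
  imports "HOL-Analysis.Analysis"
begin

definition frob_norm :: "complex^'n^'n \<Rightarrow> real" where
  "frob_norm A = sqrt (\<Sum>i\<in>UNIV. \<Sum>j\<in>UNIV. (cmod (A $ i $ j))^2)"

definition hinner :: "complex^'n \<Rightarrow> complex^'n \<Rightarrow> complex" where
  "hinner v w = (\<Sum>i\<in>UNIV. cnj (v $ i) * w $ i)"

definition hperp :: "complex^'n \<Rightarrow> (complex^'n) set" where
  "hperp v = {w. hinner v w = 0}"

definition proj_perp :: "complex^'n \<Rightarrow> complex^'n \<Rightarrow> complex^'n" where
  "proj_perp v w = w - (hinner v w / hinner v v) *s v"

definition A_lv :: "complex^'n^'n \<Rightarrow> complex \<Rightarrow> complex^'n \<Rightarrow> complex^'n \<Rightarrow> complex^'n" where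
  "A_lv A l v w = proj_perp v (l *s w - A *v w)"

definition A_lv_invertible :: "complex^'n^'n \<Rightarrow> complex \<Rightarrow> complex^'n \<Rightarrow> bool" where
  "A_lv_invertible A l v \<longleftrightarrow> bij_betw (A_lv A l v) (hperp v) (hperp v)"

text \<open>The inverse of A_{lambda,v} : v^perp \<rightarrow> v^perp, extended by zero on span{v}
  (i.e. precomposed with the orthogonal projection onto v^perp); its operator norm and
  Frobenius norm coincide with those of the inverse as an operator on v^perp.\<close>
definition A_lv_inv_ext :: "complex^'n^'n \<Rightarrow> complex \<Rightarrow> complex^'n \<Rightarrow> complex^'n \<Rightarrow> complex^'n" where
  "A_lv_inv_ext A l v w = inv_into (hperp v) (A_lv A l v) (proj_perp v w)"

definition op_norm_inv :: "complex^'n^'n \<Rightarrow> complex \<Rightarrow> complex^'n \<Rightarrow> real" where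
  "op_norm_inv A l v = onorm (A_lv_inv_ext A l v)"

definition frob_norm_inv :: "complex^'n^'n \<Rightarrow> complex \<Rightarrow> complex^'n \<Rightarrow> real" where
  "frob_norm_inv A l v = sqrt (\<Sum>j\<in>UNIV. (norm (A_lv_inv_ext A l v (axis j 1)))^2)"

definition mu :: "complex^'n^'n \<Rightarrow> complex \<Rightarrow> complex^'n \<Rightarrow> ennreal" where
  "mu A l v = (if A_lv_invertible A l v
               then ennreal (max 1 (frob_norm A * op_norm_inv A l v)) else \<infinity>)"

definition mu_F :: "complex^'n^'n \<Rightarrow> complex \<Rightarrow> complex^'n \<Rightarrow> ennreal" where
  "mu_F A l v = (if A_lv_invertible A l v
               then ennreal (max 1 (frob_norm A * frob_norm_inv A l v)) else \<infinity>)"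

text \<open>Points of the projective space P(C^n): complex lines through a nonzero vector.\<close>
definition cline :: "complex^'n \<Rightarrow> (complex^'n) set" where
  "cline v = {c *s v | c. True}"

definition eigenpairs :: "complex^'n^'n \<Rightarrow> (complex \<times> (complex^'n) set) set" where
  "eigenpairs A = {(l, cline v) | l v. v \<noteq> 0 \<and> A *v v = l *s v}"

text \<open>A representative nonzero vector of a line (mu, mu_F do not depend on the choice).\<close>
definition line_rep :: "(complex^'n) set \<Rightarrow> complex^'n" where
  "line_rep L = (SOME v. v \<in> L \<and> v \<noteq> 0)"

text \<open>Sum over all eigenpairs of A of f(A,lambda,v), as an ennreal-valued sum over a
  possibly infinite set (sum w.r.t. counting measure).\<close>
definition eigsum :: "(complex^'n^'n \<Rightarrow> complex \<Rightarrow> complex^'n \<Rightarrow> ennreal) \<Rightarrow> complex^'n^'n \<Rightarrow> ennreal" where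
  "eigsum f A = (\<integral>\<^sup>+ p. f A (fst p) (line_rep (snd p)) \<partial>count_space (eigenpairs A))"

definition gauss_density :: "real \<Rightarrow> complex^'n^'n \<Rightarrow> complex^'n^'n \<Rightarrow> real" where
  "gauss_density s Ahat A =
     (\<Prod>i\<in>UNIV. \<Prod>j\<in>UNIV. exp (- ((cmod (A $ i $ j - Ahat $ i $ j))^2) / (s^2)) / (pi * s^2))"

definition gauss_matrix :: "real \<Rightarrow> complex^'n^'n \<Rightarrow> (complex^'n^'n) measure" where
  "gauss_matrix s Ahat = density lborel (\<lambda>A. ennreal (gauss_density s Ahat A))"

text \<open>Uniform distribution on the unit sphere of C^{n x n} (Frobenius norm): the
  image of the uniform distribution on the unit ball under A \<mapsto> A / ||A||_F
  (normalized surface measure, via the cone construction).\<close>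
definition sphere_uniform :: "(complex^'n^'n) measure" where
  "sphere_uniform = distr (uniform_measure lborel (ball 0 1)) borel (\<lambda>A. A /\<^sub>R norm A)"

end

(* The inverse of A restricted to the orthogonal complement of an eigenvector v governs the
   derivative of v: perturbing A in direction N moves v by A_lv^{-1} N v. Let D_u(A) be the determinant
   with rows u A^k, 0 <= k < n, a polynomial in A of degree n(n-1)/2. If A has n distinct
   eigenvalues with eigenvectors v_i, then D_u(A) is a nonzero multiple of the product of the
   linear forms u . v_i, so the zero set of D_u tracks the eigenvectors orthogonal to u.

   Upper bound: f = log (|D_u|^2 + e) is smooth and plurisubharmonic in A with complex Laplacian
   e |grad D_u|^2 / (|D_u|^2 + e)^2. Integrating by parts against (q - |A - C|^2)_+ leaves the integral
   of the radial derivative of f over a ball; its average over a circle is at most the degree of D_u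
   (Jensen). Superposing balls gives the Gaussian weight, and a radial change of weight gives the sphere.

   Lower bound: for fixed A and Gaussian u, as e tends to 0 the energy concentrates on the
   hyperplanes u . v_i = 0, where it becomes the sum of the squared Frobenius norms of the inverses.
   By Fatou, the expectation of this sum is at most n(n-1)/(2 s^2).

   The maximum with 1 in mu_F costs at most a factor 2, because |A|_F |A_lv^{-1}| >= 1 / sqrt 2. *)
theory Submission
  imports Defs "HOL-Probability.Probability" "HOL-Computational_Algebra.Fundamental_Theorem_Algebra"
begin

section \<open>Circle means of logarithmic gradients of polynomials\<close>

text \<open>\<open>D_u\<close> vanishes exactly when u, u A, ... fail to span, that is, for distinct
  eigenvalues, when u annihilates some eigenvector. It is a polynomial in the entries of A, so no
  branch of eigenvectors has to be followed over the space of matrices; perturbation theory enters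
  only to first order, at one fixed matrix. Off its zeros log |D_u| is pluriharmonic, so its
  Laplacian is a measure on the zero set. Adding e spreads this measure into a smooth density, and
  the degree bounds the result uniformly in e and u.

  Measurability of the sum over eigenpairs as a function of A is never established. All estimates
  are made for a measurable majorant, the liminf of the averaged energies, which dominates the sum
  almost everywhere.

  Constants: the degree n(n-1)/2, the factor 2 from the maximum and the average over n eigenpairs
  give (n-1)/s^2 for the Gaussian. On the sphere the change of weight contributes n^2 - 1, which
  gives (n^2-1)(n-1), below n^3.\<close>

lemma has_vector_derivative_log_gradient:
  fixes a p :: "real \<Rightarrow> complex"
  assumes a: "(a has_vector_derivative a') (at t within U)"
    and p: "(p has_vector_derivative p') (at t within U)" and "e > 0"
  shows "((\<lambda>t. p t * cnj (a t) / of_real ((cmod (a t))\<^sup>2 + e)) has_vector_derivative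
     (p' * cnj (a t) + p t * cnj a') / of_real ((cmod (a t))\<^sup>2 + e)
     - p t * cnj (a t) * of_real (2 * (a t \<bullet> a')) / (of_real ((cmod (a t))\<^sup>2 + e))\<^sup>2) (at t within U)"
proof -
  have q: "((\<lambda>t. a t \<bullet> a t + e) has_vector_derivative a t \<bullet> a' + a' \<bullet> a t) (at t within U)"
    using has_vector_derivative_add_const bounded_bilinear.has_vector_derivative[OF bounded_bilinear_inner a a]
    by (metis has_vector_derivative_add_const)
  have q': "((\<lambda>t. (cmod (a t))\<^sup>2 + e) has_real_derivative 2 * (a t \<bullet> a')) (at t within U)"
    using q by (simp add: has_real_derivative_iff_has_vector_derivative dot_square_norm inner_commute)
  have pos: "(cmod (a t))\<^sup>2 + e \<noteq> 0" using \<open>e > 0\<close>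
    by (smt (verit) zero_le_power2)
  have i: "((\<lambda>t. inverse ((cmod (a t))\<^sup>2 + e)) has_real_derivative
      - (inverse ((cmod (a t))\<^sup>2 + e) * (2 * (a t \<bullet> a')) * inverse ((cmod (a t))\<^sup>2 + e))) (at t within U)"
    by (rule DERIV_inverse'[OF q' pos])
  have m: "((\<lambda>t. p t * cnj (a t)) has_vector_derivative p t * cnj a' + p' * cnj (a t)) (at t within U)"
    by (rule has_vector_derivative_mult[OF p has_vector_derivative_cnj[OF a]])
  have "((\<lambda>t. inverse ((cmod (a t))\<^sup>2 + e) *\<^sub>R (p t * cnj (a t))) has_vector_derivative
     inverse ((cmod (a t))\<^sup>2 + e) *\<^sub>R (p t * cnj a' + p' * cnj (a t)) + - (inverse ((cmod (a t))\<^sup>2 + e) * (2 * (a t \<bullet> a')) * inverse ((cmod (a t))\<^sup>2 + e)) *\<^sub>R (p t * cnj (a t))) (at t within U)"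
    by (rule has_vector_derivative_scaleR[OF i m])
  moreover have e1: "inverse Q *\<^sub>R x = x / of_real Q" for x :: complex and Q
    by (simp add: scaleR_conv_of_real divide_inverse mult.commute)
  moreover have e2: "inverse Q *\<^sub>R (x + y) + - (inverse Q * k * inverse Q) *\<^sub>R z = (y + x) / of_real Q - z * of_real k / (of_real Q)\<^sup>2"
    for x y z :: complex and k Q
    by (simp add: scaleR_conv_of_real divide_inverse power2_eq_square algebra_simps)
  ultimately show ?thesis unfolding e2 unfolding e1 by blast
qed

text \<open>This is the polar identity r d/dr + i d/dt = 2 cnj(z) d/d(cnj z), applied to z q' cnj(q)
  / (|q|^2 + e), where \<open>a\<close>, \<open>b\<close>, \<open>c\<close> are the values of q, q',
  q'' at z. Only cnj(q) and the denominator depend on cnj z; in the quotient rule |q|^2 cancels and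
  e |q'|^2 / Q^2 is left.\<close>

lemma circle_log_gradient_identity:
  fixes a b c z :: complex and r e :: real
  assumes e: "e > 0" and z: "z = of_real r * w"
  defines "Q \<equiv> (cmod a)\<^sup>2 + e"
  shows "of_real r * ((w * (b + z * c) * cnj a + z * b * cnj (b * w)) / of_real Q
       - z * b * cnj a * of_real (2 * (a \<bullet> (b * w))) / (of_real Q)\<^sup>2)
    + \<i> * ((\<i> * z * (b + z * c) * cnj a + z * b * cnj (b * (\<i> * z))) / of_real Q
       - z * b * cnj a * of_real (2 * (a \<bullet> (b * (\<i> * z)))) / (of_real Q)\<^sup>2)
    = of_real (2 * e * (cmod (z * b))\<^sup>2 / Q\<^sup>2)"
proof -
  have Q0: "Q \<noteq> 0" unfolding Q_def using e by (smt (verit) zero_le_power2)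
  have in1: "complex_of_real (2 * (x \<bullet> y)) = cnj x * y + x * cnj y" for x y
    by (simp add: complex_eq_iff inner_complex_def)
  have Qc: "of_real Q = a * cnj a + of_real e"
    unfolding Q_def of_real_add complex_norm_square ..
  have nn: "complex_of_real ((cmod (z*b))\<^sup>2) = z * b * cnj (z * b)"
    by (rule complex_norm_square)
  have Qc0: "complex_of_real Q \<noteq> 0" using Q0 by simp
  have rhs: "complex_of_real (2 * e * (cmod (z * b))\<^sup>2 / Q\<^sup>2) = 2 * of_real e * (z * b * cnj (z * b)) / (of_real Q)\<^sup>2"
    unfolding of_real_divide of_real_mult[of "2*e"] nn by simp
  \<comment> \<open>Once denominators are cleared and \<open>Q\<close> is expanded as a * cnj a + e,
    a polynomial identity in the values and their conjugates remains.\<close>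
  have iff: "?thesis \<longleftrightarrow> of_real r * ((w * (b + z * c) * cnj a + z * b * cnj (b * w)) * of_real Q
       - z * b * cnj a * (cnj a * (b * w) + a * cnj (b * w)))
    + \<i> * ((\<i> * z * (b + z * c) * cnj a + z * b * cnj (b * (\<i> * z))) * of_real Q
       - z * b * cnj a * (cnj a * (b * (\<i> * z)) + a * cnj (b * (\<i> * z))))
    = 2 * of_real e * (z * b * cnj (z * b))"
    unfolding rhs unfolding in1 using Qc0
    by (simp add: divide_simps power2_eq_square del: complex_cnj_mult)
  show ?thesis by (rule iffD2[OF iff]) (simp add: Qc z algebra_simps)
qed
text \<open>The integrand is half the radial derivative of log (|q|^2 + e), a subharmonic function.
  The integral \<open>J r\<close> over the circle of radius r vanishes at r = 0 and does not
  decrease: by the preceding identity, r times its derivative is the integral of a nonnegative term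
  and of an angular derivative, and the latter vanishes over a full period.\<close>

lemma circle_log_gradient_nonneg:
  fixes q :: "complex poly" and e :: real
  assumes e: "e > 0"
  shows "0 \<le> integral {0..2*pi} (\<lambda>t. Re (cis t * poly (pderiv q) (cis t) * cnj (poly q (cis t))
            / of_real ((cmod (poly q (cis t)))\<^sup>2 + e)))"
proof -
  define Q where "Q z = (cmod (poly q z))\<^sup>2 + e" for z
  have Qpos: "Q z > 0" for z unfolding Q_def using e by (simp add: add_nonneg_pos)
  then have Qc: "complex_of_real (Q z) \<noteq> 0" for z by (metis less_irrefl of_real_eq_0_iff)
  define L where "L r t = (of_real r * cis t) * poly (pderiv q) (of_real r * cis t) * cnj (poly q (of_real r * cis t))
     / of_real (Q (of_real r * cis t))" for r t
  define D where "D w z = ((w * (poly (pderiv q) z + z * poly (pderiv (pderiv q)) z) * cnj (poly q z)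
        + z * poly (pderiv q) z * cnj (poly (pderiv q) z * w)) / of_real (Q z)
       - z * poly (pderiv q) z * cnj (poly q z) * of_real (2 * (poly q z \<bullet> (poly (pderiv q) z * w))) / (of_real (Q z))\<^sup>2)" for w z
  \<comment> \<open>\<open>g\<close> is any curve with velocity \<open>w\<close>; it is used for the
    rays and for the circles.\<close>
  have gen: "((\<lambda>s. g s * poly (pderiv q) (g s) * cnj (poly q (g s)) / of_real (Q (g s))) has_vector_derivative D w (g s)) (at s within U)"
    if g: "(g has_vector_derivative w) (at s within U)" for g w s U
  proof -
    have a: "((\<lambda>s. poly p (g s)) has_vector_derivative w * poly (pderiv p) (g s)) (at s within U)" for p
      using field_vector_diff_chain_within[OF g has_field_derivative_at_within[OF poly_DERIV], of p]
      by (simp add: o_def)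
    have p: "((\<lambda>s. g s * poly (pderiv q) (g s)) has_vector_derivative w * (poly (pderiv q) (g s) + g s * poly (pderiv (pderiv q)) (g s))) (at s within U)"
      using has_vector_derivative_mult[OF g a[of "pderiv q"]] by (simp add: algebra_simps)
    show ?thesis
      using has_vector_derivative_log_gradient[OF a[of q] p e] unfolding D_def Q_def
      by (simp add: mult.commute)
  qed
  have Lr: "((\<lambda>r. L r t) has_vector_derivative D (cis t) (of_real r * cis t)) (at r within U)" for r t U
    unfolding L_def
  proof (rule gen)
    show "((\<lambda>r. complex_of_real r * cis t) has_vector_derivative cis t) (at r within U)"
      unfolding scaleR_conv_of_real[symmetric] by (auto intro!: derivative_eq_intros)
  qed
  have Lt: "((\<lambda>t. L r t) has_vector_derivative D (\<i> * (of_real r * cis t)) (of_real r * cis t)) (at t within U)" for r t U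
    unfolding L_def
  proof (rule gen)
    show "((\<lambda>t. complex_of_real r * cis t) has_vector_derivative \<i> * (of_real r * cis t)) (at t within U)"
      unfolding cis_conv_exp
      by (auto intro!: derivative_eq_intros has_vector_derivative_real_field simp: mult_ac)
  qed
  have id: "r * Re (D (cis t) (of_real r * cis t)) - Im (D (\<i> * (of_real r * cis t)) (of_real r * cis t)) \<ge> 0" for r t
  proof -
    have "of_real r * D (cis t) (of_real r * cis t) + \<i> * D (\<i> * (of_real r * cis t)) (of_real r * cis t) =
       of_real (2 * e * (cmod (of_real r * cis t * poly (pderiv q) (of_real r * cis t)))\<^sup>2 / (Q (of_real r * cis t))\<^sup>2)"
      using circle_log_gradient_identity[OF e refl, of r "cis t" "poly (pderiv q) (of_real r * cis t)" "poly (pderiv (pderiv q)) (of_real r * cis t)" "poly q (of_real r * cis t)"]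
      unfolding D_def Q_def by simp
    from arg_cong[OF this, of Re] show ?thesis using e by simp
  qed
  have contD: "continuous_on S (\<lambda>x. D (f x) (g x))" if "continuous_on S f" "continuous_on S g" for f g and S :: "'x::topological_space set"
  proof -
    have "continuous_on S (\<lambda>x. complex_of_real (Q (g x)))"
      unfolding Q_def using that by (intro continuous_intros)
    then show ?thesis unfolding D_def using that Qc by (intro continuous_intros) simp_all
  qed
  define J where "J r = integral (cbox 0 (2*pi)) (L r)" for r
  have cL: "continuous_on S (L r)" for S r
    by (rule continuous_on_vector_derivative[OF Lt])
  have Jd: "(J has_vector_derivative integral (cbox 0 (2*pi)) (\<lambda>t. D (cis t) (of_real r * cis t))) (at r)" for r
    unfolding J_def
  proof (rule leibniz_rule_vector_derivative[where U = UNIV and fx="\<lambda>r t. D (cis t) (of_real r * cis t)"])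
    show "((\<lambda>r. L r t) has_vector_derivative D (cis t) (of_real r * cis t)) (at r)" for r t by (rule Lr)
    show "L r integrable_on cbox 0 (2*pi)" for r
      by (rule integrable_continuous[OF cL])
    show "continuous_on (UNIV \<times> cbox 0 (2*pi)) (\<lambda>(r, t). D (cis t) (complex_of_real r * cis t))"
      unfolding split_beta by (intro contD continuous_intros)
  qed auto
  have nonneg: "0 \<le> Re (integral (cbox 0 (2*pi)) (\<lambda>t. D (cis t) (of_real r * cis t)))" if r: "r > 0" for r
  proof -
    have i1: "(\<lambda>t. D (cis t) (of_real r * cis t)) integrable_on {0..2*pi}"
      by (intro integrable_continuous_interval contD continuous_intros)
    have i2: "((\<lambda>t. D (\<i> * (of_real r * cis t)) (of_real r * cis t)) has_integral L r (2*pi) - L r 0) {0..2*pi}"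
      by (rule fundamental_theorem_of_calculus) (use Lt in auto)
    have "((\<lambda>t. r * Re (D (cis t) (of_real r * cis t)) - Im (D (\<i> * (of_real r * cis t)) (of_real r * cis t))) has_integral
       r * Re (integral {0..2*pi} (\<lambda>t. D (cis t) (of_real r * cis t))) - Im (L r (2*pi) - L r 0)) {0..2*pi}"
      by (intro has_integral_diff has_integral_mult_right has_integral_linear[OF integrable_integral[OF i1] bounded_linear_Re, unfolded o_def]
           has_integral_linear[OF i2 bounded_linear_Im, unfolded o_def])
    then have "r * Re (integral {0..2*pi} (\<lambda>t. D (cis t) (of_real r * cis t))) - Im (L r (2*pi) - L r 0) \<ge> 0"
      by (rule has_integral_nonneg) (use id in auto)
    moreover have "L r (2*pi) = L r 0" unfolding L_def by simp
    ultimately show ?thesis using r by (simp add: zero_le_mult_iff)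
  qed
  have "Re (J 0) \<le> Re (J 1)"
  proof (rule DERIV_nonneg_imp_increasing_open[of 0 1 "\<lambda>r. Re (J r)"])
    show "\<exists>y. ((\<lambda>r. Re (J r)) has_real_derivative y) (at x) \<and> 0 \<le> y" if "0 < x" for x
      using nonneg[OF that] bounded_linear.has_vector_derivative[OF bounded_linear_Re Jd[of x]]
      unfolding has_real_derivative_iff_has_vector_derivative by (intro exI conjI)
    show "continuous_on {0..1} (\<lambda>r. Re (J r))"
      by (intro continuous_on_Re continuous_on_vector_derivative[OF has_vector_derivative_at_within[OF Jd]])
  qed simp
  moreover have "J 0 = 0" unfolding J_def L_def by simp
  moreover have "Re (J 1) = integral {0..2*pi} (\<lambda>t. Re (L 1 t))"
    unfolding J_def using integral_linear[OF integrable_continuous_interval[OF cL] bounded_linear_Re, of 0 "2*pi" 1]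
    by (simp add: o_def)
  ultimately show ?thesis unfolding L_def Q_def by simp
qed

lemma pderiv_sum: "pderiv (\<Sum>x\<in>A. f x) = (\<Sum>x\<in>A. pderiv (f x))"
  by (induction A rule: infinite_finite_induct) (auto simp: pderiv_add)

text \<open>\<open>q\<close> is the reversed polynomial z^d cnj (p (1 / cnj z)). On the unit circle
  |q| = |p|, and the logarithmic gradients of p and q add up to d |p|^2 / (|p|^2 + e), which is at
  most d. Since that of q has nonnegative mean, that of p has mean at most d. No information on the
  zeros of p enters.\<close>

lemma circle_log_gradient_le_degree:
  fixes p :: "complex poly" and e :: real
  assumes e: "e > 0" and d: "degree p \<le> d"
  shows "integral {0..2*pi} (\<lambda>t. Re (cis t * poly (pderiv p) (cis t) * cnj (poly p (cis t))
            / of_real ((cmod (poly p (cis t)))\<^sup>2 + e))) \<le> 2 * pi * d"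
proof -
  define q where "q = (\<Sum>k\<le>d. monom (cnj (coeff p k)) (d - k))"
  define f where "f p t = Re (cis t * poly (pderiv p) (cis t) * cnj (poly p (cis t)) / of_real ((cmod (poly p (cis t)))\<^sup>2 + e))" for p t
  have pp: "p = (\<Sum>k\<le>d. monom (coeff p k) k)"
    using d by (metis poly_as_sum_of_monoms')
  have pe: "poly p z = (\<Sum>k\<le>d. coeff p k * z ^ k)" for z
    by (subst pp) (simp add: poly_sum poly_monom)
  \<comment> \<open>For k = 0 the exponent k - 1 is truncated to 0, but then the factor
    \<open>of_nat k\<close> vanishes.\<close>
  have zk: "z * (of_nat k * c * z ^ (k - 1)) = of_nat k * c * z ^ k" for z c :: complex and k
    by (cases k) auto
  have p': "z * poly (pderiv p) z = (\<Sum>k\<le>d. of_nat k * coeff p k * z ^ k)" for z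
    by (subst pp) (simp add: pderiv_sum pderiv_monom poly_sum poly_monom sum_distrib_left zk del: One_nat_def)
  have q0: "poly q z = (\<Sum>k\<le>d. cnj (coeff p k) * z ^ (d - k))" for z
    unfolding q_def by (simp add: poly_sum poly_monom)
  have q'0: "z * poly (pderiv q) z = (\<Sum>k\<le>d. of_nat (d - k) * cnj (coeff p k) * z ^ (d - k))" for z
    unfolding q_def by (simp only: pderiv_sum pderiv_monom poly_sum poly_monom sum_distrib_left zk)
  have ck: "cis t ^ (d - k) = cis t ^ d * cnj (cis t ^ k)" if "k \<le> d" for t k
  proof -
    have "cis t ^ k * cnj (cis t ^ k) = 1"
      by (metis complex_norm_square norm_power norm_cis power_one of_real_1)
    moreover have "cis t ^ d = cis t ^ (d - k) * cis t ^ k" using that by (simp flip: power_add)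
    ultimately show ?thesis by (simp add: mult.assoc)
  qed
  have q: "poly q (cis t) = cis t ^ d * cnj (poly p (cis t))" for t
    unfolding q0 pe cnj_sum sum_distrib_left
    by (rule sum.cong) (auto simp: ck[simplified] mult_ac simp del: Complex.DeMoivre)
  have q': "cis t * poly (pderiv q) (cis t) = of_nat d * poly q (cis t) - cis t ^ d * cnj (cis t * poly (pderiv p) (cis t))" for t
    unfolding q'0 p' q0 cnj_sum sum_distrib_left sum_subtractf[symmetric]
    by (rule sum.cong) (auto simp: ck[simplified] of_nat_diff algebra_simps simp del: Complex.DeMoivre)
  have key: "f p t = d - (d * e / ((cmod (poly p (cis t)))\<^sup>2 + e) + f q t)" for t
  proof -
    define P where "P = poly p (cis t)"
    define P1 where "P1 = cis t * poly (pderiv p) (cis t)"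
    define R where "R = (cmod P)\<^sup>2 + e"
    have R: "R > 0" unfolding R_def using e by (simp add: add_nonneg_pos)
    have n1: "cmod (cis t ^ d) = 1" by (simp add: norm_power)
    have nq: "cmod (poly q (cis t)) = cmod P" unfolding q P_def by (simp add: norm_mult n1 del: Complex.DeMoivre)
    have "cis t * poly (pderiv q) (cis t) * cnj (poly q (cis t))
        = (cis t ^ d * cnj (cis t ^ d)) * (of_nat d * (P * cnj P) - cnj P1 * P)"
      unfolding q' unfolding q P_def P1_def by (simp add: algebra_simps del: Complex.DeMoivre)
    also have "\<dots> = of_nat d * (P * cnj P) - cnj P1 * P"
      by (simp only: complex_norm_square[symmetric] n1) simp
    finally have "f q t = (d * (cmod P)\<^sup>2 - Re (P1 * cnj P)) / R"
      unfolding f_def nq R_def[symmetric] by (simp add: complex_norm_square[symmetric] Re_divide_of_real)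
    moreover have "f p t = Re (P1 * cnj P) / R"
      unfolding f_def P_def P1_def R_def by (simp only: Re_divide_of_real)
    moreover have "(cmod P)\<^sup>2 = R - e" unfolding R_def by simp
    ultimately show ?thesis unfolding P_def[symmetric] R_def[symmetric] using R by (simp add: field_simps)
  qed
  have cf: "f p integrable_on {0..2*pi}" for p
  proof -
    have "(cmod z)\<^sup>2 + e \<noteq> 0" for z using e by (smt (verit) zero_le_power2)
    then show ?thesis unfolding f_def by (intro integrable_continuous_interval continuous_intros) (simp del: of_real_add)
  qed
  have "integral {0..2*pi} (f p) \<le> integral {0..2*pi} (\<lambda>t. d - f q t)"
    by (rule integral_le) (use cf key e in \<open>auto intro!: integrable_diff divide_nonneg_nonneg simp: add_nonneg_nonneg\<close>)
  also have "\<dots> \<le> 2 * pi * d"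
    using circle_log_gradient_nonneg[OF e, of q] cf unfolding f_def[symmetric]
    by (subst integral_diff) auto
  finally show ?thesis unfolding f_def .
qed

section \<open>Invariance of Lebesgue measure and integration by parts\<close>

lemma nn_integral_lborel_translate:
  fixes f :: "'a::euclidean_space \<Rightarrow> ennreal"
  assumes [measurable]: "f \<in> borel_measurable borel"
  shows "(\<integral>\<^sup>+x. f (x + c) \<partial>lborel) = (\<integral>\<^sup>+x. f x \<partial>lborel)"
  by (subst (2) lborel_distr_plus[of c, symmetric]) (simp add: nn_integral_distr add.commute)

lemma integral_lborel_translate:
  fixes f :: "'a::euclidean_space \<Rightarrow> 'b::{banach, second_countable_topology}"
  assumes [measurable]: "f \<in> borel_measurable borel"
  shows "(\<integral>x. f (x + c) \<partial>lborel) = (\<integral>x. f x \<partial>lborel)"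
  by (subst (2) lborel_distr_plus[of c, symmetric]) (simp add: integral_distr add.commute)

lemma integrable_lborel_translate:
  fixes f :: "'a::euclidean_space \<Rightarrow> 'b::{banach, second_countable_topology}"
  assumes f: "integrable lborel f"
  shows "integrable lborel (\<lambda>x. f (x + c))"
proof -
  have [measurable]: "f \<in> borel_measurable borel" using f by auto
  show ?thesis using f
    by (subst (asm) lborel_distr_plus[of c, symmetric]) (simp add: integrable_distr_eq add.commute)
qed

text \<open>The image measure is translation invariant and agrees with Lebesgue measure on the unit
  ball; Fubini for the two translation-invariant measures turns this into equality.\<close>
lemma lborel_distr_isometry:
  fixes T :: "'a::euclidean_space \<Rightarrow> 'a"
  assumes T: "linear T" and iso: "\<And>x. norm (T x) = norm x"
  shows "distr lborel borel T = lborel"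
proof -
  have cont: "continuous_on UNIV T" by (rule linear_continuous_on[OF linear_conv_bounded_linear[THEN iffD1, OF T]])
  have inj: "inj T" using T iso by (metis linear_injective_0 norm_eq_zero)
  then have surj: "surj T" using T linear_injective_imp_surjective by blast
  have [measurable]: "T \<in> borel_measurable borel" by (rule borel_measurable_continuous_onI[OF cont])
  define N where "N = distr lborel borel T"
  have sN[measurable_cong]: "sets N = sets borel" unfolding N_def by simp
  have trans: "(\<integral>\<^sup>+y. f (y + c) \<partial>N) = (\<integral>\<^sup>+y. f y \<partial>N)" if [measurable]: "f \<in> borel_measurable borel" for f :: "'a \<Rightarrow> ennreal" and c
  proof -
    obtain c' where c': "c = T c'" using surj by auto
    have "(\<integral>\<^sup>+y. f (y + c) \<partial>N) = (\<integral>\<^sup>+y. f (T (y + c')) \<partial>lborel)"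
      unfolding N_def c' by (simp add: nn_integral_distr linear_add[OF T])
    also have "\<dots> = (\<integral>\<^sup>+y. f (T y) \<partial>lborel)" by (rule nn_integral_lborel_translate) measurable
    also have "\<dots> = (\<integral>\<^sup>+y. f y \<partial>N)" unfolding N_def by (simp add: nn_integral_distr)
    finally show ?thesis .
  qed
  define B :: "'a set" where "B = ball 0 1"
  have [measurable]: "B \<in> sets borel" unfolding B_def by simp
  have NB: "emeasure N B = emeasure lborel B"
  proof -
    have "T -` B = B" unfolding B_def using iso by auto
    then show ?thesis unfolding N_def by (simp add: emeasure_distr)
  qed
  have eB: "emeasure lborel B \<noteq> \<infinity>" "emeasure lborel B \<noteq> 0"
    unfolding B_def using unit_ball_vol_pos[of "real DIM('a)"] by (auto simp: emeasure_ball simp del: unit_ball_vol_pos)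
  have sf: "sigma_finite_measure N"
  proof
    have "(\<Union>n. ball 0 (real n)) = (UNIV::'a set)"
      by (auto simp: reals_Archimedean2)
    moreover have "emeasure N (ball 0 (real n)) \<noteq> \<infinity>" for n
    proof -
      have "T -` ball 0 (real n) = ball 0 (real n)" using iso by auto
      then show ?thesis unfolding N_def using emeasure_lborel_ball_finite by (simp add: emeasure_distr less_top)
    qed
    ultimately show "\<exists>A. countable A \<and> A \<subseteq> sets N \<and> \<Union> A = space N \<and> (\<forall>a\<in>A. emeasure N a \<noteq> \<infinity>)"
      by (intro exI[of _ "range (\<lambda>n. ball 0 (real n))"]) (auto simp: N_def)
  qed
  interpret P: pair_sigma_finite lborel N
    using sf by (simp add: pair_sigma_finite_def sigma_finite_lborel)
  have eq: "emeasure N S = emeasure lborel S" if [measurable]: "S \<in> sets borel" for S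
  proof -
    have "emeasure lborel B * emeasure N S = (\<integral>\<^sup>+x. (\<integral>\<^sup>+y. indicator B x * indicator S y \<partial>N) \<partial>lborel)"
      by (simp add: nn_integral_cmult nn_integral_multc sN)
    also have "\<dots> = (\<integral>\<^sup>+x. (\<integral>\<^sup>+y. indicator B x * indicator S (y + x) \<partial>N) \<partial>lborel)"
      by (intro nn_integral_cong trans[symmetric]) measurable
    also have "\<dots> = (\<integral>\<^sup>+y. (\<integral>\<^sup>+x. indicator B x * indicator S (y + x) \<partial>lborel) \<partial>N)"
      by (rule P.Fubini'[symmetric]) measurable
    also have "\<dots> = (\<integral>\<^sup>+y. (\<integral>\<^sup>+x. indicator B (x + - y) * indicator S (y + (x + - y)) \<partial>lborel) \<partial>N)"
      by (intro nn_integral_cong nn_integral_lborel_translate[symmetric]) measurable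
    also have "\<dots> = (\<integral>\<^sup>+x. (\<integral>\<^sup>+y. indicator B (x + - y) * indicator S (y + (x + - y)) \<partial>N) \<partial>lborel)"
      by (rule P.Fubini') measurable
    also have "\<dots> = (\<integral>\<^sup>+x. emeasure N B * indicator S x \<partial>lborel)"
    \<comment> \<open>The ball is symmetric, so x - y may be replaced by y - x; translation
      invariance of \<open>N\<close> then turns the inner integral into
      \<open>emeasure N B\<close>.\<close>
    proof (intro nn_integral_cong)
      fix x
      have "(\<integral>\<^sup>+y. indicator B (x + - y) * indicator S (y + (x + - y)) \<partial>N) = (\<integral>\<^sup>+y. indicator B (y + - x) * indicator S x \<partial>N)"
        by (intro nn_integral_cong) (auto simp: indicator_def B_def norm_minus_commute)
      also have "\<dots> = (\<integral>\<^sup>+y. indicator B (y + -x) \<partial>N) * indicator S x"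
        by (rule nn_integral_multc) measurable
      also have "(\<integral>\<^sup>+y. indicator B (y + -x) \<partial>N) = (\<integral>\<^sup>+y. indicator B y \<partial>N)"
        by (rule trans) measurable
      finally show "(\<integral>\<^sup>+y. indicator B (x + - y) * indicator S (y + (x + - y)) \<partial>N) = emeasure N B * indicator S x"
        by (simp add: sN)
    qed
    also have "\<dots> = emeasure lborel B * emeasure lborel S"
      by (simp add: nn_integral_cmult NB)
    finally show ?thesis using eB by (simp add: ennreal_mult_cancel_left)
  qed
  show ?thesis unfolding N_def[symmetric]
    by (rule measure_eqI) (auto simp: sN eq)
qed

lemma integral_lborel_isometry:
  fixes T :: "'a::euclidean_space \<Rightarrow> 'a" and f :: "'a \<Rightarrow> 'b::{banach, second_countable_topology}"
  assumes T: "linear T" "\<And>x. norm (T x) = norm x" and [measurable]: "f \<in> borel_measurable borel"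
  shows "(\<integral>x. f (T x) \<partial>lborel) = (\<integral>x. f x \<partial>lborel)"
proof -
  have [measurable]: "T \<in> borel_measurable borel"
    using T(1) by (intro borel_measurable_continuous_onI linear_continuous_on) (simp add: linear_conv_bounded_linear)
  show ?thesis
    by (subst (2) lborel_distr_isometry[OF T, symmetric]) (simp add: integral_distr)
qed

text \<open>Each difference quotient has integral zero by translation invariance, and the Lipschitz
  bound on a ball dominates all of them. The derivative is required only almost everywhere because
  the truncated weight has a kink on a sphere. The ball is enlarged by \<open>norm b\<close>: from
  outside it, a step of length at most \<open>norm b\<close> cannot reach the support.\<close>

lemma integral_directional_derivative_eq_0:
  fixes f f' :: "'a::euclidean_space \<Rightarrow> complex"
  assumes int: "integrable lborel f" and supp: "\<And>x. x \<notin> cball c R \<Longrightarrow> f x = 0"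
    and lip: "\<And>x t. x \<in> cball c (R + norm b) \<Longrightarrow> 0 < t \<Longrightarrow> t \<le> 1 \<Longrightarrow> norm (f (x + t *\<^sub>R b) - f x) \<le> M * t"
    and deriv: "AE x in lborel. ((\<lambda>t. f (x + t *\<^sub>R b)) has_vector_derivative f' x) (at 0)"
    and [measurable]: "f' \<in> borel_measurable borel"
  shows "integrable lborel f'" "(\<integral>x. f' x \<partial>lborel) = 0"
proof -
  have [measurable]: "f \<in> borel_measurable borel" using int by auto
  define s where "s i x = real (Suc i) *\<^sub>R (f (x + (1 / real (Suc i)) *\<^sub>R b) - f x)" for i x
  define w where "w x = indicator (cball c (R + norm b)) x *\<^sub>R M" for x
  have m[measurable]: "s i \<in> borel_measurable borel" for i unfolding s_def by measurable
  have int_s: "(\<integral>x. s i x \<partial>lborel) = 0" for i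
    unfolding s_def using int
    by (simp add: integrable_lborel_translate integral_lborel_translate)
  have iw: "integrable lborel w" unfolding w_def
    by (rule integrable_scaleR_left integrable_real_indicator)+ (use emeasure_lborel_cball_finite in auto)
  have lim: "AE x in lborel. (\<lambda>i. s i x) \<longlonglongrightarrow> f' x"
    using deriv
  proof eventually_elim
    fix x assume "((\<lambda>t. f (x + t *\<^sub>R b)) has_vector_derivative f' x) (at 0)"
    then have d: "((\<lambda>h. norm (f (x + h *\<^sub>R b) - f x - h *\<^sub>R f' x) / norm h) \<longlongrightarrow> 0) (at 0)"
      unfolding has_vector_derivative_def has_derivative_at by simp
    have "((\<lambda>h. norm ((1 / h) *\<^sub>R (f (x + h *\<^sub>R b) - f x) - f' x)) \<longlongrightarrow> 0) (at 0)"
    proof (rule Lim_transform_eventually[OF d])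
      have "norm (f (x + h *\<^sub>R b) - f x - h *\<^sub>R f' x) / norm h = norm ((1 / h) *\<^sub>R (f (x + h *\<^sub>R b) - f x) - f' x)"
        if "h \<noteq> 0" for h
      proof -
        have "(1 / h) *\<^sub>R (f (x + h *\<^sub>R b) - f x) - f' x = (1 / h) *\<^sub>R (f (x + h *\<^sub>R b) - f x - h *\<^sub>R f' x)"
          using that by (simp add: algebra_simps)
        then show ?thesis by simp
      qed
      then show "\<forall>\<^sub>F h in at 0. norm (f (x + h *\<^sub>R b) - f x - h *\<^sub>R f' x) / norm h = norm ((1 / h) *\<^sub>R (f (x + h *\<^sub>R b) - f x) - f' x)"
        by (auto simp: eventually_at intro!: exI[of _ 1])
    qed
    then have "((\<lambda>h. (1 / h) *\<^sub>R (f (x + h *\<^sub>R b) - f x)) \<longlongrightarrow> f' x) (at 0)"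
      by (subst Lim_null) (rule tendsto_norm_zero_cancel)
    moreover have "filterlim (\<lambda>i. 1 / real (Suc i)) (at 0) sequentially"
      unfolding filterlim_at using LIMSEQ_Suc[OF lim_inverse_n'] by (simp del: of_nat_Suc)
    ultimately have "(\<lambda>i. (1 / (1 / real (Suc i))) *\<^sub>R (f (x + (1 / real (Suc i)) *\<^sub>R b) - f x)) \<longlonglongrightarrow> f' x"
      by (rule filterlim_compose)
    then show "(\<lambda>i. s i x) \<longlonglongrightarrow> f' x" unfolding s_def by simp
  qed
  have bd: "AE x in lborel. norm (s i x) \<le> w x" for i
  proof (rule AE_I2)
    fix x
    show "norm (s i x) \<le> w x"
    proof (cases "x \<in> cball c (R + norm b)")
      case True
      have "norm (f (x + (1 / real (Suc i)) *\<^sub>R b) - f x) \<le> M * (1 / real (Suc i))"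
        by (rule lip[OF True]) auto
      then have "real (Suc i) * norm (f (x + (1 / real (Suc i)) *\<^sub>R b) - f x) \<le> M"
        by (simp add: field_simps)
      then show ?thesis using True by (simp add: s_def w_def)
    next
      case False
      have "norm ((1 / real (Suc i)) *\<^sub>R b) \<le> norm b"
        by (simp add: divide_le_eq mult_le_cancel_left1 mult_le_cancel_right1)
      then have "x + (1 / real (Suc i)) *\<^sub>R b \<notin> cball c R"
        using False dist_triangle[of c x "x + (1 / real (Suc i)) *\<^sub>R b"]
        unfolding mem_cball by (simp only: dist_add_cancel2 dist_norm[of "x + (1 / real (Suc i)) *\<^sub>R b" x] add_diff_cancel_left')
      moreover have "x \<notin> cball c R" using False by (auto intro: order_trans)
      ultimately show ?thesis using False supp by (simp add: s_def w_def)
    qed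
  qed
  show "integrable lborel f'"
    by (rule integrable_dominated_convergence[OF _ _ iw lim bd]) auto
  have "(\<lambda>i. \<integral>x. s i x \<partial>lborel) \<longlonglongrightarrow> (\<integral>x. f' x \<partial>lborel)"
    by (rule integral_dominated_convergence[OF _ _ iw lim bd]) auto
  then show "(\<integral>x. f' x \<partial>lborel) = 0" unfolding int_s
    using LIMSEQ_unique tendsto_const by blast
qed

section \<open>Energy of a polynomial on balls\<close>

lemma AE_lborel_notin_negligible: "negligible S \<Longrightarrow> AE x in lborel. x \<notin> S"
  using AE_not_in[of S lebesgue] by (simp add: negligible_iff_null_sets AE_completion_iff)

text \<open>\<open>*s\<close> multiplies by scalars of the component type, and the components of a
  matrix are rows; hence the entrywise product with a complex number.\<close>

definition smat :: "complex \<Rightarrow> complex^'n^'n \<Rightarrow> complex^'n^'n" where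
  "smat z N = (\<chi> i j. z * N $ i $ j)"

definition munit :: "'n \<Rightarrow> 'n \<Rightarrow> complex^'n^'n" where
  "munit i j = axis i (axis j 1)"

lemma smat_nth [simp]: "smat z N $ i $ j = z * N $ i $ j"
  by (simp add: smat_def)

lemma smat_add: "smat w N + smat x N = smat (w + x) N"
  by (simp add: vec_eq_iff algebra_simps)

lemma smat_0 [simp]: "smat 0 N = 0"
  by (simp add: vec_eq_iff)

lemma smat_1 [simp]: "smat 1 N = N"
  by (simp add: vec_eq_iff)

lemma scaleR_smat: "t *\<^sub>R smat z N = smat (of_real t * z) N"
  by (simp add: vec_eq_iff) (simp add: scaleR_conv_of_real)

lemma linear_smat: "linear (smat z)"
  by (rule linearI) (simp_all add: vec_eq_iff algebra_simps)

lemma norm_smat: "norm (smat z N) = cmod z * norm N"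
  by (simp add: norm_vec_def L2_set_def norm_mult power_mult_distrib sum_nonneg flip: sum_distrib_left)
     (simp add: real_sqrt_mult)

lemma munit_nth [simp]: "munit i j $ k $ l = (if k = i \<and> l = j then 1 else 0)"
  by (simp add: munit_def axis_def)

lemma inner_smat_munit: "x \<bullet> smat z (munit i j) = x $ i $ j \<bullet> z"
proof -
  have a: "x $ k $ l \<bullet> smat z (munit i j) $ k $ l = (if k = i then if l = j then x $ i $ j \<bullet> z else 0 else 0)" for k l
    by simp
  then have "(\<Sum>l\<in>UNIV. x $ k $ l \<bullet> smat z (munit i j) $ k $ l) = (if k = i then x $ i $ j \<bullet> z else 0)" for k
    by (cases "k = i") (simp_all only: a, simp_all)
  then show ?thesis unfolding inner_vec_def by simp
qed

lemma poly_real_line: "((\<lambda>t. poly p (of_real t * z)) has_vector_derivative z * coeff p 1) (at 0)"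
  for p :: "complex poly"
proof -
  have "((\<lambda>t. complex_of_real t * z) has_vector_derivative z) (at 0)"
    unfolding scaleR_conv_of_real[symmetric] by (auto intro!: derivative_eq_intros)
  from field_vector_diff_chain_at[OF this, of "poly p" "poly (pderiv p) 0"] poly_DERIV[of p 0]
  show ?thesis by (simp add: o_def poly_0_coeff_0 coeff_pderiv)
qed

text \<open>A polynomial \<open>D\<close> on the space of matrices, seen through its restrictions to
  complex lines: \<open>P A N\<close> is z -> D (A + z N). Its coefficient 1 is the derivative of
  \<open>D\<close> at \<open>A\<close> along \<open>N\<close>, linear in \<open>N\<close> by
  \<open>lin\<close>, and coefficient 2 is half the second derivative. Integration by parts works
  along one line at a time, so polynomials in one variable suffice.\<close>

locale holomorphic_lines =
  fixes D :: "complex^'n^'n \<Rightarrow> complex" and P :: "complex^'n^'n \<Rightarrow> complex^'n^'n \<Rightarrow> complex poly" and d :: nat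
  assumes line: "D (A + smat z N) = poly (P A N) z"
    and deg: "degree (P A N) \<le> d"
    and cont_coeff: "continuous_on UNIV (\<lambda>(A, N). coeff (P A N) k)"
    and lin: "coeff (P A N) 1 = (\<Sum>i\<in>UNIV. \<Sum>j\<in>UNIV. N $ i $ j * coeff (P A (munit i j)) 1)"
begin

lemma D_eq: "D A = coeff (P A N) 0"
  using line[of A 0 N] by (simp add: poly_0_coeff_0)

lemma cont_coeff_comp:
  assumes "continuous_on S f" "continuous_on S g"
  shows "continuous_on S (\<lambda>x. coeff (P (f x) (g x)) k)"
  using continuous_on_compose2[OF cont_coeff continuous_on_Pair[OF assms]] by simp

lemma cont_D: "continuous_on S f \<Longrightarrow> continuous_on S (\<lambda>x. D (f x))"
  unfolding D_eq[of _ 0] by (intro cont_coeff_comp continuous_intros)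

lemma P_shift: "P (A + smat w N) N = pcompose (P A N) [:w, 1:]"
proof -
  have "poly (P (A + smat w N) N) x = poly (pcompose (P A N) [:w, 1:]) x" for x
    by (simp add: line[symmetric] poly_pcompose add.assoc smat_add del: line)
  then show ?thesis by (intro poly_ext)
qed

lemma coeff_1_shift: "coeff (P (A + smat w N) N) 1 = poly (pderiv (P A N)) w"
proof -
  have "coeff q 1 = poly (pderiv q) 0" for q :: "complex poly"
    by (simp add: poly_0_coeff_0 coeff_pderiv)
  then show ?thesis unfolding P_shift by (simp add: pderiv_pcompose pderiv_pCons poly_pcompose)
qed

section \<open>The logarithmic gradient and its complex Laplacian\<close>

context
  fixes e :: real assumes e: "e > 0"
begin

definition Q where "Q A = (cmod (D A))\<^sup>2 + e"

text \<open>The holomorphic derivative of log \<open>Q\<close> in direction \<open>N\<close>. In its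
  derivative \<open>K\<close> the factor 2 turns a quadratic coefficient into a second
  derivative.\<close>

definition h where "h N A = coeff (P A N) 1 * cnj (D A) / of_real (Q A)"

definition K where "K N z A = (z * (2 * coeff (P A N) 2) * cnj (D A) + coeff (P A N) 1 * cnj (z * coeff (P A N) 1)) / of_real (Q A)
   - coeff (P A N) 1 * cnj (D A) * of_real (2 * (D A \<bullet> (z * coeff (P A N) 1))) / (of_real (Q A))\<^sup>2"

lemma Q_pos: "Q A > 0" unfolding Q_def using e by (simp add: add_nonneg_pos)

lemma Q_nz: "complex_of_real (Q A) \<noteq> 0" using Q_pos[of A] by (metis less_irrefl of_real_eq_0_iff)

lemma Q_ne: "Q A \<noteq> 0" using Q_pos[of A] by simp

lemma cont_Q: "continuous_on S f \<Longrightarrow> continuous_on S (\<lambda>x. Q (f x))"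
  unfolding Q_def by (intro continuous_intros cont_D)

lemma cont_h: "continuous_on S f \<Longrightarrow> continuous_on S g \<Longrightarrow> continuous_on S (\<lambda>x. h (g x) (f x))"
  unfolding h_def by (intro continuous_intros cont_D cont_coeff_comp cont_Q) (auto simp: Q_ne)

lemma cont_K: "continuous_on S (K N z)"
  unfolding K_def by (intro continuous_intros cont_D cont_coeff_comp cont_Q) (auto simp: Q_ne)

lemma h_deriv_0: "((\<lambda>t. h N (A + t *\<^sub>R smat z N)) has_vector_derivative K N z A) (at 0)"
proof -
  have 1: "((\<lambda>t. D (A + t *\<^sub>R smat z N)) has_vector_derivative z * coeff (P A N) 1) (at 0)"
    unfolding scaleR_smat line by (rule poly_real_line)
  have 2: "((\<lambda>t. coeff (P (A + t *\<^sub>R smat z N) N) 1) has_vector_derivative z * (2 * coeff (P A N) 2)) (at 0)"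
    unfolding scaleR_smat coeff_1_shift using poly_real_line[of "pderiv (P A N)" z]
    by (simp add: coeff_pderiv numeral_2_eq_2)
  show ?thesis using has_vector_derivative_log_gradient[OF 1 2 e]
    unfolding h_def K_def Q_def by simp
qed

lemma h_deriv: "((\<lambda>t. h N (A + t *\<^sub>R smat z N)) has_vector_derivative K N z (A + t *\<^sub>R smat z N)) (at t within U)"
proof -
  have 1: "((\<lambda>s. s - t) has_vector_derivative 1) (at t)" by (auto intro!: derivative_eq_intros)
  have "((\<lambda>s. h N (A + t *\<^sub>R smat z N + s *\<^sub>R smat z N)) has_vector_derivative K N z (A + t *\<^sub>R smat z N)) (at (t - t))"
    using h_deriv_0[of N "A + t *\<^sub>R smat z N"] by simp
  from vector_diff_chain_at[OF 1 this] show ?thesis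
    by (simp add: o_def algebra_simps has_vector_derivative_at_within)
qed

text \<open>\<open>K N z\<close> is the derivative of \<open>h N\<close> in direction \<open>z N\<close>, so the left-hand side is twice the
  antiholomorphic derivative of \<open>h N\<close> along \<open>N\<close>.\<close>
lemma K_laplacian: "K N 1 A + \<i> * K N \<i> A = of_real (2 * (e * (cmod (coeff (P A N) 1))\<^sup>2 / (Q A)\<^sup>2))"
proof -
  define a b c where "a = D A" "b = coeff (P A N) 1" "c = 2 * coeff (P A N) 2"
  have in1: "complex_of_real (2 * (x \<bullet> y)) = cnj x * y + x * cnj y" for x y
    by (simp add: complex_eq_iff inner_complex_def)
  have nn: "complex_of_real ((cmod b)\<^sup>2) = b * cnj b" by (rule complex_norm_square)
  have Qc: "of_real (Q A) = a * cnj a + of_real e"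
    unfolding Q_def a_b_c_def of_real_add complex_norm_square ..
  have rhs: "complex_of_real (2 * (e * (cmod b)\<^sup>2 / (Q A)\<^sup>2)) = 2 * of_real e * (b * cnj b) / (of_real (Q A))\<^sup>2"
    by (simp only: of_real_mult of_real_divide of_real_power nn[unfolded of_real_power] of_real_numeral times_divide_eq_right mult.assoc)
  have iff: "?thesis \<longleftrightarrow> (1 * c * cnj a + b * cnj (1 * b)) * of_real (Q A) - b * cnj a * (cnj a * (1 * b) + a * cnj (1 * b))
     + \<i> * ((\<i> * c * cnj a + b * cnj (\<i> * b)) * of_real (Q A) - b * cnj a * (cnj a * (\<i> * b) + a * cnj (\<i> * b)))
     = 2 * of_real e * (b * cnj b)"
    unfolding K_def a_b_c_def[symmetric] rhs in1 using Q_nz[of A]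
    by (simp add: divide_simps power2_eq_square)
  show ?thesis by (rule iffD2[OF iff]) (simp add: Qc algebra_simps)
qed

text \<open>Linearity in the direction takes the scalar \<open>w\<close> out of
  \<open>smat w x\<close>. On the circle through C + x about C, the radial gradient thus becomes the
  expression in one variable whose mean is bounded by the degree.\<close>

lemma h_eq_circle:
  "Re (h (smat w x) (C + smat w x)) = Re (w * poly (pderiv (P C x)) w * cnj (poly (P C x) w) / of_real ((cmod (poly (P C x) w))\<^sup>2 + e))"
proof -
  have "coeff (P (C + smat w x) (smat w x)) 1 = w * coeff (P (C + smat w x) x) 1"
    by (subst (1 2) lin) (simp add: sum_distrib_left mult.assoc)
  then show ?thesis unfolding h_def Q_def coeff_1_shift line by simp
qed

lemma h_lin: "(\<Sum>i\<in>UNIV. \<Sum>j\<in>UNIV. x $ i $ j * h (munit i j) A) = h x A"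
  unfolding h_def by (subst (2) lin) (simp add: sum_distrib_right sum_divide_distrib mult.assoc)

section \<open>Integration by parts against the truncated weight\<close>

context
  fixes C :: "complex^'n^'n" and q :: real assumes q: "q > 0"
begin

definition W where "W A = q - (norm (A - C))\<^sup>2"

definition phi where "phi N A = max 0 (W A) *\<^sub>R h N A"

lemma W_pos_iff: "0 < W A \<longleftrightarrow> A \<in> ball C (sqrt q)"
  unfolding W_def using real_sqrt_less_iff[of "(norm (A - C))\<^sup>2" q]
  by (simp add: dist_norm norm_minus_commute)

lemma W_neg: "A \<notin> cball C (sqrt q) \<Longrightarrow> W A < 0"
  unfolding W_def using real_sqrt_less_iff[of q "(norm (A - C))\<^sup>2"]
  by (simp add: dist_norm norm_minus_commute)

lemma W_le: "W A \<le> q" unfolding W_def by simp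

lemma cont_W: "continuous_on S W" unfolding W_def by (intro continuous_intros)

lemma cont_phi: "continuous_on S (phi N)"
  unfolding phi_def by (intro continuous_intros cont_W cont_h)

lemma W_step: "W (A + t *\<^sub>R b) = W A - 2 * t * ((A - C) \<bullet> b) - t\<^sup>2 * (norm b)\<^sup>2"
proof -
  have "(norm (A + t *\<^sub>R b - C))\<^sup>2 = (norm ((A - C) + t *\<^sub>R b))\<^sup>2" by (simp add: algebra_simps)
  also have "\<dots> = (norm (A - C))\<^sup>2 + 2 * t * ((A - C) \<bullet> b) + t\<^sup>2 * (norm b)\<^sup>2"
    unfolding power2_norm_eq_inner by (simp add: inner_add inner_commute power2_eq_square algebra_simps)
  finally show ?thesis unfolding W_def by simp
qed

lemma W_deriv: "((\<lambda>t. W (A + t *\<^sub>R b)) has_real_derivative - (2 * ((A - C) \<bullet> b))) (at 0)"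
  unfolding W_step by (auto intro!: derivative_eq_intros)

definition dphi where "dphi N z A = indicator (ball C (sqrt q)) A *\<^sub>R
   (W A *\<^sub>R K N z A - (2 * ((A - C) \<bullet> smat z N)) *\<^sub>R h N A)"

text \<open>The kink of the weight lies on a sphere, a null set. Off the sphere \<open>W\<close> has
  a strict sign near the point, so \<open>phi\<close> is locally either a differentiable product or
  zero.\<close>

lemma phi_deriv: "AE A in lborel. ((\<lambda>t. phi N (A + t *\<^sub>R smat z N)) has_vector_derivative dphi N z A) (at 0)"
  using AE_lborel_notin_negligible[OF negligible_sphere[of C "sqrt q"]]
proof eventually_elim
  fix A assume A: "A \<notin> sphere C (sqrt q)"
  define b where "b = smat z N"
  show "((\<lambda>t. phi N (A + t *\<^sub>R smat z N)) has_vector_derivative dphi N z A) (at 0)"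
  proof (cases "A \<in> ball C (sqrt q)")
    case True
    have d: "((\<lambda>t. W (A + t *\<^sub>R b) *\<^sub>R h N (A + t *\<^sub>R b)) has_vector_derivative
        W (A + 0 *\<^sub>R b) *\<^sub>R K N z A + (- (2 * ((A - C) \<bullet> b))) *\<^sub>R h N (A + 0 *\<^sub>R b)) (at 0)"
      unfolding b_def by (rule has_vector_derivative_scaleR[OF W_deriv h_deriv_0])
    have "((\<lambda>t. phi N (A + t *\<^sub>R b)) has_vector_derivative
        W (A + 0 *\<^sub>R b) *\<^sub>R K N z A + (- (2 * ((A - C) \<bullet> b))) *\<^sub>R h N (A + 0 *\<^sub>R b)) (at 0)"
    proof (rule has_vector_derivative_transform_within_open[OF d])
      show "open {t. 0 < W (A + t *\<^sub>R b)}"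
        by (intro open_Collect_less continuous_intros continuous_on_compose2[OF cont_W[of UNIV]]) auto
      show "0 \<in> {t. 0 < W (A + t *\<^sub>R b)}" using True W_pos_iff by simp
      show "W (A + t *\<^sub>R b) *\<^sub>R h N (A + t *\<^sub>R b) = phi N (A + t *\<^sub>R b)" if "t \<in> {t. 0 < W (A + t *\<^sub>R b)}" for t
        using that unfolding phi_def by simp
    qed
    then show ?thesis using True unfolding dphi_def b_def by simp
  next
    case False
    then have nA: "A \<notin> cball C (sqrt q)" using A by auto
    have d: "((\<lambda>t. 0::complex) has_vector_derivative 0) (at (0::real))" by simp
    have "((\<lambda>t. phi N (A + t *\<^sub>R b)) has_vector_derivative 0) (at 0)"
    proof (rule has_vector_derivative_transform_within_open[OF d])
      show "open {t. W (A + t *\<^sub>R b) < 0}"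
        by (intro open_Collect_less continuous_intros continuous_on_compose2[OF cont_W[of UNIV]]) auto
      show "0 \<in> {t. W (A + t *\<^sub>R b) < 0}" using W_neg[OF nA] by simp
      show "0 = phi N (A + t *\<^sub>R b)" if "t \<in> {t. W (A + t *\<^sub>R b) < 0}" for t
        using that unfolding phi_def by simp
    qed
    then show ?thesis using False unfolding dphi_def b_def by simp
  qed
qed

lemma phi_lipschitz:
  obtains M where "\<And>x t. x \<in> cball C (sqrt q + norm (smat z N)) \<Longrightarrow> 0 < t \<Longrightarrow> t \<le> 1 \<Longrightarrow>
     norm (phi N (x + t *\<^sub>R smat z N) - phi N x) \<le> M * t"
proof -
  define b where "b = smat z N"
  \<comment> \<open>One \<open>norm b\<close> allows for base points outside the support, the other
    for the step from there.\<close>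
  define S where "S = cball C (sqrt q + 2 * norm b)"
  have "bounded (K N z ` S)" "bounded (h N ` S)"
    unfolding S_def by (intro compact_imp_bounded compact_continuous_image cont_K cont_h continuous_intros compact_cball)+
  then obtain MK Mh where MK: "\<And>x. x \<in> S \<Longrightarrow> norm (K N z x) \<le> MK" and Mh: "\<And>x. x \<in> S \<Longrightarrow> norm (h N x) \<le> Mh"
    by (auto simp: bounded_iff)
  have inS: "x + s *\<^sub>R b \<in> S" if x: "x \<in> cball C (sqrt q + norm b)" and s: "0 \<le> s" "s \<le> 1" for x s
  proof -
    have "dist C (x + s *\<^sub>R b) \<le> dist C x + norm (s *\<^sub>R b)"
      using dist_triangle[of C "x + s *\<^sub>R b" x] by (simp add: dist_norm[of x])
    moreover have "norm (s *\<^sub>R b) \<le> norm b" using s by (simp add: mult_left_le_one_le)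
    ultimately show ?thesis using x unfolding S_def by simp
  qed
  define M where "M = q * MK + Mh * (2 * (sqrt q + norm b) * norm b + (norm b)\<^sup>2)"
  have "norm (phi N (x + t *\<^sub>R b) - phi N x) \<le> M * t" if x: "x \<in> cball C (sqrt q + norm b)" and t: "0 < t" "t \<le> 1" for x t
  proof -
    have h1: "norm (h N (x + t *\<^sub>R b) - h N (x + 0 *\<^sub>R b)) \<le> MK * norm (t - 0)"
    proof (rule differentiable_bound[where f = "\<lambda>s. h N (x + s *\<^sub>R b)" and S = "{0..t}"])
      show "((\<lambda>s. h N (x + s *\<^sub>R b)) has_derivative (\<lambda>r. r *\<^sub>R K N z (x + s *\<^sub>R b))) (at s within {0..t})" for s
        using h_deriv[of N x z s "{0..t}"] unfolding b_def has_vector_derivative_def .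
      show "onorm (\<lambda>r. r *\<^sub>R K N z (x + s *\<^sub>R b)) \<le> MK" if "s \<in> {0..t}" for s
        using MK[OF inS[OF x, of s]] that t by (intro onorm_le) (simp add: mult.commute[of MK] mult_left_mono)
    qed (use t in auto)
    have "norm (x - C) \<le> sqrt q + norm b" using x by (simp add: dist_norm norm_minus_commute)
    then have "\<bar>(x - C) \<bullet> b\<bar> \<le> (sqrt q + norm b) * norm b"
      using Cauchy_Schwarz_ineq2[of "x - C" b] mult_right_mono[of "norm (x - C)" "sqrt q + norm b" "norm b"] by simp
    moreover have "t\<^sup>2 \<le> t" using t by (simp add: power2_eq_square mult_left_le_one_le)
    ultimately have *: "\<bar>2 * t * ((x - C) \<bullet> b)\<bar> + \<bar>t\<^sup>2 * (norm b)\<^sup>2\<bar> \<le> 2 * t * ((sqrt q + norm b) * norm b) + t * (norm b)\<^sup>2"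
      using t by (intro add_mono) (auto simp: abs_mult intro!: mult_right_mono)
    have W1: "\<bar>W (x + t *\<^sub>R b) - W x\<bar> \<le> (2 * (sqrt q + norm b) * norm b + (norm b)\<^sup>2) * t"
    proof -
      have "\<bar>W (x + t *\<^sub>R b) - W x\<bar> \<le> \<bar>2 * t * ((x - C) \<bullet> b)\<bar> + \<bar>t\<^sup>2 * (norm b)\<^sup>2\<bar>" unfolding W_step by linarith
      with * show ?thesis by (simp add: algebra_simps)
    qed
    have "phi N (x + t *\<^sub>R b) - phi N x = max 0 (W (x + t *\<^sub>R b)) *\<^sub>R (h N (x + t *\<^sub>R b) - h N (x + 0 *\<^sub>R b))
        + (max 0 (W (x + t *\<^sub>R b)) - max 0 (W x)) *\<^sub>R h N x"
      unfolding phi_def by (simp add: algebra_simps)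
    then have "norm (phi N (x + t *\<^sub>R b) - phi N x) \<le> max 0 (W (x + t *\<^sub>R b)) * norm (h N (x + t *\<^sub>R b) - h N (x + 0 *\<^sub>R b))
        + \<bar>max 0 (W (x + t *\<^sub>R b)) - max 0 (W x)\<bar> * norm (h N x)"
      by (metis abs_of_nonneg max.cobounded1 norm_scaleR norm_triangle_ineq)
    also have "\<dots> \<le> q * (MK * t) + ((2 * (sqrt q + norm b) * norm b + (norm b)\<^sup>2) * t) * Mh"
    proof (intro add_mono mult_mono)
      show "max 0 (W (x + t *\<^sub>R b)) \<le> q" using W_le q by (simp add: less_imp_le)
      show "\<bar>max 0 (W (x + t *\<^sub>R b)) - max 0 (W x)\<bar> \<le> (2 * (sqrt q + norm b) * norm b + (norm b)\<^sup>2) * t" using W1 by linarith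
      show "norm (h N x) \<le> Mh" using Mh[OF inS[OF x, of 0]] by simp
    qed (use h1 t q in \<open>auto intro!: mult_nonneg_nonneg add_nonneg_nonneg\<close>)
    also have "\<dots> = M * t" unfolding M_def by (simp add: algebra_simps)
    finally show ?thesis .
  qed
  then show thesis using that unfolding b_def by blast
qed

lemma integrable_ball_continuous:
  fixes f :: "'a::euclidean_space \<Rightarrow> 'b::{banach, second_countable_topology}"
  assumes "continuous_on UNIV f"
  shows "integrable lborel (\<lambda>x. indicator (ball c r) x *\<^sub>R f x)"
proof -
  have "integrable lborel (\<lambda>x. indicator (cball c r) x *\<^sub>R f x)"
    by (rule borel_integrable_compact) (use assms continuous_on_subset in auto)
  then have "integrable lborel (\<lambda>x. indicator (ball c r) x *\<^sub>R indicator (cball c r) x *\<^sub>R f x)"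
    by (rule integrable_mult_indicator[rotated]) simp
  moreover have "indicator (ball c r) x *\<^sub>R indicator (cball c r) x *\<^sub>R f x = indicator (ball c r) x *\<^sub>R f x" for x
    by (auto simp: indicator_def)
  ultimately show ?thesis by (simp only:)
qed

lemma dphi_integral: "integrable lborel (dphi N z)" "(\<integral>A. dphi N z A \<partial>lborel) = 0"
proof -
  obtain M where M: "\<And>x t. x \<in> cball C (sqrt q + norm (smat z N)) \<Longrightarrow> 0 < t \<Longrightarrow> t \<le> 1 \<Longrightarrow>
     norm (phi N (x + t *\<^sub>R smat z N) - phi N x) \<le> M * t"
    using phi_lipschitz[of z N] by blast
  have supp: "phi N x = 0" if "x \<notin> cball C (sqrt q)" for x
    using W_neg[OF that] unfolding phi_def by simp
  have "integrable lborel (\<lambda>x. indicator (cball C (sqrt q)) x *\<^sub>R phi N x)"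
    by (rule borel_integrable_compact) (auto intro: cont_phi)
  also have "(\<lambda>x. indicator (cball C (sqrt q)) x *\<^sub>R phi N x) = phi N"
    using supp by (auto simp: indicator_def fun_eq_iff)
  finally have int: "integrable lborel (phi N)" .
  have m: "dphi N z \<in> borel_measurable borel"
    unfolding dphi_def
    by (intro borel_measurable_scaleR borel_measurable_indicator borel_measurable_continuous_onI continuous_intros cont_W cont_K cont_h) simp
  show "integrable lborel (dphi N z)" "(\<integral>A. dphi N z A \<partial>lborel) = 0"
    using integral_directional_derivative_eq_0[OF int supp M phi_deriv m] by auto
qed

definition psi where "psi A = (\<Sum>i\<in>UNIV. \<Sum>j\<in>UNIV. e * (cmod (coeff (P A (munit i j)) 1))\<^sup>2 / (Q A)\<^sup>2)"

lemma cont_psi: "continuous_on S psi"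
  unfolding psi_def by (intro continuous_intros cont_coeff_comp cont_Q) (auto simp: Q_ne)

lemma psi_nonneg: "psi A \<ge> 0"
  unfolding psi_def using e by (intro sum_nonneg) auto

text \<open>For each entry, half of \<open>dphi\<close> along 1 plus i times \<open>dphi\<close>
  along i is the antiholomorphic derivative of weight times gradient, and its integral vanishes.
  Differentiating the gradient yields the Laplacian; differentiating the weight yields minus the
  entry of A - C. Summed over the entries, the latter assemble to the gradient along A - C, whose
  real part is half the radial derivative of log \<open>Q\<close>.\<close>

lemma integral_psi_eq:
  "(\<integral>A. indicator (ball C (sqrt q)) A *\<^sub>R (W A * psi A) \<partial>lborel) = (\<integral>A. indicator (ball C (sqrt q)) A *\<^sub>R Re (h (A - C) A) \<partial>lborel)"
proof -
  define g where "g i j A = indicator (ball C (sqrt q)) A *\<^sub>R complex_of_real (W A * (e * (cmod (coeff (P A (munit i j)) 1))\<^sup>2 / (Q A)\<^sup>2))" for i j A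
  define r where "r i j A = indicator (ball C (sqrt q)) A *\<^sub>R ((A - C) $ i $ j * h (munit i j) A)" for i j A
  have ig: "integrable lborel (g i j)" for i j
    unfolding g_def by (intro integrable_ball_continuous continuous_intros cont_W cont_coeff_comp cont_Q) (auto simp: Q_ne)
  have ir: "integrable lborel (r i j)" for i j
    unfolding r_def by (intro integrable_ball_continuous continuous_intros cont_h)
  have eq: "(\<integral>A. g i j A \<partial>lborel) = (\<integral>A. r i j A \<partial>lborel)" for i j
  proof -
    have in1: "x \<bullet> 1 = Re x" "x \<bullet> \<i> = Im x" for x :: complex by (simp_all add: inner_complex_def)
    have cx: "of_real (Re x) + \<i> * of_real (Im x) = x" for x by (simp add: complex_eq_iff)
    have alg: "(w *\<^sub>R k1 - (2 * re) *\<^sub>R hh) + \<i> * (w *\<^sub>R k2 - (2 * im) *\<^sub>R hh) = of_real w * (k1 + \<i> * k2) - 2 * ((of_real re + \<i> * of_real im) * hh)"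
      for w re im :: real and k1 k2 hh :: complex by (simp add: scaleR_conv_of_real algebra_simps)
    have "dphi (munit i j) 1 A + \<i> * dphi (munit i j) \<i> A = indicator (ball C (sqrt q)) A *\<^sub>R
       ((W A *\<^sub>R K (munit i j) 1 A - (2 * Re ((A - C) $ i $ j)) *\<^sub>R h (munit i j) A) + \<i> * (W A *\<^sub>R K (munit i j) \<i> A - (2 * Im ((A - C) $ i $ j)) *\<^sub>R h (munit i j) A))" for A
      unfolding dphi_def inner_smat_munit in1 by (simp add: scaleR_right_distrib)
    also have "\<dots> A = 2 * (g i j A - r i j A)" for A
      unfolding alg K_laplacian cx g_def r_def by (simp add: scaleR_conv_of_real algebra_simps)
    finally have "dphi (munit i j) 1 A + \<i> * dphi (munit i j) \<i> A = 2 * (g i j A - r i j A)" for A .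
    then have "(\<integral>A. 2 * (g i j A - r i j A) \<partial>lborel) = (\<integral>A. dphi (munit i j) 1 A + \<i> * dphi (munit i j) \<i> A \<partial>lborel)"
      by simp
    also have "\<dots> = 0" using dphi_integral by simp
    finally show ?thesis using ig ir by simp
  qed
  have "complex_of_real (\<integral>A. indicator (ball C (sqrt q)) A *\<^sub>R (W A * psi A) \<partial>lborel) = (\<integral>A. (\<Sum>i\<in>UNIV. \<Sum>j\<in>UNIV. g i j A) \<partial>lborel)"
    unfolding g_def psi_def by (simp add: integral_complex_of_real[symmetric] scaleR_conv_of_real sum_distrib_left)
  also have "\<dots> = (\<Sum>i\<in>UNIV. \<Sum>j\<in>UNIV. (\<integral>A. r i j A \<partial>lborel))"
    using ig by (simp add: eq)
  also have "\<dots> = (\<integral>A. (\<Sum>i\<in>UNIV. \<Sum>j\<in>UNIV. r i j A) \<partial>lborel)"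
    using ir by simp
  also have "\<dots> = (\<integral>A. indicator (ball C (sqrt q)) A *\<^sub>R h (A - C) A \<partial>lborel)"
    unfolding r_def by (simp only: scaleR_sum_right[symmetric] h_lin)
  finally have "(\<integral>A. indicator (ball C (sqrt q)) A *\<^sub>R (W A * psi A) \<partial>lborel) = Re (\<integral>A. indicator (ball C (sqrt q)) A *\<^sub>R h (A - C) A \<partial>lborel)"
    by (metis Re_complex_of_real)
  also have "\<dots> = (\<integral>A. Re (indicator (ball C (sqrt q)) A *\<^sub>R h (A - C) A) \<partial>lborel)"
    by (rule integral_Re[symmetric]) (intro integrable_ball_continuous continuous_intros cont_h)
  finally show ?thesis by simp
qed

text \<open>Multiplication by \<open>cis t\<close> is an isometry preserving the ball, so the
  integral may be averaged over t. After exchanging the order of integration, each circle about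
  \<open>C\<close> contributes at most 2 pi d.\<close>

lemma integral_radial_le:
  "(\<integral>A. indicator (ball C (sqrt q)) A *\<^sub>R Re (h (A - C) A) \<partial>lborel) \<le> d * measure lborel (ball C (sqrt q))"
proof -
  define B where "B = (ball 0 (sqrt q) :: (complex^'n^'n) set)"
  define F where "F x t = indicator B x *\<^sub>R indicator {0..2*pi} t *\<^sub>R Re (h (smat (cis t) x) (C + smat (cis t) x))" for x t
  define I where "I = (\<integral>x. indicator B x *\<^sub>R Re (h x (C + x)) \<partial>lborel)"
  have csm: "continuous_on UNIV (\<lambda>z. smat (cis (snd z)) (fst z) :: complex^'n^'n)"
    unfolding smat_def by (intro continuous_intros)
  have cF: "continuous_on UNIV (\<lambda>z. Re (h (smat (cis (snd z)) (fst z)) (C + smat (cis (snd z)) (fst z))))"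
    by (intro continuous_intros cont_h csm)
  have int: "integrable (lborel \<Otimes>\<^sub>M lborel) (\<lambda>(x, t). F x t)"
  proof -
    have "integrable lborel (\<lambda>z. indicator (cball 0 (sqrt q) \<times> {0..2*pi}) z *\<^sub>R Re (h (smat (cis (snd z)) (fst z)) (C + smat (cis (snd z)) (fst z))))"
      by (rule borel_integrable_compact) (auto intro: compact_Times continuous_on_subset[OF cF])
    then have "integrable lborel (\<lambda>z. indicator (B \<times> UNIV) z *\<^sub>R indicator (cball 0 (sqrt q) \<times> {0..2*pi}) z *\<^sub>R Re (h (smat (cis (snd z)) (fst z)) (C + smat (cis (snd z)) (fst z))))"
      by (rule integrable_mult_indicator[rotated]) (auto simp: B_def borel_prod[symmetric])
    moreover have "indicator (B \<times> UNIV) z *\<^sub>R indicator (cball 0 (sqrt q) \<times> {0..2*pi}) z *\<^sub>R Re (h (smat (cis (snd z)) (fst z)) (C + smat (cis (snd z)) (fst z))) = (\<lambda>(x, t). F x t) z" for z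
      by (auto simp: F_def B_def indicator_def split: prod.splits)
    ultimately show ?thesis unfolding lborel_prod by simp
  qed
  have rot: "(\<integral>x. F x t \<partial>lborel) = indicator {0..2*pi} t *\<^sub>R I" for t
  proof -
    have m: "(\<lambda>x. indicator B x *\<^sub>R Re (h x (C + x))) \<in> borel_measurable borel"
      unfolding B_def
      by (intro borel_measurable_scaleR borel_measurable_indicator borel_measurable_continuous_onI continuous_intros cont_h) simp
    have "I = (\<integral>x. indicator B (smat (cis t) x) *\<^sub>R Re (h (smat (cis t) x) (C + smat (cis t) x)) \<partial>lborel)"
      unfolding I_def by (rule integral_lborel_isometry[OF linear_smat _ m, symmetric]) (simp add: norm_smat)
    moreover have "indicator B (smat (cis t) x) = (indicator B x :: real)" for x
      by (simp add: B_def indicator_def norm_smat)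
    ultimately show ?thesis unfolding F_def by (cases "t \<in> {0..2*pi}") simp_all
  qed
  have "2 * pi * I = (\<integral>t. indicator {0..2*pi} t *\<^sub>R I \<partial>lborel)" by simp
  also have "\<dots> = (\<integral>t. (\<integral>x. F x t \<partial>lborel) \<partial>lborel)" unfolding rot ..
  also have "\<dots> = (\<integral>x. (\<integral>t. F x t \<partial>lborel) \<partial>lborel)"
    by (rule lborel_pair.Fubini_integral[OF int])
  also have "\<dots> \<le> (\<integral>x. indicator B x *\<^sub>R (2 * pi * d) \<partial>lborel)"
  proof (rule integral_mono)
    show "integrable lborel (\<lambda>x. \<integral>t. F x t \<partial>lborel)"
      using lborel_pair.integrable_fst[OF int] by simp
    show "integrable lborel (\<lambda>x. indicator B x *\<^sub>R (2 * pi * real d))"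
      unfolding B_def by (intro integrable_ball_continuous continuous_intros)
    fix x
    define f where "f t = Re (cis t * poly (pderiv (P C x)) (cis t) * cnj (poly (P C x) (cis t))
            / of_real ((cmod (poly (P C x) (cis t)))\<^sup>2 + e))" for t
    have "f = (\<lambda>t. Re (h (smat (cis t) x) (C + smat (cis t) x)))"
      unfolding f_def h_eq_circle ..
    moreover have "continuous_on UNIV (\<lambda>t. Re (h (smat (cis t) x) (C + smat (cis t) x)))"
    proof -
      have "continuous_on UNIV (\<lambda>t::real. (x, t))" by (intro continuous_intros)
      from continuous_on_compose2[OF cF this] show "continuous_on UNIV (\<lambda>t. Re (h (smat (cis t) x) (C + smat (cis t) x)))" by simp
    qed
    ultimately have cf: "continuous_on UNIV f" by simp
    have "(\<integral>t. F x t \<partial>lborel) = indicator B x * (LINT t:{0..2*pi}|lborel. f t)"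
      unfolding F_def h_eq_circle f_def[symmetric] set_lebesgue_integral_def by simp
    also have "(LINT t:{0..2*pi}|lborel. f t) = integral {0..2*pi} f"
      by (rule set_borel_integral_eq_integral, unfold set_integrable_def, rule borel_integrable_compact)
        (auto intro: continuous_on_subset[OF cf])
    also have "\<dots> \<le> 2 * pi * d"
      unfolding f_def by (rule circle_log_gradient_le_degree[OF e deg])
    finally show "(\<integral>t. F x t \<partial>lborel) \<le> indicator B x *\<^sub>R (2 * pi * d)"
      by (simp add: mult_left_mono indicator_def)
  qed
  also have "\<dots> = 2 * pi * (d * measure lborel B)" by simp
  finally have "I \<le> d * measure lborel B" by simp
  moreover have "measure lborel B = measure lborel (ball C (sqrt q))"
    unfolding B_def using q by (simp add: content_ball)
  moreover have "(\<integral>A. indicator (ball C (sqrt q)) A *\<^sub>R Re (h (A - C) A) \<partial>lborel) = I"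
  proof -
    have m: "(\<lambda>A. indicator (ball C (sqrt q)) A *\<^sub>R Re (h (A - C) A)) \<in> borel_measurable borel"
      by (intro borel_measurable_scaleR borel_measurable_indicator borel_measurable_continuous_onI continuous_intros cont_h) simp
    have "indicator (ball C (sqrt q)) (x + C) = (indicator B x :: real)" for x
      by (simp add: B_def indicator_def dist_norm)
    then show ?thesis unfolding I_def
      using integral_lborel_translate[OF m, of C] by (simp add: add.commute)
  qed
  ultimately show ?thesis by simp
qed

lemma nn_integral_psi_le:
  "(\<integral>\<^sup>+A. ennreal (psi A * max 0 (q - (norm (A - C))\<^sup>2)) \<partial>lborel) \<le> ennreal (d * measure lborel (ball C (sqrt q)))"
proof -
  have "psi A * max 0 (q - (norm (A - C))\<^sup>2) = indicator (ball C (sqrt q)) A *\<^sub>R (W A * psi A)" for A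
    using W_pos_iff[of A] unfolding W_def[symmetric] by (cases "0 < W A") (auto simp: indicator_def)
  then have "(\<integral>\<^sup>+A. ennreal (psi A * max 0 (q - (norm (A - C))\<^sup>2)) \<partial>lborel) = (\<integral>\<^sup>+A. ennreal (indicator (ball C (sqrt q)) A *\<^sub>R (W A * psi A)) \<partial>lborel)"
    by (simp only:)
  also have "\<dots> = ennreal (\<integral>A. indicator (ball C (sqrt q)) A *\<^sub>R (W A * psi A) \<partial>lborel)"
  proof (rule nn_integral_eq_integral)
    show "integrable lborel (\<lambda>A. indicator (ball C (sqrt q)) A *\<^sub>R (W A * psi A))"
      by (intro integrable_ball_continuous continuous_intros cont_W cont_psi)
    show "AE A in lborel. 0 \<le> indicator (ball C (sqrt q)) A *\<^sub>R (W A * psi A)"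
      using W_pos_iff psi_nonneg by (auto simp: indicator_def less_imp_le)
  qed
  also have "\<dots> \<le> ennreal (d * measure lborel (ball C (sqrt q)))"
    unfolding integral_psi_eq by (rule ennreal_leI[OF integral_radial_le])
  finally show ?thesis .
qed

end
end
end

section \<open>From balls to Gaussian and spherical averages\<close>

lemma tendsto_linear_exp_0:
  fixes a k :: real
  assumes k: "k > 0"
  shows "((\<lambda>q. (q - a) * exp (- k * q)) \<longlongrightarrow> 0) at_top" "((\<lambda>q. exp (- k * q)) \<longlongrightarrow> 0) at_top"
proof -
  have kq: "filterlim (\<lambda>q. k * q) at_top at_top"
    by (rule filterlim_tendsto_pos_mult_at_top[OF tendsto_const k filterlim_ident])
  have 1: "((\<lambda>q. (k * q) ^ n / exp (k * q)) \<longlongrightarrow> 0) at_top" for n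
    by (rule filterlim_compose[OF tendsto_power_div_exp_0 kq])
  show 2: "((\<lambda>q. exp (- k * q)) \<longlongrightarrow> 0) at_top"
    using 1[of 0] by (simp add: exp_minus divide_inverse)
  have "((\<lambda>q. (1 / k) * ((k * q) ^ 1 / exp (k * q)) - a * exp (- k * q)) \<longlongrightarrow> (1 / k) * 0 - a * 0) at_top"
    by (intro tendsto_intros 1 2)
  then show "((\<lambda>q. (q - a) * exp (- k * q)) \<longlongrightarrow> 0) at_top"
    using k by (simp add: exp_minus field_simps)
qed

text \<open>The first integral superposes truncated weights, the second the indicators of their
  balls. The second value is k times the first, and with k = 1 / s^2 this is where the Gaussian
  bound gets its factor.\<close>

lemma nn_integral_exp_tail:
  fixes a k :: real
  assumes k: "k > 0" and a: "a \<ge> 0"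
  shows "(\<integral>\<^sup>+q. ennreal (indicator {0..} q * exp (- k * q) * max 0 (q - a)) \<partial>lborel) = ennreal (exp (- k * a) / k\<^sup>2)"
    and "(\<integral>\<^sup>+q. ennreal (indicator {0..} q * exp (- k * q) * indicator {a<..} q) \<partial>lborel) = ennreal (exp (- k * a) / k)"
proof -
  have "(\<integral>\<^sup>+q. ennreal (indicator {0..} q * exp (- k * q) * max 0 (q - a)) \<partial>lborel)
     = (\<integral>\<^sup>+q. ennreal (exp (- k * q) * (q - a)) * indicator {a..} q \<partial>lborel)"
    using a by (intro nn_integral_cong) (auto simp: indicator_def max_def)
  also have "\<dots> = ennreal (0 - (- ((a - a) * exp (- k * a) / k) - exp (- k * a) / k\<^sup>2))"
  proof (rule nn_integral_FTC_atLeast[where F = "\<lambda>q. - ((q - a) * exp (- k * q) / k) - exp (- k * q) / k\<^sup>2"])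
    show "((\<lambda>q. - ((q - a) * exp (- k * q) / k) - exp (- k * q) / k\<^sup>2) has_real_derivative exp (- k * q) * (q - a)) (at q)" for q
      using k by (auto intro!: derivative_eq_intros simp: field_simps power2_eq_square)
    have "((\<lambda>q. - ((q - a) * exp (- k * q) / k) - exp (- k * q) / k\<^sup>2) \<longlongrightarrow> - (0 / k) - 0 / k\<^sup>2) at_top"
      using k by (intro tendsto_intros tendsto_linear_exp_0) auto
    then show "((\<lambda>q. - ((q - a) * exp (- k * q) / k) - exp (- k * q) / k\<^sup>2) \<longlongrightarrow> 0) at_top" by simp
  qed auto
  finally show "(\<integral>\<^sup>+q. ennreal (indicator {0..} q * exp (- k * q) * max 0 (q - a)) \<partial>lborel) = ennreal (exp (- k * a) / k\<^sup>2)"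
    by simp
  have "(\<integral>\<^sup>+q. ennreal (indicator {0..} q * exp (- k * q) * indicator {a<..} q) \<partial>lborel)
     = (\<integral>\<^sup>+q. ennreal (exp (- k * q)) * indicator {a..} q \<partial>lborel)"
    using AE_lborel_singleton[of a] a by (intro nn_integral_cong_AE) (auto simp: indicator_def)
  also have "\<dots> = ennreal (0 - (- (exp (- k * a) / k)))"
  proof (rule nn_integral_FTC_atLeast[where F = "\<lambda>q. - (exp (- k * q) / k)"])
    show "((\<lambda>q. - (exp (- k * q) / k)) has_real_derivative exp (- k * q)) (at q)" for q
      using k by (auto intro!: derivative_eq_intros simp: field_simps)
    have "((\<lambda>q. - (exp (- k * q) / k)) \<longlongrightarrow> - (0 / k)) at_top"
      using k by (intro tendsto_intros tendsto_linear_exp_0) auto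
    then show "((\<lambda>q. - (exp (- k * q) / k)) \<longlongrightarrow> 0) at_top" by simp
  qed auto
  finally show "(\<integral>\<^sup>+q. ennreal (indicator {0..} q * exp (- k * q) * indicator {a<..} q) \<partial>lborel) = ennreal (exp (- k * a) / k)"
    by simp
qed

text \<open>The Gaussian weight is the superposition of the truncated weights
  \<open>max 0 (q - |x - C|\<^sup>2)\<close> with density \<open>exp (- q / s\<^sup>2) / s ^ 4\<close> in \<open>q\<close>.\<close>
lemma nn_integral_gaussian_le_of_balls:
  fixes f :: "'a::euclidean_space \<Rightarrow> real" and c :: real
  assumes [measurable]: "f \<in> borel_measurable borel" and f: "\<And>x. f x \<ge> 0" and c: "c \<ge> 0" and s: "s > 0"
    and ball: "\<And>q. q > 0 \<Longrightarrow> (\<integral>\<^sup>+x. ennreal (f x * max 0 (q - (norm (x - C))\<^sup>2)) \<partial>lborel) \<le> ennreal (c * measure lborel (ball C (sqrt q)))"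
  shows "(\<integral>\<^sup>+x. ennreal (f x * exp (- (norm (x - C))\<^sup>2 / s\<^sup>2)) \<partial>lborel)
      \<le> ennreal (c / s\<^sup>2) * (\<integral>\<^sup>+x. ennreal (exp (- (norm (x - C))\<^sup>2 / s\<^sup>2)) \<partial>lborel)"
proof -
  define k where "k = 1 / s\<^sup>2"
  have k: "k > 0" using s by (simp add: k_def)
  define a where "a x = (norm (x - C))\<^sup>2" for x
  have a: "a x \<ge> 0" for x by (simp add: a_def)
  have [measurable]: "a \<in> borel_measurable borel" unfolding a_def by measurable
  have [measurable]: "(\<lambda>x. indicator {a x <..} q :: real) \<in> borel_measurable borel" for q
    unfolding indicator_def by simp
  have ea: "exp (- (norm (x - C))\<^sup>2 / s\<^sup>2) = exp (- k * a x)" for x by (simp add: a_def k_def)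
  have "ennreal (1 / k\<^sup>2) * (\<integral>\<^sup>+x. ennreal (f x * exp (- k * a x)) \<partial>lborel)
     = (\<integral>\<^sup>+x. ennreal (f x) * ennreal (exp (- k * a x) / k\<^sup>2) \<partial>lborel)"
    using f k by (subst nn_integral_cmult[symmetric]) (auto simp flip: ennreal_mult intro!: nn_integral_cong)
  also have "\<dots> = (\<integral>\<^sup>+x. (\<integral>\<^sup>+q. ennreal (f x) * ennreal (indicator {0..} q * exp (- k * q) * max 0 (q - a x)) \<partial>lborel) \<partial>lborel)"
    by (subst nn_integral_exp_tail(1)[OF k a, symmetric]) (simp add: nn_integral_cmult)
  also have "\<dots> = (\<integral>\<^sup>+q. (\<integral>\<^sup>+x. ennreal (f x) * ennreal (indicator {0..} q * exp (- k * q) * max 0 (q - a x)) \<partial>lborel) \<partial>lborel)"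
    by (rule lborel_pair.Fubini'[symmetric]) measurable
  also have "\<dots> = (\<integral>\<^sup>+q. ennreal (indicator {0..} q * exp (- k * q)) * (\<integral>\<^sup>+x. ennreal (f x * max 0 (q - a x)) \<partial>lborel) \<partial>lborel)"
    using f by (subst nn_integral_cmult[symmetric]) (auto simp: mult_ac simp flip: ennreal_mult intro!: nn_integral_cong)
  also have "\<dots> \<le> (\<integral>\<^sup>+q. ennreal (indicator {0..} q * exp (- k * q)) * (\<integral>\<^sup>+x. ennreal (c * indicator {a x <..} q) \<partial>lborel) \<partial>lborel)"
  proof (rule nn_integral_mono)
    fix q
    show "ennreal (indicator {0..} q * exp (- k * q)) * (\<integral>\<^sup>+x. ennreal (f x * max 0 (q - a x)) \<partial>lborel)
       \<le> ennreal (indicator {0..} q * exp (- k * q)) * (\<integral>\<^sup>+x. ennreal (c * indicator {a x <..} q) \<partial>lborel)"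
    proof (cases "q > 0")
      case True
      have ib: "indicator {a x <..} q = (indicator (ball C (sqrt q)) x :: real)" for x
        using real_sqrt_less_iff[of "a x" q] by (simp add: indicator_def a_def dist_norm norm_minus_commute)
      have "(\<integral>\<^sup>+x. ennreal (c * indicator {a x <..} q) \<partial>lborel) = ennreal (c * measure lborel (ball C (sqrt q)))"
        unfolding ib using c emeasure_lborel_ball_finite[of C "sqrt q"]
        by (simp add: ennreal_mult nn_integral_cmult_indicator ennreal_indicator emeasure_eq_ennreal_measure less_top[symmetric])
      then show ?thesis using ball[OF True] unfolding a_def by (intro mult_left_mono) auto
    next
      case False
      then have "max 0 (q - a x) = 0" for x using a[of x] by simp
      then show ?thesis by simp
    qed
  qed
  also have "\<dots> = (\<integral>\<^sup>+q. (\<integral>\<^sup>+x. ennreal c * ennreal (indicator {0..} q * exp (- k * q) * indicator {a x <..} q) \<partial>lborel) \<partial>lborel)"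
    using c by (subst nn_integral_cmult[symmetric]) (auto simp: mult_ac simp flip: ennreal_mult intro!: nn_integral_cong)
  also have "\<dots> = (\<integral>\<^sup>+x. (\<integral>\<^sup>+q. ennreal c * ennreal (indicator {0..} q * exp (- k * q) * indicator {a x <..} q) \<partial>lborel) \<partial>lborel)"
    by (rule lborel_pair.Fubini') (simp add: indicator_def[of "{_<..}"])
  also have "\<dots> = (\<integral>\<^sup>+x. ennreal c * ennreal (exp (- k * a x) / k) \<partial>lborel)"
    by (subst nn_integral_exp_tail(2)[OF k a, symmetric]) (simp add: nn_integral_cmult)
  also have "\<dots> = ennreal (1 / k\<^sup>2) * (ennreal (c * k) * (\<integral>\<^sup>+x. ennreal (exp (- k * a x)) \<partial>lborel))"
  proof -
    have "(\<integral>\<^sup>+x. ennreal c * ennreal (exp (- k * a x) / k) \<partial>lborel) = (\<integral>\<^sup>+x. ennreal (c / k) * ennreal (exp (- k * a x)) \<partial>lborel)"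
      using c k by (intro nn_integral_cong) (simp flip: ennreal_mult)
    moreover have "ennreal (c / k) = ennreal (1 / k\<^sup>2) * ennreal (c * k)"
      using c k by (simp add: power2_eq_square flip: ennreal_mult)
    ultimately show ?thesis by (simp add: nn_integral_cmult mult.assoc)
  qed
  finally have "(\<integral>\<^sup>+x. ennreal (f x * exp (- k * a x)) \<partial>lborel) \<le> ennreal (c * k) * (\<integral>\<^sup>+x. ennreal (exp (- k * a x)) \<partial>lborel)"
    using k by (subst (asm) ennreal_mult_le_mult_iff) auto
  then show ?thesis unfolding ea by (simp add: k_def)
qed

lemma nn_integral_gaussian:
  fixes C :: "'a::euclidean_space"
  assumes s: "s > 0"
  shows "(\<integral>\<^sup>+x. ennreal (exp (- (norm (x - C))\<^sup>2 / s\<^sup>2)) \<partial>lborel) = ennreal ((sqrt pi * s) ^ DIM('a))"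
proof -
  have 1: "(\<integral>\<^sup>+t. ennreal (exp (- (t - m)\<^sup>2 / s\<^sup>2)) \<partial>lborel) = ennreal (sqrt pi * s)" for m
  proof -
    \<comment> \<open>Variance s^2 of a complex entry means variance s^2 / 2 of each real
      coordinate.\<close>
    have "exp (- (t - m)\<^sup>2 / s\<^sup>2) = (sqrt pi * s) * normal_density m (s / sqrt 2) t" for t
      using s by (simp add: normal_density_def power_divide real_sqrt_mult)
    then have "(\<integral>\<^sup>+t. ennreal (exp (- (t - m)\<^sup>2 / s\<^sup>2)) \<partial>lborel) = ennreal (sqrt pi * s) * (\<integral>\<^sup>+t. ennreal (normal_density m (s / sqrt 2) t) \<partial>lborel)"
      using s by (simp add: ennreal_mult nn_integral_cmult)
    also have "(\<integral>\<^sup>+t. ennreal (normal_density m (s / sqrt 2) t) \<partial>lborel) = 1"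
      using prob_space.emeasure_space_1[OF prob_space_normal_density[of "s / sqrt 2" m]] s
      by (simp add: emeasure_density)
    finally show ?thesis by simp
  qed
  have "exp (- (norm (x - C))\<^sup>2 / s\<^sup>2) = (\<Prod>b\<in>Basis. exp (- (x \<bullet> b - C \<bullet> b)\<^sup>2 / s\<^sup>2))" for x :: 'a
    unfolding power2_norm_eq_inner
    by (subst euclidean_inner) (simp add: exp_sum[symmetric] inner_diff_left power2_eq_square sum_divide_distrib sum_negf)
  then have "(\<integral>\<^sup>+x. ennreal (exp (- (norm (x - C))\<^sup>2 / s\<^sup>2)) \<partial>lborel) = (\<integral>\<^sup>+x. (\<Prod>b\<in>Basis. ennreal (exp (- (x \<bullet> b - C \<bullet> b)\<^sup>2 / s\<^sup>2))) \<partial>lborel)"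
    by (simp add: prod_ennreal)
  also have "\<dots> = (\<Prod>b\<in>(Basis::'a set). (\<integral>\<^sup>+t. ennreal (exp (- (t - C \<bullet> b)\<^sup>2 / s\<^sup>2)) \<partial>lborel))"
    by (rule nn_integral_lborel_prod) auto
  also have "\<dots> = ennreal ((sqrt pi * s) ^ DIM('a))"
    unfolding 1 using s by (simp add: ennreal_power)
  finally show ?thesis .
qed

section \<open>From the sphere to weighted integrals over the ball\<close>

lemma nn_integral_lborel_scale:
  fixes f :: "'a::euclidean_space \<Rightarrow> ennreal"
  assumes [measurable]: "f \<in> borel_measurable borel" and r: "r > 0"
  shows "(\<integral>\<^sup>+x. f x \<partial>lborel) = ennreal (r ^ DIM('a)) * (\<integral>\<^sup>+x. f (r *\<^sub>R x) \<partial>lborel)"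
  using r by (subst lborel_affine[of r 0]) (auto simp: nn_integral_density nn_integral_distr nn_integral_cmult)

text \<open>With m the real dimension, the integral of \<open>f\<close> over the ball of radius r is
  r^m times that over the unit ball. As 1 / |x|^2 - 1 is the integral of 2 / r^3 over r from |x| to
  1, superposing these balls gives the factor 2 / (m - 2). The weight is chosen such that the factor
  |x|^2, coming from an energy homogeneous of degree -2, turns it into the truncated weight 1 -
  |x|^2.\<close>

lemma nn_integral_ball_homogeneous:
  fixes f :: "'a::euclidean_space \<Rightarrow> ennreal"
  assumes [measurable]: "f \<in> borel_measurable borel" and hom: "\<And>x r. r > 0 \<Longrightarrow> f (r *\<^sub>R x) = f x"
    and dim: "DIM('a) \<ge> 3"
  shows "(\<integral>\<^sup>+x. f x * indicator (ball 0 1) x \<partial>lborel)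
     = ennreal ((real DIM('a) - 2) / 2) * (\<integral>\<^sup>+x. f x * ennreal (1 / (norm x)\<^sup>2 - 1) * indicator (ball 0 1) x \<partial>lborel)"
proof -
  define m where "m = DIM('a)"
  have split: "ennreal (1 / (norm x)\<^sup>2 - 1) * indicator (ball 0 1) x
      = (\<integral>\<^sup>+r. ennreal (2 / r ^ 3) * indicator {0<..1} r * indicator (ball 0 r) x \<partial>lborel)" if "x \<noteq> 0" for x :: 'a
  proof (cases "norm x < 1")
    case True
    have "(\<integral>\<^sup>+r. ennreal (2 / r ^ 3) * indicator {0<..1} r * indicator (ball 0 r) x \<partial>lborel)
       = (\<integral>\<^sup>+r. ennreal (2 / r ^ 3) * indicator {norm x..1} r \<partial>lborel)"
      using AE_lborel_singleton[of "norm x"] that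
      by (intro nn_integral_cong_AE) (auto simp: indicator_def dest: le_less_trans[OF norm_ge_zero])
    also have "\<dots> = ennreal (- (1 / 1\<^sup>2) - (- (1 / (norm x)\<^sup>2)))"
    proof (rule nn_integral_FTC_Icc[where F = "\<lambda>r. - (1 / r\<^sup>2)"])
      fix r assume "r \<in> {norm x..1}"
      moreover have "norm x > 0" using that by simp
      ultimately have "r > 0" using less_le_trans[of 0 "norm x" r] by simp
      then show "((\<lambda>r. - (1 / r\<^sup>2)) has_real_derivative 2 / r ^ 3) (at r)"
        using \<open>r > 0\<close>
        by (auto intro!: derivative_eq_intros simp: field_simps power2_eq_square power3_eq_cube)
      show "0 \<le> 2 / r ^ 3" using \<open>r > 0\<close> by simp
    qed (use True in auto)
    finally show ?thesis using True by simp
  next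
    case False
    then have "indicator {0<..1} r * indicator (ball 0 r) x = (0::ennreal)" for r
      by (auto simp: indicator_def)
    then have "ennreal (2 / r ^ 3) * indicator {0<..1} r * indicator (ball 0 r) x = 0" for r
      by (simp only: mult.assoc mult_zero_right)
    then have "(\<integral>\<^sup>+r. ennreal (2 / r ^ 3) * indicator {0<..1} r * indicator (ball 0 r) x \<partial>lborel) = (\<integral>\<^sup>+r. 0 \<partial>(lborel :: real measure))"
      by (simp only:)
    then show ?thesis using False by simp
  qed
  have meas: "(\<lambda>(x, r). f x * (ennreal (2 / r ^ 3) * indicator {0<..1} r * indicator (ball 0 r) x)) \<in> borel_measurable (lborel \<Otimes>\<^sub>M lborel)"
    unfolding indicator_def mem_ball_0 by measurable
  have "(\<integral>\<^sup>+x. f x * ennreal (1 / (norm x)\<^sup>2 - 1) * indicator (ball 0 1) x \<partial>lborel)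
     = (\<integral>\<^sup>+x. f x * (\<integral>\<^sup>+r. ennreal (2 / r ^ 3) * indicator {0<..1} r * indicator (ball 0 r) x \<partial>lborel) \<partial>lborel)"
    using AE_lborel_singleton[of "0::'a"] by (intro nn_integral_cong_AE) (auto simp: split mult.assoc)
  also have "\<dots> = (\<integral>\<^sup>+x. (\<integral>\<^sup>+r. f x * (ennreal (2 / r ^ 3) * indicator {0<..1} r * indicator (ball 0 r) x) \<partial>lborel) \<partial>lborel)"
    by (intro nn_integral_cong nn_integral_cmult[symmetric]) (simp add: indicator_def)
  also have "\<dots> = (\<integral>\<^sup>+r. (\<integral>\<^sup>+x. f x * (ennreal (2 / r ^ 3) * indicator {0<..1} r * indicator (ball 0 r) x) \<partial>lborel) \<partial>lborel)"
    by (rule lborel_pair.Fubini'[symmetric]) (rule meas)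
  also have "\<dots> = (\<integral>\<^sup>+r. ennreal (2 * r ^ (m - 3)) * indicator {0..1} r * (\<integral>\<^sup>+x. f x * indicator (ball 0 1) x \<partial>lborel) \<partial>lborel)"
  proof (intro nn_integral_cong_AE)
    show "AE r in lborel. (\<integral>\<^sup>+x. f x * (ennreal (2 / r ^ 3) * indicator {0<..1} r * indicator (ball 0 r) x) \<partial>lborel)
        = ennreal (2 * r ^ (m - 3)) * indicator {0..1} r * (\<integral>\<^sup>+x. f x * indicator (ball 0 1) x \<partial>lborel)"
      using AE_lborel_singleton[of "0::real"]
    proof eventually_elim
      fix r :: real assume "r \<noteq> 0"
      show "(\<integral>\<^sup>+x. f x * (ennreal (2 / r ^ 3) * indicator {0<..1} r * indicator (ball 0 r) x) \<partial>lborel)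
        = ennreal (2 * r ^ (m - 3)) * indicator {0..1} r * (\<integral>\<^sup>+x. f x * indicator (ball 0 1) x \<partial>lborel)"
      proof (cases "r \<in> {0<..1}")
        case True
        then have r: "r > 0" by simp
        have [measurable]: "ball (0::'a) r \<in> sets borel" by simp
        have mb: "(\<lambda>x. f x * indicator (ball 0 r) x) \<in> borel_measurable lborel" by measurable
        have "(\<integral>\<^sup>+x. f x * (ennreal (2 / r ^ 3) * indicator {0<..1} r * indicator (ball 0 r) x) \<partial>lborel)
          = ennreal (2 / r ^ 3) * (\<integral>\<^sup>+x. f x * indicator (ball 0 r) x \<partial>lborel)"
          using True by (subst nn_integral_cmult[OF mb, symmetric]) (auto simp: mult_ac)
        also have "(\<integral>\<^sup>+x. f x * indicator (ball 0 r) x \<partial>lborel) = ennreal (r ^ m) * (\<integral>\<^sup>+x. f (r *\<^sub>R x) * indicator (ball 0 r) (r *\<^sub>R x) \<partial>lborel)"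
          unfolding m_def by (rule nn_integral_lborel_scale[OF _ r]) measurable
        also have "(\<integral>\<^sup>+x. f (r *\<^sub>R x) * indicator (ball 0 r) (r *\<^sub>R x) \<partial>lborel) = (\<integral>\<^sup>+x. f x * indicator (ball 0 1) x \<partial>lborel)"
          using r by (intro nn_integral_cong) (simp add: hom indicator_def)
        also have "ennreal (2 / r ^ 3) * (ennreal (r ^ m) * y) = ennreal (2 * r ^ (m - 3)) * y" for y
          using r dim by (simp add: mult.assoc[symmetric] ennreal_mult[symmetric] m_def power_diff)
        finally show ?thesis using True by simp
      qed (use \<open>r \<noteq> 0\<close> in auto)
    qed
  qed
  also have "\<dots> = (\<integral>\<^sup>+r. ennreal (2 * r ^ (m - 3)) * indicator {0..1} r \<partial>lborel) * (\<integral>\<^sup>+x. f x * indicator (ball 0 1) x \<partial>lborel)"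
    by (rule nn_integral_multc) measurable
  also have "(\<integral>\<^sup>+r. ennreal (2 * r ^ (m - 3)) * indicator {0..1} r \<partial>lborel) = ennreal (2 / (real m - 2) * 1 ^ (m - 2) - 2 / (real m - 2) * 0 ^ (m - 2))"
  proof (rule nn_integral_FTC_Icc[where F = "\<lambda>r. 2 / (real m - 2) * r ^ (m - 2)"])
    fix r :: real assume "r \<in> {0..1}"
    have "m - 2 - Suc 0 = m - 3" "real (m - 2) = real m - 2" "real m - 2 \<noteq> 0" using dim by (auto simp: m_def)
    then show "((\<lambda>r. 2 / (real m - 2) * r ^ (m - 2)) has_real_derivative 2 * r ^ (m - 3)) (at r)"
      by (auto intro!: derivative_eq_intros)
    show "0 \<le> 2 * r ^ (m - 3)" using \<open>r \<in> {0..1}\<close> by simp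
  qed auto
  also have "\<dots> = ennreal (2 / (real m - 2))" using dim by (simp add: m_def zero_power)
  finally have *: "(\<integral>\<^sup>+x. f x * ennreal (1 / (norm x)\<^sup>2 - 1) * indicator (ball 0 1) x \<partial>lborel)
     = ennreal (2 / (real m - 2)) * (\<integral>\<^sup>+x. f x * indicator (ball 0 1) x \<partial>lborel)" .
  have "ennreal ((real m - 2) / 2) * ennreal (2 / (real m - 2)) = ennreal 1"
    using dim by (subst ennreal_mult[symmetric]) (auto simp: m_def)
  then show ?thesis unfolding m_def[symmetric] * by (simp only: mult.assoc[symmetric] ennreal_1 mult_1)
qed

text \<open>\<open>g\<close> may fail to be measurable, so the integral is treated as the supremum
  over simple functions below \<open>g\<close>. Each of these is Borel, and composed with A / |A| it
  is homogeneous of degree zero, so the change of weight applies to it. The real dimension 2 n^2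
  gives the factor (2 n^2 - 2) / 2.\<close>

lemma nn_integral_sphere_uniform_le:
  fixes g :: "complex^'n^'n \<Rightarrow> ennreal"
  assumes card: "CARD('n) \<ge> 2"
  shows "(\<integral>\<^sup>+A. g A \<partial>sphere_uniform) \<le> ennreal ((real CARD('n))\<^sup>2 - 1) / emeasure lborel (ball (0::complex^'n^'n) 1)
     * (\<integral>\<^sup>+A. g (A /\<^sub>R norm A) * ennreal (1 / (norm A)\<^sup>2 - 1) * indicator (ball 0 1) A \<partial>lborel)"
  unfolding nn_integral_def[of sphere_uniform g]
proof (rule SUP_least, clarify)
  fix s :: "complex^'n^'n \<Rightarrow> ennreal" assume s: "simple_function sphere_uniform s" and le: "s \<le> g"
  have [measurable]: "s \<in> borel_measurable borel"
    using borel_measurable_simple_function[OF s] by (simp add: sphere_uniform_def measurable_distr_eq1 cong: measurable_cong_sets)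
  define V where "V = emeasure lborel (ball (0::complex^'n^'n) 1)"
  have dim: "DIM(complex^'n^'n) = 2 * CARD('n)\<^sup>2" by (simp add: power2_eq_square)
  have c4: "CARD('n)\<^sup>2 \<ge> 4" using power_mono[OF card, of 2] by simp
  have hom: "(r *\<^sub>R A) /\<^sub>R norm (r *\<^sub>R A) = A /\<^sub>R norm A" if "r > 0" for r and A :: "complex^'n^'n"
    using that by (simp add: field_simps)
  have "integral\<^sup>S sphere_uniform s = (\<integral>\<^sup>+A. s A \<partial>sphere_uniform)"
    by (rule nn_integral_eq_simple_integral[OF s, symmetric])
  also have "\<dots> = (\<integral>\<^sup>+A. s (A /\<^sub>R norm A) \<partial>uniform_measure lborel (ball 0 1))"
    unfolding sphere_uniform_def by (rule nn_integral_distr) measurable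
  also have "\<dots> = (\<integral>\<^sup>+A. s (A /\<^sub>R norm A) * indicator (ball 0 1) A \<partial>lborel) / V"
    unfolding V_def by (rule nn_integral_uniform_measure) measurable
  also have "(\<integral>\<^sup>+A. s (A /\<^sub>R norm A) * indicator (ball 0 1) A \<partial>lborel)
     = ennreal ((real DIM(complex^'n^'n) - 2) / 2) * (\<integral>\<^sup>+A. s (A /\<^sub>R norm A) * ennreal (1 / (norm A)\<^sup>2 - 1) * indicator (ball 0 1) A \<partial>lborel)"
  proof (rule nn_integral_ball_homogeneous)
    show "s ((r *\<^sub>R A) /\<^sub>R norm (r *\<^sub>R A)) = s (A /\<^sub>R norm A)" if "r > 0" for r A
      unfolding hom[OF that] ..
  qed (use c4 in \<open>auto simp: dim simp del: DIM_cart\<close>)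
  also have "\<dots> / V \<le> ennreal ((real CARD('n))\<^sup>2 - 1) / V * (\<integral>\<^sup>+A. g (A /\<^sub>R norm A) * ennreal (1 / (norm A)\<^sup>2 - 1) * indicator (ball 0 1) A \<partial>lborel)"
  proof -
    have "(\<integral>\<^sup>+A. s (A /\<^sub>R norm A) * ennreal (1 / (norm A)\<^sup>2 - 1) * indicator (ball 0 1) A \<partial>lborel)
       \<le> (\<integral>\<^sup>+A. g (A /\<^sub>R norm A) * ennreal (1 / (norm A)\<^sup>2 - 1) * indicator (ball 0 1) A \<partial>lborel)"
      using le by (intro nn_integral_mono mult_right_mono) (auto simp: le_fun_def)
    moreover have "(real (2 * CARD('n)\<^sup>2) - 2) / 2 = (real CARD('n))\<^sup>2 - 1" by simp
    ultimately show ?thesis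
      unfolding dim by (simp only: divide_ennreal_def mult.assoc mult.commute[of _ "inverse V"] mult_left_mono zero_le)
  qed
  finally show "integral\<^sup>S sphere_uniform s \<le> ennreal ((real CARD('n))\<^sup>2 - 1) / emeasure lborel (ball (0::complex^'n^'n) 1)
     * (\<integral>\<^sup>+A. g (A /\<^sub>R norm A) * ennreal (1 / (norm A)\<^sup>2 - 1) * indicator (ball 0 1) A \<partial>lborel)"
    unfolding V_def .
qed

section \<open>Gaussian vectors in complex space\<close>

text \<open>Bilinear instead of Hermitian, because \<open>u\<close> acts as a row vector, that is,
  as a complex linear form on eigenvectors; \<open>vcnj\<close> translates between the two
  pairings.\<close>

definition bdot :: "complex^'n \<Rightarrow> complex^'n \<Rightarrow> complex" where
  "bdot u m = (\<Sum>i\<in>UNIV. u $ i * m $ i)"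

definition vcnj :: "complex^'n \<Rightarrow> complex^'n" where
  "vcnj v = (\<chi> i. cnj (v $ i))"

lemma vcnj_nth [simp]: "vcnj v $ i = cnj (v $ i)"
  by (simp add: vcnj_def)

lemma norm_sq_vec: "complex_of_real ((norm v)\<^sup>2) = (\<Sum>i\<in>UNIV. v $ i * cnj (v $ i))" for v :: "complex^'n"
  by (simp add: norm_vec_def L2_set_def sum_nonneg complex_norm_square[symmetric])

lemma bdot_vcnj: "bdot (vcnj v) v = of_real ((norm v)\<^sup>2)" "bdot v (vcnj v) = of_real ((norm v)\<^sup>2)"
  unfolding norm_sq_vec bdot_def by (simp_all add: mult.commute)

lemma hinner_eq_bdot: "hinner v w = bdot (vcnj v) w"
  by (simp add: hinner_def bdot_def)

lemma norm_vcnj [simp]: "norm (vcnj v) = norm v"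
  by (simp add: norm_vec_def)

lemma bdot_add_left: "bdot (u + w) m = bdot u m + bdot w m"
  by (simp add: bdot_def algebra_simps sum.distrib)

lemma bdot_diff_left: "bdot (u - w) m = bdot u m - bdot w m"
  by (simp add: bdot_def algebra_simps sum_subtractf)

lemma bdot_scale_left: "bdot (z *s u) m = z * bdot u m"
  by (simp add: bdot_def sum_distrib_left mult_ac)

lemma bdot_commute: "bdot u m = bdot m u"
  by (simp add: bdot_def mult.commute)

lemma continuous_on_bdot [continuous_intros]:
  "continuous_on S f \<Longrightarrow> continuous_on S g \<Longrightarrow> continuous_on S (\<lambda>x. bdot (f x) (g x))"
  unfolding bdot_def by (intro continuous_intros)

lemma continuous_on_scale_vec [continuous_intros]:
  fixes g :: "'a::topological_space \<Rightarrow> complex^'n"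
  shows "continuous_on S f \<Longrightarrow> continuous_on S g \<Longrightarrow> continuous_on S (\<lambda>x. f x *s g x)"
  unfolding vector_scalar_mult_def by (intro continuous_intros)

text \<open>Pythagoras: with y the coefficient of \<open>u\<close> along \<open>b\<close>, the
  vector \<open>u - z *s b\<close> is the component of \<open>u\<close> orthogonal to
  \<open>b\<close> plus the multiple y - z of \<open>b\<close>.\<close>

lemma norm_diff_scale_sq:
  fixes b u :: "complex^'n"
  assumes b: "norm b = 1"
  shows "(norm (u - z *s b))\<^sup>2 = (norm u)\<^sup>2 - (cmod (bdot u (vcnj b)))\<^sup>2 + (cmod (bdot u (vcnj b) - z))\<^sup>2"
proof -
  define y where "y = bdot u (vcnj b)"
  have cy: "cnj y = (\<Sum>i\<in>UNIV. cnj (u $ i) * b $ i)" by (simp add: y_def bdot_def)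
  have y: "y = (\<Sum>i\<in>UNIV. u $ i * cnj (b $ i))" by (simp add: y_def bdot_def)
  have b1: "(\<Sum>i\<in>UNIV. b $ i * cnj (b $ i)) = 1" using norm_sq_vec[of b] b by simp
  have "complex_of_real ((norm (u - z *s b))\<^sup>2) = (\<Sum>i\<in>UNIV. u $ i * cnj (u $ i)) - cnj z * (\<Sum>i\<in>UNIV. u $ i * cnj (b $ i))
      - z * (\<Sum>i\<in>UNIV. cnj (u $ i) * b $ i) + z * cnj z * (\<Sum>i\<in>UNIV. b $ i * cnj (b $ i))"
    unfolding norm_sq_vec by (simp add: algebra_simps sum.distrib sum_subtractf sum_distrib_left)
  also have "\<dots> = of_real ((norm u)\<^sup>2 - (cmod y)\<^sup>2 + (cmod (y - z))\<^sup>2)"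
    unfolding b1 cy[symmetric] y[symmetric] of_real_add of_real_diff norm_sq_vec complex_norm_square
    by (simp add: algebra_simps)
  finally show ?thesis unfolding y_def of_real_eq_iff .
qed

text \<open>The density of the standard complex Gaussian; its real coordinates have variance 1/2, so
  its second absolute moment is 1.\<close>

definition crho :: "complex \<Rightarrow> real" where
  "crho z = exp (- (cmod z)\<^sup>2) / pi"

lemma nn_integral_complex_gaussian: "(\<integral>\<^sup>+z. ennreal (exp (- (cmod (z - c))\<^sup>2)) \<partial>lborel) = ennreal pi"
  using nn_integral_gaussian[of 1 c] by (simp add: power2_eq_square)

text \<open>Conditioning a Gaussian vector on its component orthogonal to \<open>b\<close>; proved from translation
  invariance, so that no coordinates adapted to \<open>b\<close> are needed.\<close>
lemma gaussian_disintegration: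
  fixes b :: "complex^'n" and H :: "complex^'n \<Rightarrow> ennreal"
  assumes b: "norm b = 1" and [measurable]: "H \<in> borel_measurable borel"
  shows "(\<integral>\<^sup>+u. H u * ennreal (exp (- (norm u)\<^sup>2)) \<partial>lborel)
    = (\<integral>\<^sup>+u. ennreal (exp (- (norm u)\<^sup>2)) * (\<integral>\<^sup>+z. H (u - bdot u (vcnj b) *s b + z *s b) * ennreal (crho z) \<partial>lborel) \<partial>lborel)"
proof -
  define y where "y u = bdot u (vcnj b)" for u
  have my: "y \<in> borel_measurable borel" unfolding y_def by (intro borel_measurable_continuous_onI continuous_intros)
  note [measurable] = my
  have [measurable]: "(\<lambda>z. z *s b) \<in> borel_measurable borel"
    by (intro borel_measurable_continuous_onI continuous_intros)
  have [measurable]: "crho \<in> borel_measurable borel" unfolding crho_def by measurable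
  define g where "g u = ennreal (exp (- (norm u)\<^sup>2))" for u :: "complex^'n"
  have [measurable]: "g \<in> borel_measurable borel" unfolding g_def by measurable
  have y_shift: "y (u + z *s b) = y u + z" for u z
    unfolding y_def bdot_add_left bdot_scale_left bdot_vcnj b by simp
  have sc: "(z + w) *s b = z *s b + w *s b" "(z - w) *s b = z *s b - w *s b" for z w
    by (simp_all add: vec_eq_iff algebra_simps)
  have "(\<integral>\<^sup>+u. g u * (\<integral>\<^sup>+z. H (u - y u *s b + z *s b) * ennreal (crho z) \<partial>lborel) \<partial>lborel)
     = (\<integral>\<^sup>+u. g u * (\<integral>\<^sup>+z. H (u + z *s b) * ennreal (crho (z + y u)) \<partial>lborel) \<partial>lborel)"
  proof (intro nn_integral_cong)
    fix u
    have m: "(\<lambda>z. H (u - y u *s b + z *s b) * ennreal (crho z)) \<in> borel_measurable borel" by measurable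
    show "g u * (\<integral>\<^sup>+z. H (u - y u *s b + z *s b) * ennreal (crho z) \<partial>lborel) = g u * (\<integral>\<^sup>+z. H (u + z *s b) * ennreal (crho (z + y u)) \<partial>lborel)"
      using nn_integral_lborel_translate[OF m, of "y u"] by (simp add: sc algebra_simps)
  qed
  also have "\<dots> = (\<integral>\<^sup>+u. (\<integral>\<^sup>+z. g u * (H (u + z *s b) * ennreal (crho (z + y u))) \<partial>lborel) \<partial>lborel)"
    by (intro nn_integral_cong nn_integral_cmult[symmetric]) measurable
  also have "\<dots> = (\<integral>\<^sup>+z. (\<integral>\<^sup>+u. g u * (H (u + z *s b) * ennreal (crho (z + y u))) \<partial>lborel) \<partial>lborel)"
    by (rule lborel_pair.Fubini'[symmetric]) measurable
  also have "\<dots> = (\<integral>\<^sup>+z. (\<integral>\<^sup>+u. g (u - z *s b) * (H u * ennreal (crho (y u))) \<partial>lborel) \<partial>lborel)"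
  proof (rule nn_integral_cong)
    fix z
    have m: "(\<lambda>u. g (u - z *s b) * (H u * ennreal (crho (y u)))) \<in> borel_measurable borel" by measurable
    show "(\<integral>\<^sup>+u. g u * (H (u + z *s b) * ennreal (crho (z + y u))) \<partial>lborel) = (\<integral>\<^sup>+u. g (u - z *s b) * (H u * ennreal (crho (y u))) \<partial>lborel)"
      using nn_integral_lborel_translate[OF m, of "z *s b"] by (simp add: y_shift add.commute)
  qed
  also have "\<dots> = (\<integral>\<^sup>+u. (\<integral>\<^sup>+z. g (u - z *s b) * (H u * ennreal (crho (y u))) \<partial>lborel) \<partial>lborel)"
    by (rule lborel_pair.Fubini') measurable
  also have "\<dots> = (\<integral>\<^sup>+u. H u * g u \<partial>lborel)"
  \<comment> \<open>For fixed \<open>u\<close> the integral over z is that of a Gaussian centered at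
    \<open>y u\<close>. Its mass pi and the factor exp (|y u|^2) cancel against
    \<open>crho (y u)\<close>.\<close>
  proof (intro nn_integral_cong)
    fix u
    have "g (u - z *s b) = ennreal (exp (- (norm u)\<^sup>2 + (cmod (y u))\<^sup>2)) * ennreal (exp (- (cmod (z - y u))\<^sup>2))" for z
      unfolding g_def norm_diff_scale_sq[OF b] y_def[symmetric]
      by (simp add: norm_minus_commute flip: ennreal_mult exp_add)
    then have "(\<integral>\<^sup>+z. g (u - z *s b) \<partial>lborel) = ennreal (exp (- (norm u)\<^sup>2 + (cmod (y u))\<^sup>2)) * ennreal pi"
      by (simp add: nn_integral_cmult nn_integral_complex_gaussian)
    moreover have "ennreal (exp (- (norm u)\<^sup>2 + (cmod (y u))\<^sup>2)) * ennreal pi * ennreal (crho (y u)) = g u"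
      unfolding g_def crho_def by (simp add: flip: ennreal_mult exp_add)
    moreover have "(\<integral>\<^sup>+z. g (u - z *s b) * (H u * ennreal (crho (y u))) \<partial>lborel) = (\<integral>\<^sup>+z. g (u - z *s b) \<partial>lborel) * (H u * ennreal (crho (y u)))"
      by (rule nn_integral_multc) measurable
    ultimately show "(\<integral>\<^sup>+z. g (u - z *s b) * (H u * ennreal (crho (y u))) \<partial>lborel) = H u * g u"
      by (simp only: mult.left_commute[of _ "H u"] mult.assoc)
  qed
  finally show ?thesis unfolding g_def y_def ..
qed

lemma nn_integral_crho_second_moment: "(\<integral>\<^sup>+z. ennreal ((cmod z)\<^sup>2) * ennreal (crho z) \<partial>lborel) = 1"
proof -
  have m0: "(\<integral>\<^sup>+t. ennreal (exp (- t\<^sup>2)) \<partial>lborel) = ennreal (sqrt pi)"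
    using nn_integral_gaussian[of 1 "0::real"] by simp
  have m2: "(\<integral>\<^sup>+t. ennreal (t\<^sup>2 * exp (- t\<^sup>2)) \<partial>lborel) = ennreal (sqrt pi / 2)"
  proof -
    have eq: "normal_density 0 (1 / sqrt 2) t * (t - 0) ^ (2 * 1) = (1 / sqrt pi) * (t\<^sup>2 * exp (- t\<^sup>2))" for t
      by (simp add: normal_density_def power_divide)
    have "has_bochner_integral lborel (\<lambda>t. (1 / sqrt pi) * (t\<^sup>2 * exp (- t\<^sup>2))) (1 / 2)"
      using normal_moment_even[of "1 / sqrt 2" 0 1] unfolding eq by (simp add: power_divide)
    then have i: "integrable lborel (\<lambda>t. (1 / sqrt pi) * (t\<^sup>2 * exp (- t\<^sup>2)))" "(\<integral>t. (1 / sqrt pi) * (t\<^sup>2 * exp (- t\<^sup>2)) \<partial>lborel) = 1 / 2"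
      by (auto simp: has_bochner_integral_iff)
    have "(\<integral>\<^sup>+t. ennreal (t\<^sup>2 * exp (- t\<^sup>2)) \<partial>lborel) = (\<integral>\<^sup>+t. ennreal (sqrt pi) * ennreal ((1 / sqrt pi) * (t\<^sup>2 * exp (- t\<^sup>2))) \<partial>lborel)"
      by (intro nn_integral_cong) (simp flip: ennreal_mult)
    also have "\<dots> = ennreal (sqrt pi) * (\<integral>\<^sup>+t. ennreal ((1 / sqrt pi) * (t\<^sup>2 * exp (- t\<^sup>2))) \<partial>lborel)"
      by (rule nn_integral_cmult) measurable
    also have "(\<integral>\<^sup>+t. ennreal ((1 / sqrt pi) * (t\<^sup>2 * exp (- t\<^sup>2))) \<partial>lborel) = ennreal (1 / 2)"
      unfolding i(2)[symmetric] by (rule nn_integral_eq_integral[OF i(1)]) auto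
    also have "ennreal (sqrt pi) * ennreal (1 / 2) = ennreal (sqrt pi / 2)"
      by (subst ennreal_mult[symmetric]) auto
    finally show ?thesis .
  qed
  have split: "ennreal ((cmod z)\<^sup>2 * exp (- (cmod z)\<^sup>2)) =
      (\<Prod>b\<in>Basis. ennreal (if b = 1 then (z \<bullet> b)\<^sup>2 * exp (- (z \<bullet> b)\<^sup>2) else exp (- (z \<bullet> b)\<^sup>2)))
    + (\<Prod>b\<in>Basis. ennreal (if b = \<i> then (z \<bullet> b)\<^sup>2 * exp (- (z \<bullet> b)\<^sup>2) else exp (- (z \<bullet> b)\<^sup>2)))" for z
    by (simp add: Basis_complex_def cmod_power2 inner_complex_def exp_diff exp_minus field_simps complex_eq_iff flip: ennreal_mult ennreal_plus)
  have p: "(\<integral>\<^sup>+z. (\<Prod>b\<in>Basis. ennreal (if b = c then (z \<bullet> b)\<^sup>2 * exp (- (z \<bullet> b)\<^sup>2) else exp (- (z \<bullet> b)\<^sup>2))) \<partial>lborel) = ennreal (pi / 2)"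
    if c: "c = 1 \<or> c = \<i>" for c :: complex
  proof -
    have "(\<integral>\<^sup>+z. (\<Prod>b\<in>Basis. ennreal (if b = c then (z \<bullet> b)\<^sup>2 * exp (- (z \<bullet> b)\<^sup>2) else exp (- (z \<bullet> b)\<^sup>2))) \<partial>lborel)
      = (\<Prod>b\<in>(Basis::complex set). (\<integral>\<^sup>+t. ennreal (if b = c then t\<^sup>2 * exp (- t\<^sup>2) else exp (- t\<^sup>2)) \<partial>lborel))"
      by (rule nn_integral_lborel_prod) auto
    also have "\<dots> = ennreal (sqrt pi / 2) * ennreal (sqrt pi)"
      using c by (auto simp: Basis_complex_def m0 m2 complex_eq_iff mult.commute)
    also have "\<dots> = ennreal (pi / 2)" by (simp flip: ennreal_mult)
    finally show ?thesis .
  qed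
  have "(\<integral>\<^sup>+z. ennreal ((cmod z)\<^sup>2) * ennreal (crho z) \<partial>lborel) = (\<integral>\<^sup>+z. ennreal (1 / pi) * ennreal ((cmod z)\<^sup>2 * exp (- (cmod z)\<^sup>2)) \<partial>lborel)"
    unfolding crho_def by (intro nn_integral_cong) (simp flip: ennreal_mult)
  also have "\<dots> = ennreal (1 / pi) * (\<integral>\<^sup>+z. ennreal ((cmod z)\<^sup>2 * exp (- (cmod z)\<^sup>2)) \<partial>lborel)"
    by (rule nn_integral_cmult) measurable
  also have "(\<integral>\<^sup>+z. ennreal ((cmod z)\<^sup>2 * exp (- (cmod z)\<^sup>2)) \<partial>lborel) = ennreal (pi / 2) + ennreal (pi / 2)"
    unfolding split using p by (subst nn_integral_add) auto
  finally show ?thesis by (simp flip: ennreal_mult ennreal_plus)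
qed

text \<open>Conditioning along the normalized conjugate \<open>b\<close> of \<open>m\<close>: the
  form \<open>bdot u m\<close> sees only the component z along \<open>b\<close>, where it equals z
  times \<open>norm m\<close>.\<close>

lemma gaussian_second_moment:
  fixes m :: "complex^'n"
  shows "(\<integral>\<^sup>+u. ennreal ((cmod (bdot u m))\<^sup>2) * ennreal (exp (- (norm u)\<^sup>2)) \<partial>lborel)
    = ennreal ((norm m)\<^sup>2) * (\<integral>\<^sup>+u. ennreal (exp (- (norm u)\<^sup>2)) \<partial>(lborel :: (complex^'n) measure))"
proof (cases "m = 0")
  case True
  then show ?thesis by (simp add: bdot_def)
next
  case False
  define b where "b = of_real (1 / norm m) *s vcnj m"
  have "b = (1 / norm m) *\<^sub>R vcnj m" unfolding b_def by (simp add: vec_eq_iff) (simp add: scaleR_conv_of_real)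
  then have b: "norm b = 1" using False by simp
  have vb: "bdot u (vcnj b) = bdot u m / of_real (norm m)" for u
    unfolding b_def bdot_def by (simp add: sum_divide_distrib)
  have bm: "bdot b m = of_real (norm m)"
    unfolding b_def bdot_scale_left bdot_vcnj using False by (simp add: power2_eq_square)
  have mm: "(\<lambda>u. ennreal ((cmod (bdot u m))\<^sup>2)) \<in> borel_measurable borel"
    by (intro measurable_compose[OF _ measurable_ennreal] borel_measurable_continuous_onI continuous_intros)
  have "bdot (u - bdot u (vcnj b) *s b + z *s b) m = z * of_real (norm m)" for u z
    unfolding bdot_add_left bdot_diff_left bdot_scale_left vb bm using False by simp
  then have "(\<integral>\<^sup>+z. ennreal ((cmod (bdot (u - bdot u (vcnj b) *s b + z *s b) m))\<^sup>2) * ennreal (crho z) \<partial>lborel)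
     = (\<integral>\<^sup>+z. ennreal ((norm m)\<^sup>2) * (ennreal ((cmod z)\<^sup>2) * ennreal (crho z)) \<partial>lborel)" for u
    by (simp add: norm_mult power_mult_distrib ennreal_mult mult_ac)
  also have "\<dots> = ennreal ((norm m)\<^sup>2)"
    using nn_integral_crho_second_moment by (subst nn_integral_cmult) (auto simp: crho_def)
  finally show ?thesis unfolding gaussian_disintegration[OF b mm]
    by (simp add: nn_integral_cmult mult.commute)
qed

text \<open>Up to normalization, the area of the complex projective line in an affine chart. Layer
  cake in q = |w|^2: \<open>k\<close> is minus the derivative of 1 / (1 + B q)^2, and the disc |w|^2
  \<le> q has area pi q. The resulting antiderivative B pi (q / (1 + B q))^2 tends to pi /
  B.\<close>

lemma nn_integral_fubini_study:
  assumes B: "B > 0"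
  shows "(\<integral>\<^sup>+w. ennreal (1 / (B * (cmod w)\<^sup>2 + 1)\<^sup>2) \<partial>lborel) = ennreal (pi / B)"
proof -
  define k where "k q = 2 * B * (inverse (1 + B * q)) ^ 3" for q
  have [measurable]: "k \<in> borel_measurable borel" unfolding k_def by measurable
  have k0: "k q \<ge> 0" if "q \<ge> 0" for q using that B by (simp add: k_def)
  have inv: "((\<lambda>q. inverse (1 + B * q)) has_real_derivative - (inverse (1 + B * q) * B * inverse (1 + B * q))) (at q)" if "1 + B * q \<noteq> 0" for q
    using that by (intro DERIV_inverse'[where f = "\<lambda>q. 1 + B * q"]) (auto intro!: derivative_eq_intros)
  have s: "ennreal (1 / (B * a + 1)\<^sup>2) = (\<integral>\<^sup>+q. ennreal (k q) * indicator {a..} q \<partial>lborel)" if a: "a \<ge> 0" for a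
  proof -
    have "(\<integral>\<^sup>+q. ennreal (k q) * indicator {a..} q \<partial>lborel) = ennreal (0 - (- (inverse (1 + B * a))\<^sup>2))"
    proof (rule nn_integral_FTC_atLeast[where F = "\<lambda>q. - (inverse (1 + B * q))\<^sup>2"])
      fix q assume "a \<le> q"
      then have q0: "1 + B * q \<noteq> 0" "q \<ge> 0" using a B by (smt (verit) mult_nonneg_nonneg)+
      show "((\<lambda>q. - (inverse (1 + B * q))\<^sup>2) has_real_derivative k q) (at q)"
        unfolding k_def using DERIV_minus[OF DERIV_power[OF inv[OF q0(1)], of 2]]
        by (simp add: power2_eq_square power3_eq_cube mult_ac)
      show "0 \<le> k q" using k0 q0 by simp
    next
      have "filterlim (\<lambda>q. B * q) at_top at_top"
        by (rule filterlim_tendsto_pos_mult_at_top[OF tendsto_const B filterlim_ident])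
      then have "((\<lambda>q. inverse (1 + B * q)) \<longlongrightarrow> 0) at_top"
        by (intro filterlim_compose[OF tendsto_inverse_0_at_top] filterlim_tendsto_add_at_top[OF tendsto_const])
          (auto intro: filterlim_ident)
      from tendsto_minus[OF tendsto_power[OF this, of 2]]
      show "((\<lambda>q. - (inverse (1 + B * q))\<^sup>2) \<longlongrightarrow> 0) at_top" by simp
    qed measurable
    then show ?thesis by (simp add: add.commute divide_inverse power_inverse)
  qed
  have m: "(\<lambda>(w::complex, q). ennreal (k q) * indicator {(cmod w)\<^sup>2..} q) \<in> borel_measurable (lborel \<Otimes>\<^sub>M lborel)"
    by (simp add: indicator_def)
  have "(\<integral>\<^sup>+w. ennreal (1 / (B * (cmod w)\<^sup>2 + 1)\<^sup>2) \<partial>lborel) = (\<integral>\<^sup>+w. (\<integral>\<^sup>+q. ennreal (k q) * indicator {(cmod w)\<^sup>2..} q \<partial>lborel) \<partial>lborel)"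
    by (intro nn_integral_cong s) simp
  also have "\<dots> = (\<integral>\<^sup>+q. (\<integral>\<^sup>+w. ennreal (k q) * indicator {(cmod w)\<^sup>2..} q \<partial>lborel) \<partial>lborel)"
    by (rule lborel_pair.Fubini'[symmetric]) (rule m)
  also have "\<dots> = (\<integral>\<^sup>+q. ennreal (2 * B * pi * q * (inverse (1 + B * q)) ^ 3) * indicator {0..} q \<partial>lborel)"
  proof (intro nn_integral_cong)
    fix q :: real
    show "(\<integral>\<^sup>+w. ennreal (k q) * indicator {(cmod w)\<^sup>2..} q \<partial>lborel) = ennreal (2 * B * pi * q * (inverse (1 + B * q)) ^ 3) * indicator {0..} q"
    proof (cases "q \<ge> 0")
      case True
      have "indicator {(cmod w)\<^sup>2..} q = (indicator (cball 0 (sqrt q)) w :: ennreal)" for w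
        using True real_sqrt_le_iff[of "(cmod w)\<^sup>2" q] by (simp add: indicator_def)
      then have "(\<integral>\<^sup>+w. ennreal (k q) * indicator {(cmod w)\<^sup>2..} q \<partial>lborel) = ennreal (k q) * emeasure lborel (cball (0::complex) (sqrt q))"
        by (simp add: nn_integral_cmult_indicator)
      also have "emeasure lborel (cball (0::complex) (sqrt q)) = ennreal (pi * q)"
        using True by (simp add: emeasure_cball unit_ball_vol_2)
      finally show ?thesis using True k0[OF True] by (simp add: k_def mult_ac flip: ennreal_mult)
    next
      case False
      then have "indicator {(cmod w)\<^sup>2..} q = (0 :: ennreal)" for w :: complex
        by (auto simp: indicator_def) (smt (verit) zero_le_power2)
      then show ?thesis using False by simp
    qed
  qed
  also have "\<dots> = ennreal (pi / B - B * pi * (0 * inverse (1 + B * 0))\<^sup>2)"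
  proof (rule nn_integral_FTC_atLeast[where F = "\<lambda>q. B * pi * (q * inverse (1 + B * q))\<^sup>2"])
    fix q :: real assume "0 \<le> q"
    then have "1 + B * q > 0" using B by (simp add: add_pos_nonneg)
    then have r: "1 + B * q \<noteq> 0" "1 - q * B * inverse (1 + B * q) = inverse (1 + B * q)" by (auto simp: field_simps)
    define j where "j = inverse (1 + B * q)"
    have "j * (1 - q * B * j) = j * j" unfolding j_def r(2) ..
    then have e: "1 * j + - (j * B * j) * q = j * j" by (simp add: algebra_simps)
    show "((\<lambda>q. B * pi * (q * inverse (1 + B * q))\<^sup>2) has_real_derivative 2 * B * pi * q * (inverse (1 + B * q)) ^ 3) (at q)"
    proof (rule DERIV_cong[OF DERIV_cmult[OF DERIV_power[OF DERIV_mult[OF DERIV_ident inv[OF r(1)]], of 2], of "B * pi"]])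
      show "B * pi * (of_nat 2 * ((1 * inverse (1 + B * q) + - (inverse (1 + B * q) * B * inverse (1 + B * q)) * q) * (q * inverse (1 + B * q)) ^ (2 - Suc 0))) = 2 * B * pi * q * (inverse (1 + B * q)) ^ 3"
        unfolding j_def[symmetric] e by (simp add: power3_eq_cube mult_ac)
    qed
    show "0 \<le> 2 * B * pi * q * (inverse (1 + B * q)) ^ 3" using B \<open>0 \<le> q\<close> by simp
  next
    have "((\<lambda>q. inverse (inverse q + B)) \<longlongrightarrow> inverse (0 + B)) at_top"
      using B by (intro tendsto_intros tendsto_inverse_0_at_top filterlim_ident) auto
    then have "((\<lambda>q. B * pi * (inverse (inverse q + B))\<^sup>2) \<longlongrightarrow> B * pi * (inverse (0 + B))\<^sup>2) at_top"
      by (rule tendsto_mult[OF tendsto_const tendsto_power])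
    then have "((\<lambda>q. B * pi * (inverse (inverse q + B))\<^sup>2) \<longlongrightarrow> pi / B) at_top"
      using B by (simp add: power2_eq_square field_simps)
    then show "((\<lambda>q. B * pi * (q * inverse (1 + B * q))\<^sup>2) \<longlongrightarrow> pi / B) at_top"
    proof (rule Lim_transform_eventually)
      show "\<forall>\<^sub>F q in at_top. B * pi * (inverse (inverse q + B))\<^sup>2 = B * pi * (q * inverse (1 + B * q))\<^sup>2"
        using eventually_gt_at_top[of "0::real"]
      proof eventually_elim
        fix q :: real assume "0 < q"
        then have "inverse (inverse q + B) = q * inverse (1 + B * q)" using B by (simp add: field_simps)
        then show "B * pi * (inverse (inverse q + B))\<^sup>2 = B * pi * (q * inverse (1 + B * q))\<^sup>2" by simp
      qed
    qed
  qed measurable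
  finally show ?thesis by simp
qed

section \<open>Concentration of energy on hyperplanes\<close>

text \<open>Fatou for the counting measure.\<close>

lemma sum_liminf_le:
  fixes f :: "nat \<Rightarrow> 'k::finite \<Rightarrow> ennreal"
  shows "(\<Sum>i\<in>UNIV. liminf (\<lambda>n. f n i)) \<le> liminf (\<lambda>n. \<Sum>i\<in>UNIV. f n i)"
  using nn_integral_liminf[of f "count_space UNIV"]
  by (simp add: nn_integral_count_space_finite)

text \<open>Fatou on a one-point space of mass \<open>c\<close>, which includes infinite
  \<open>c\<close>.\<close>

lemma mult_liminf_le:
  fixes c :: ennreal
  shows "c * liminf f \<le> liminf (\<lambda>n. c * f n)"
  using nn_integral_liminf[of "\<lambda>n (_::unit). f n" "density (count_space UNIV) (\<lambda>_. c)"]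
  by (simp add: nn_integral_density nn_integral_count_space_finite UNIV_unit emeasure_density mult.commute)

lemma bdot_eq_0_negligible: "m \<noteq> 0 \<Longrightarrow> AE u in lborel. bdot u m \<noteq> 0"
proof -
  assume m: "m \<noteq> 0"
  have "Re (bdot u m) = vcnj m \<bullet> u" for u
    by (simp add: bdot_def inner_vec_def inner_complex_def mult.commute)
  then have "{u. bdot u m = 0} \<subseteq> {u. vcnj m \<bullet> u = 0}"
    by (metis (mono_tags, lifting) mem_Collect_eq subsetI zero_complex.sel(1))
  moreover have "vcnj m \<noteq> 0" using m norm_vcnj[of m] by (metis norm_eq_zero)
  ultimately have "negligible {u. bdot u m = 0}"
    using negligible_hyperplane negligible_subset by blast
  then show ?thesis using AE_lborel_notin_negligible by fastforce
qed

text \<open>Describes one fixed matrix: the \<open>v i\<close> are its eigenvectors,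
  \<open>D\<close> is the determinant as a function of \<open>u\<close>, \<open>G a\<close> its
  derivative in the matrix direction \<open>a\<close>, and \<open>M i a\<close> the first-order
  motion of \<open>v i\<close> in that direction. Assumption \<open>G\<close> is the product rule at
  a point where the i-th factor vanishes.\<close>

locale linear_form_product =
  fixes v :: "'n::finite \<Rightarrow> complex^'n" and c :: complex and D :: "complex^'n \<Rightarrow> complex"
    and G :: "'k::finite \<Rightarrow> complex^'n \<Rightarrow> complex" and M :: "'n \<Rightarrow> 'k \<Rightarrow> complex^'n"
  assumes v_nz: "v i \<noteq> 0" and v_indep: "i \<noteq> j \<Longrightarrow> v j \<noteq> z *s v i" and c: "c \<noteq> 0"
    and D: "D u = c * (\<Prod>i\<in>UNIV. bdot u (v i))"
    and contG: "continuous_on UNIV (G a)"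
    and G: "bdot u (v i) = 0 \<Longrightarrow> G a u = c * (\<Prod>j\<in>UNIV - {i}. bdot u (v j)) * bdot u (M i a)"
    and M_perp: "bdot (vcnj (v i)) (M i a) = 0"
begin

text \<open>The regularization e is the square of \<open>h k\<close>: near a generic point of a
  hyperplane, \<open>D\<close> is linear in the distance to first order, which makes
  \<open>h k\<close> the width of the layer.\<close>

definition h :: "nat \<Rightarrow> real" where "h k = 1 / real (Suc k)"

definition Psi :: "nat \<Rightarrow> complex^'n \<Rightarrow> real" where
  "Psi k u = (\<Sum>a\<in>UNIV. (h k)\<^sup>2 * (cmod (G a u))\<^sup>2 / ((cmod (D u))\<^sup>2 + (h k)\<^sup>2)\<^sup>2)"

definition R :: "'n \<Rightarrow> nat \<Rightarrow> (complex^'n) set" where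
  "R i k = {u. cmod (bdot u (v i)) < sqrt (h k) \<and> (\<forall>j\<in>UNIV - {i}. sqrt (h k) \<le> cmod (bdot u (v j)))}"

lemma h_pos: "h k > 0" by (simp add: h_def)

lemma h_lim: "h \<longlonglongrightarrow> 0"
  unfolding h_def using LIMSEQ_Suc[OF lim_inverse_n'] by (simp del: of_nat_Suc)

lemma cont_D: "continuous_on S D"
  unfolding D by (intro continuous_intros)

lemma Psi_nonneg: "0 \<le> Psi k u"
  unfolding Psi_def by (intro sum_nonneg) auto

lemma meas_Psi [measurable]: "Psi k \<in> borel_measurable borel"
proof -
  have "(cmod z)\<^sup>2 + (h k)\<^sup>2 \<noteq> 0" for z using h_pos[of k] by (smt (verit) zero_le_power2 zero_less_power)
  then show ?thesis unfolding Psi_def[abs_def]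
    by (intro borel_measurable_continuous_onI continuous_intros cont_D contG) auto
qed

lemma meas_R [measurable]: "R i k \<in> sets borel"
proof -
  have [measurable]: "(\<lambda>u. bdot u (v j)) \<in> borel_measurable borel" for j
    by (intro borel_measurable_continuous_onI continuous_intros)
  show ?thesis unfolding R_def by measurable
qed

text \<open>On \<open>R i k\<close> the i-th form is the only one below sqrt (h k) in modulus, so i
  is determined by u.\<close>

lemma disjoint_R: "(\<Sum>i\<in>UNIV. indicator (R i k) u) \<le> (1::ennreal)"
proof (cases "\<exists>i. u \<in> R i k")
  case True
  then obtain i where i: "u \<in> R i k" by blast
  have "u \<notin> R j k" if "j \<noteq> i" for j
    using i that unfolding R_def by (auto simp: not_less)
  then have "indicator (R j k) u = (if j = i then 1 else 0 :: ennreal)" for j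
    using i by (auto simp: indicator_def)
  then show ?thesis by simp
qed (auto simp: indicator_def)

definition gauss_const :: ennreal where
  "gauss_const = (\<integral>\<^sup>+u. ennreal (exp (- (norm u)\<^sup>2)) \<partial>(lborel :: (complex^'n) measure))"

text \<open>\<open>R i k\<close> is a neighbourhood of the generic points of the hyperplane \<open>bdot u (v i) = 0\<close> of width
  \<open>sqrt (h k)\<close>, while the energy concentrates at scale \<open>h k\<close>; different \<open>i\<close> give disjoint regions.\<close>
lemma liminf_local:
  "ennreal ((\<Sum>a\<in>UNIV. (norm (M i a))\<^sup>2) / (norm (v i))\<^sup>2) * gauss_const
    \<le> liminf (\<lambda>k. \<integral>\<^sup>+u. indicator (R i k) u * ennreal (Psi k u) * ennreal (exp (- (norm u)\<^sup>2)) \<partial>lborel)"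
proof -
  define nv where "nv = norm (v i)"
  have nv: "nv > 0" using v_nz[of i] by (simp add: nv_def)
  define b where "b = of_real (1 / nv) *s vcnj (v i)"
  have "b = (1 / nv) *\<^sub>R vcnj (v i)" unfolding b_def by (simp add: vec_eq_iff) (simp add: scaleR_conv_of_real)
  then have nb: "norm b = 1" using nv by (simp add: nv_def)
  have vb: "bdot u (vcnj b) = bdot u (v i) / of_real nv" for u
    unfolding b_def bdot_def by (simp add: sum_divide_distrib)
  have bv: "bdot b (v i) = of_real nv"
    unfolding b_def bdot_scale_left bdot_vcnj using nv by (simp add: nv_def[symmetric] power2_eq_square)
  have bM: "bdot b (M i a) = 0" for a
    unfolding b_def bdot_scale_left M_perp by simp
  \<comment> \<open>Orthogonal projection onto the hyperplane on which the i-th form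
    vanishes.\<close>
  define p where "p u = u - bdot u (vcnj b) *s b" for u
  have p_vi: "bdot (p u) (v i) = 0" for u
    unfolding p_def bdot_diff_left bdot_scale_left vb bv using nv by simp
  \<comment> \<open>Since \<open>M i a\<close> is orthogonal to \<open>v i\<close>, projecting
    \<open>u\<close> does not change its pairing with \<open>M i a\<close>. The limit can therefore
    be averaged over \<open>u\<close> itself.\<close>
  have pM: "bdot (p u) (M i a) = bdot u (M i a)" for u a
    unfolding p_def bdot_diff_left bdot_scale_left bM by simp
  have cp: "continuous_on UNIV p" unfolding p_def by (intro continuous_intros)
  have p_vj: "AE u in lborel. bdot (p u) (v j) \<noteq> 0" if j: "j \<noteq> i" for j
  proof -
    define w where "w = v j - (bdot b (v j) / of_real nv) *s v i"
    have "bdot (p u) (v j) = bdot u w" for u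
      unfolding p_def w_def bdot_diff_left bdot_scale_left vb
      by (simp add: bdot_commute[of u] bdot_diff_left bdot_scale_left)
    moreover have "w \<noteq> 0" using v_indep[of i j "bdot b (v j) / of_real nv"] j by (auto simp: w_def)
    ultimately show ?thesis using bdot_eq_0_negligible[of w] by simp
  qed
  define g where "g u = ennreal (exp (- (norm u)\<^sup>2))" for u :: "complex^'n"
  have [measurable]: "g \<in> borel_measurable borel" unfolding g_def by measurable
  define B where "B u = (cmod (c * (\<Prod>j\<in>UNIV - {i}. bdot (p u) (v j))))\<^sup>2 * nv\<^sup>2" for u
  \<comment> \<open>Blow-up of the normal coordinate, z = h w. The Jacobian in two real dimensions
    is the factor (h k)^2 of \<open>T\<close>.\<close>
  define x where "x k u w = p u + (of_real (h k) * w) *s b" for k u w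
  have cx: "continuous_on UNIV (\<lambda>(u, w). x k u w)" for k
    unfolding x_def split_beta by (intro continuous_intros continuous_on_compose2[OF cp]) auto
  have [measurable]: "(\<lambda>(u, w). x k u w) \<in> borel_measurable (borel \<Otimes>\<^sub>M borel)" for k
    unfolding borel_prod by (rule borel_measurable_continuous_onI[OF cx])
  have [measurable]: "(\<lambda>w. x k u w) \<in> borel_measurable borel" for k u
    unfolding x_def by (intro borel_measurable_continuous_onI continuous_intros)
  have [measurable]: "crho \<in> borel_measurable borel" unfolding crho_def by measurable
  define T where "T k u w = ennreal ((h k)\<^sup>2) * (indicator (R i k) (x k u w) * ennreal (Psi k (x k u w)) * ennreal (crho (of_real (h k) * w)))" for k u w
  have mT: "(\<lambda>(u, w). T k u w) \<in> borel_measurable (lborel \<Otimes>\<^sub>M lborel)" for k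
    unfolding T_def by measurable
  have mT': "T k u \<in> borel_measurable lborel" for k u
    unfolding T_def by measurable
  have step: "(\<integral>\<^sup>+u. indicator (R i k) u * ennreal (Psi k u) * g u \<partial>lborel) = (\<integral>\<^sup>+u. g u * (\<integral>\<^sup>+w. T k u w \<partial>lborel) \<partial>lborel)" for k
  proof -
    have "(\<integral>\<^sup>+u. indicator (R i k) u * ennreal (Psi k u) * g u \<partial>lborel)
      = (\<integral>\<^sup>+u. g u * (\<integral>\<^sup>+z. indicator (R i k) (p u + z *s b) * ennreal (Psi k (p u + z *s b)) * ennreal (crho z) \<partial>lborel) \<partial>lborel)"
      unfolding g_def p_def by (rule gaussian_disintegration[OF nb]) measurable
    moreover have "(\<integral>\<^sup>+z. indicator (R i k) (p u + z *s b) * ennreal (Psi k (p u + z *s b)) * ennreal (crho z) \<partial>lborel)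
      = (\<integral>\<^sup>+w. T k u w \<partial>lborel)" for u
    proof -
      have [measurable]: "(\<lambda>z. p u + z *s b) \<in> borel_measurable borel"
        by (intro borel_measurable_continuous_onI continuous_intros)
      have m: "(\<lambda>z. indicator (R i k) (p u + z *s b) * ennreal (Psi k (p u + z *s b)) * ennreal (crho z)) \<in> borel_measurable borel"
        by measurable
      show ?thesis
        unfolding nn_integral_lborel_scale[OF m h_pos[of k]] T_def x_def
        by (subst nn_integral_cmult[symmetric]) (auto simp: scaleR_conv_of_real)
    qed
    ultimately show ?thesis by (simp only:)
  qed
  \<comment> \<open>In the blown-up coordinate \<open>D\<close> is h E with E convergent, so the
    denominator is h^4 (|E|^2 + 1)^2. The Jacobian and the regularization supply exactly h^4 in the
    numerator, and a limit free of h remains.\<close>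
  have lim: "ennreal ((\<Sum>a\<in>UNIV. (cmod (G a (p u)))\<^sup>2 / (B u * (cmod w)\<^sup>2 + 1)\<^sup>2) * crho 0) \<le> liminf (\<lambda>k. T k u w)"
    if nz: "\<forall>j\<in>UNIV - {i}. bdot (p u) (v j) \<noteq> 0" for u w
  proof -
    have xl: "(\<lambda>k. x k u w) \<longlonglongrightarrow> p u"
    proof -
      have "continuous_on UNIV (\<lambda>t. p u + (of_real t * w) *s b)" by (intro continuous_intros)
      then have "isCont (\<lambda>t. p u + (of_real t * w) *s b) 0" by (simp add: continuous_on_eq_continuous_at)
      from isCont_tendsto_compose[OF this h_lim] show ?thesis unfolding x_def by simp
    qed
    have compose: "(\<lambda>k. f (x k u w)) \<longlonglongrightarrow> f (p u)" if "continuous_on UNIV f" for f :: "complex^'n \<Rightarrow> complex"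
      using isCont_tendsto_compose[OF _ xl, of f] that by (simp add: continuous_on_eq_continuous_at)
    have yj: "(\<lambda>k. bdot (x k u w) (v j)) \<longlonglongrightarrow> bdot (p u) (v j)" for j
      by (rule compose) (intro continuous_intros)
    have yi: "bdot (x k u w) (v i) = of_real (h k) * (w * of_real nv)" for k
      unfolding x_def bdot_add_left bdot_scale_left p_vi bv by simp
    have hs: "(\<lambda>k. sqrt (h k)) \<longlonglongrightarrow> 0" using tendsto_real_sqrt[OF h_lim] by simp
    define E where "E k = w * of_real nv * (c * (\<Prod>j\<in>UNIV - {i}. bdot (x k u w) (v j)))" for k
    have DE: "D (x k u w) = of_real (h k) * E k" for k
      unfolding D E_def by (subst prod.remove[of UNIV i]) (simp_all add: yi mult_ac)
    have "E \<longlonglongrightarrow> w * of_real nv * (c * (\<Prod>j\<in>UNIV - {i}. bdot (p u) (v j)))"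
      unfolding E_def by (intro tendsto_intros yj)
    then have "(\<lambda>k. (cmod (E k))\<^sup>2) \<longlonglongrightarrow> (cmod (w * of_real nv * (c * (\<Prod>j\<in>UNIV - {i}. bdot (p u) (v j)))))\<^sup>2"
      by (intro tendsto_intros)
    then have El: "(\<lambda>k. (cmod (E k))\<^sup>2) \<longlonglongrightarrow> B u * (cmod w)\<^sup>2"
      unfolding B_def by (simp add: norm_mult power_mult_distrib mult_ac)
    define L where "L k = (\<Sum>a\<in>UNIV. (cmod (G a (x k u w)))\<^sup>2 / ((cmod (E k))\<^sup>2 + 1)\<^sup>2) * crho (of_real (h k) * w)" for k
    have cr: "(\<lambda>k. crho (of_real (h k) * w)) \<longlonglongrightarrow> crho 0"
    proof -
      have "(\<lambda>k. exp (- (cmod (of_real (h k) * w))\<^sup>2) / pi) \<longlonglongrightarrow> exp (- (cmod (of_real 0 * w))\<^sup>2) / pi"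
        by (intro tendsto_intros h_lim) simp
      then show ?thesis unfolding crho_def by simp
    qed
    have B0: "B u * (cmod w)\<^sup>2 + 1 \<noteq> 0" unfolding B_def
      by (smt (verit) mult_nonneg_nonneg zero_le_power2)
    have "L \<longlonglongrightarrow> (\<Sum>a\<in>UNIV. (cmod (G a (p u)))\<^sup>2 / (B u * (cmod w)\<^sup>2 + 1)\<^sup>2) * crho 0"
      unfolding L_def by (intro tendsto_intros compose contG El cr) (use B0 in simp)
    then have Ll: "(\<lambda>k. ennreal (L k)) \<longlonglongrightarrow> ennreal ((\<Sum>a\<in>UNIV. (cmod (G a (p u)))\<^sup>2 / (B u * (cmod w)\<^sup>2 + 1)\<^sup>2) * crho 0)"
      by (rule tendsto_ennrealI)
    \<comment> \<open>The i-th form is of order h, hence below sqrt h, while the other forms tend to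
      nonzero values.\<close>
    have evR: "\<forall>\<^sub>F k in sequentially. x k u w \<in> R i k"
    proof -
      have "(\<lambda>k. cmod w * nv * sqrt (h k)) \<longlonglongrightarrow> cmod w * nv * 0" by (intro tendsto_intros hs)
      then have "\<forall>\<^sub>F k in sequentially. cmod w * nv * sqrt (h k) < 1"
        by (rule order_tendstoD) simp
      then have e1: "\<forall>\<^sub>F k in sequentially. cmod (bdot (x k u w) (v i)) < sqrt (h k)"
      proof eventually_elim
        fix k assume a: "cmod w * nv * sqrt (h k) < 1"
        have "cmod (bdot (x k u w) (v i)) = (cmod w * nv * sqrt (h k)) * sqrt (h k)"
          unfolding yi using h_pos[of k] nv by (simp add: norm_mult mult_ac)
        also have "\<dots> < 1 * sqrt (h k)" using a h_pos[of k] by (intro mult_strict_right_mono) auto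
        finally show "cmod (bdot (x k u w) (v i)) < sqrt (h k)" by simp
      qed
      have "\<forall>\<^sub>F k in sequentially. sqrt (h k) \<le> cmod (bdot (x k u w) (v j))" if "j \<in> UNIV - {i}" for j
      proof -
        have "(\<lambda>k. cmod (bdot (x k u w) (v j)) - sqrt (h k)) \<longlonglongrightarrow> cmod (bdot (p u) (v j)) - 0"
          by (intro tendsto_intros yj hs)
        then have "\<forall>\<^sub>F k in sequentially. 0 < cmod (bdot (x k u w) (v j)) - sqrt (h k)"
          by (rule order_tendstoD) (use nz that in simp)
        then show ?thesis by eventually_elim simp
      qed
      then have "\<forall>\<^sub>F k in sequentially. \<forall>j\<in>UNIV - {i}. sqrt (h k) \<le> cmod (bdot (x k u w) (v j))"
        by (intro eventually_ball_finite) auto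
      with e1 show ?thesis unfolding R_def by eventually_elim simp
    qed
    have TL: "T k u w = ennreal (L k)" if "x k u w \<in> R i k" for k
    proof -
      have "(h k)\<^sup>2 * Psi k (x k u w) = (\<Sum>a\<in>UNIV. (cmod (G a (x k u w)))\<^sup>2 / ((cmod (E k))\<^sup>2 + 1)\<^sup>2)"
      proof -
        have "(h k)\<^sup>2 * ((h k)\<^sup>2 * y / ((cmod (D (x k u w)))\<^sup>2 + (h k)\<^sup>2)\<^sup>2) = y / ((cmod (E k))\<^sup>2 + 1)\<^sup>2" for y
        proof -
          have "(cmod (D (x k u w)))\<^sup>2 + (h k)\<^sup>2 = (h k)\<^sup>2 * ((cmod (E k))\<^sup>2 + 1)"
            unfolding DE by (simp add: norm_mult power_mult_distrib algebra_simps)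
          then show ?thesis using h_pos[of k] by (simp add: power_mult_distrib power2_eq_square[of "(h k)\<^sup>2"])
        qed
        then show ?thesis unfolding Psi_def sum_distrib_left by simp
      qed
      then show ?thesis unfolding T_def L_def using that Psi_nonneg h_pos[of k]
        by (simp add: crho_def mult.assoc[symmetric] flip: ennreal_mult)
    qed
    have "(\<lambda>k. T k u w) \<longlonglongrightarrow> ennreal ((\<Sum>a\<in>UNIV. (cmod (G a (p u)))\<^sup>2 / (B u * (cmod w)\<^sup>2 + 1)\<^sup>2) * crho 0)"
      by (rule Lim_transform_eventually[OF Ll]) (use evR in eventually_elim, simp add: TL)
    then show ?thesis using lim_imp_Liminf[OF trivial_limit_sequentially] by (metis order_refl)
  qed
  have low: "AE u in lborel. ennreal ((\<Sum>a\<in>UNIV. (cmod (bdot u (M i a)))\<^sup>2) / nv\<^sup>2) \<le> liminf (\<lambda>k. \<integral>\<^sup>+w. T k u w \<partial>lborel)"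
  proof -
    have "AE u in lborel. \<forall>j\<in>UNIV - {i}. bdot (p u) (v j) \<noteq> 0"
      using p_vj by (intro AE_finite_allI) auto
    then show ?thesis
    proof eventually_elim
      fix u assume nz: "\<forall>j\<in>UNIV - {i}. bdot (p u) (v j) \<noteq> 0"
      define C where "C = (cmod (c * (\<Prod>j\<in>UNIV - {i}. bdot (p u) (v j))))\<^sup>2"
      have C: "C > 0" unfolding C_def using nz c by simp
      have Bu: "B u = C * nv\<^sup>2" "B u > 0" unfolding B_def C_def[symmetric] using C nv by auto
      define S where "S = (\<Sum>a\<in>UNIV. (cmod (bdot u (M i a)))\<^sup>2)"
      have S0: "S \<ge> 0" unfolding S_def by (intro sum_nonneg) auto
      have GS: "(\<Sum>a\<in>UNIV. (cmod (G a (p u)))\<^sup>2 / y) = C * S / y" for y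
        unfolding S_def C_def G[OF p_vi] pM by (simp add: norm_mult power_mult_distrib sum_divide_distrib sum_distrib_left mult.assoc)
      \<comment> \<open>The squared modulus \<open>C\<close> of the remaining factors enters the
        gradient and \<open>B u\<close> alike and cancels; pi cancels with
        \<open>crho 0\<close>.\<close>
      have "ennreal (S / nv\<^sup>2) = ennreal (C * S / pi) * ennreal (pi / B u)"
        using C nv S0 by (simp add: Bu(1) flip: ennreal_mult)
      also have "\<dots> = (\<integral>\<^sup>+w. ennreal (C * S / pi) * ennreal (1 / (B u * (cmod w)\<^sup>2 + 1)\<^sup>2) \<partial>lborel)"
        unfolding nn_integral_fubini_study[OF Bu(2), symmetric] by (rule nn_integral_cmult[symmetric]) measurable
      also have "\<dots> = (\<integral>\<^sup>+w. ennreal ((\<Sum>a\<in>UNIV. (cmod (G a (p u)))\<^sup>2 / (B u * (cmod w)\<^sup>2 + 1)\<^sup>2) * crho 0) \<partial>lborel)"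
        unfolding GS using C S0 by (intro nn_integral_cong) (simp add: crho_def flip: ennreal_mult)
      also have "\<dots> \<le> (\<integral>\<^sup>+w. liminf (\<lambda>k. T k u w) \<partial>lborel)"
        by (intro nn_integral_mono lim nz)
      also have "\<dots> \<le> liminf (\<lambda>k. \<integral>\<^sup>+w. T k u w \<partial>lborel)"
        by (rule nn_integral_liminf[OF mT'])
      finally show "ennreal ((\<Sum>a\<in>UNIV. (cmod (bdot u (M i a)))\<^sup>2) / nv\<^sup>2) \<le> liminf (\<lambda>k. \<integral>\<^sup>+w. T k u w \<partial>lborel)"
        unfolding S_def .
    qed
  qed
  have "ennreal ((\<Sum>a\<in>UNIV. (norm (M i a))\<^sup>2) / nv\<^sup>2) * gauss_const
     = (\<integral>\<^sup>+u. g u * ennreal ((\<Sum>a\<in>UNIV. (cmod (bdot u (M i a)))\<^sup>2) / nv\<^sup>2) \<partial>lborel)"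
  proof -
    have mb: "(\<lambda>u. ennreal ((cmod (bdot u m))\<^sup>2)) \<in> borel_measurable lborel" for m
      using borel_measurable_continuous_onI[of "\<lambda>u. (cmod (bdot u m))\<^sup>2"] by (simp add: continuous_intros)
    have "(\<integral>\<^sup>+u. g u * ennreal ((\<Sum>a\<in>UNIV. (cmod (bdot u (M i a)))\<^sup>2) / nv\<^sup>2) \<partial>lborel)
      = (\<integral>\<^sup>+u. ennreal (1 / nv\<^sup>2) * (\<Sum>a\<in>UNIV. ennreal ((cmod (bdot u (M i a)))\<^sup>2) * g u) \<partial>lborel)"
    proof (rule nn_integral_cong)
      fix u
      have "ennreal ((\<Sum>a\<in>UNIV. (cmod (bdot u (M i a)))\<^sup>2) / nv\<^sup>2) = ennreal (1 / nv\<^sup>2) * (\<Sum>a\<in>UNIV. ennreal ((cmod (bdot u (M i a)))\<^sup>2))"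
        by (subst sum_ennreal, simp, subst ennreal_mult[symmetric]) (auto intro!: sum_nonneg)
      then show "g u * ennreal ((\<Sum>a\<in>UNIV. (cmod (bdot u (M i a)))\<^sup>2) / nv\<^sup>2) = ennreal (1 / nv\<^sup>2) * (\<Sum>a\<in>UNIV. ennreal ((cmod (bdot u (M i a)))\<^sup>2) * g u)"
        by (simp add: sum_distrib_left mult_ac del: sum_ennreal)
    qed
    also have "\<dots> = ennreal (1 / nv\<^sup>2) * (\<Sum>a\<in>UNIV. (\<integral>\<^sup>+u. ennreal ((cmod (bdot u (M i a)))\<^sup>2) * g u \<partial>lborel))"
    proof -
      note [measurable] = mb
      have "(\<integral>\<^sup>+u. (\<Sum>a\<in>UNIV. ennreal ((cmod (bdot u (M i a)))\<^sup>2) * g u) \<partial>lborel) = (\<Sum>a\<in>UNIV. (\<integral>\<^sup>+u. ennreal ((cmod (bdot u (M i a)))\<^sup>2) * g u \<partial>lborel))"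
        by (rule nn_integral_sum) measurable
      moreover have "(\<integral>\<^sup>+u. ennreal (1 / nv\<^sup>2) * (\<Sum>a\<in>UNIV. ennreal ((cmod (bdot u (M i a)))\<^sup>2) * g u) \<partial>lborel)
         = ennreal (1 / nv\<^sup>2) * (\<integral>\<^sup>+u. (\<Sum>a\<in>UNIV. ennreal ((cmod (bdot u (M i a)))\<^sup>2) * g u) \<partial>lborel)"
        by (rule nn_integral_cmult) measurable
      ultimately show ?thesis by (simp only:)
    qed
    also have "\<dots> = ennreal (1 / nv\<^sup>2) * (\<Sum>a\<in>UNIV. ennreal ((norm (M i a))\<^sup>2)) * gauss_const"
      unfolding g_def gaussian_second_moment gauss_const_def by (simp add: sum_distrib_right mult.assoc del: sum_ennreal)
    also have "ennreal (1 / nv\<^sup>2) * (\<Sum>a\<in>UNIV. ennreal ((norm (M i a))\<^sup>2)) = ennreal ((\<Sum>a\<in>UNIV. (norm (M i a))\<^sup>2) / nv\<^sup>2)"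
      by (subst sum_ennreal, simp, subst ennreal_mult[symmetric]) (auto intro!: sum_nonneg)
    finally show ?thesis ..
  qed
  also have "\<dots> \<le> (\<integral>\<^sup>+u. liminf (\<lambda>k. g u * (\<integral>\<^sup>+w. T k u w \<partial>lborel)) \<partial>lborel)"
  proof (rule nn_integral_mono_AE, use low in eventually_elim)
    fix u assume "ennreal ((\<Sum>a\<in>UNIV. (cmod (bdot u (M i a)))\<^sup>2) / nv\<^sup>2) \<le> liminf (\<lambda>k. \<integral>\<^sup>+w. T k u w \<partial>lborel)"
    then have "g u * ennreal ((\<Sum>a\<in>UNIV. (cmod (bdot u (M i a)))\<^sup>2) / nv\<^sup>2) \<le> g u * liminf (\<lambda>k. \<integral>\<^sup>+w. T k u w \<partial>lborel)"
      by (rule mult_left_mono) simp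
    also have "\<dots> \<le> liminf (\<lambda>k. g u * (\<integral>\<^sup>+w. T k u w \<partial>lborel))"
      by (rule mult_liminf_le)
    finally show "g u * ennreal ((\<Sum>a\<in>UNIV. (cmod (bdot u (M i a)))\<^sup>2) / nv\<^sup>2) \<le> liminf (\<lambda>k. g u * (\<integral>\<^sup>+w. T k u w \<partial>lborel))" .
  qed
  also have "\<dots> \<le> liminf (\<lambda>k. \<integral>\<^sup>+u. g u * (\<integral>\<^sup>+w. T k u w \<partial>lborel) \<partial>lborel)"
    using mT by (intro nn_integral_liminf borel_measurable_times_ennreal lborel.borel_measurable_nn_integral) auto
  finally show ?thesis unfolding g_def[symmetric] step nv_def[symmetric] .
qed

text \<open>The regions \<open>R i k\<close> are disjoint for fixed k, so the local lower bounds add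
  up.\<close>

lemma liminf_Psi:
  "(\<Sum>i\<in>UNIV. ennreal ((\<Sum>a\<in>UNIV. (norm (M i a))\<^sup>2) / (norm (v i))\<^sup>2)) * gauss_const
    \<le> liminf (\<lambda>k. \<integral>\<^sup>+u. ennreal (Psi k u) * ennreal (exp (- (norm u)\<^sup>2)) \<partial>lborel)"
proof -
  have "(\<Sum>i\<in>UNIV. ennreal ((\<Sum>a\<in>UNIV. (norm (M i a))\<^sup>2) / (norm (v i))\<^sup>2)) * gauss_const
     \<le> (\<Sum>i\<in>UNIV. liminf (\<lambda>k. \<integral>\<^sup>+u. indicator (R i k) u * ennreal (Psi k u) * ennreal (exp (- (norm u)\<^sup>2)) \<partial>lborel))"
    unfolding sum_distrib_right by (intro sum_mono liminf_local)
  also have "\<dots> \<le> liminf (\<lambda>k. \<Sum>i\<in>UNIV. \<integral>\<^sup>+u. indicator (R i k) u * ennreal (Psi k u) * ennreal (exp (- (norm u)\<^sup>2)) \<partial>lborel)"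
    by (rule sum_liminf_le)
  also have "\<dots> \<le> liminf (\<lambda>k. \<integral>\<^sup>+u. ennreal (Psi k u) * ennreal (exp (- (norm u)\<^sup>2)) \<partial>lborel)"
  proof (intro Liminf_mono always_eventually allI)
    fix k
    have "(\<Sum>i\<in>UNIV. \<integral>\<^sup>+u. indicator (R i k) u * ennreal (Psi k u) * ennreal (exp (- (norm u)\<^sup>2)) \<partial>lborel)
       = (\<integral>\<^sup>+u. (\<Sum>i\<in>UNIV. indicator (R i k) u) * (ennreal (Psi k u) * ennreal (exp (- (norm u)\<^sup>2))) \<partial>lborel)"
      by (subst nn_integral_sum[symmetric]) (auto simp: sum_distrib_right mult.assoc)
    also have "\<dots> \<le> (\<integral>\<^sup>+u. 1 * (ennreal (Psi k u) * ennreal (exp (- (norm u)\<^sup>2))) \<partial>lborel)"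
      by (intro nn_integral_mono mult_right_mono disjoint_R) simp
    finally show "(\<Sum>i\<in>UNIV. \<integral>\<^sup>+u. indicator (R i k) u * ennreal (Psi k u) * ennreal (exp (- (norm u)\<^sup>2)) \<partial>lborel)
       \<le> (\<integral>\<^sup>+u. ennreal (Psi k u) * ennreal (exp (- (norm u)\<^sup>2)) \<partial>lborel)" by simp
  qed
  finally show ?thesis .
qed

end

section \<open>Eigenpairs and the inverse on the orthogonal complement\<close>

text \<open>The matrices with a multiple eigenvalue, described without the characteristic
  polynomial: c = 0 means a second independent eigenvector, c \<noteq> 0 a Jordan chain. These
  linear relations can be solved for two columns of A.\<close>

definition degenerate :: "(complex^'n^'n) set" where
  "degenerate = {A. \<exists>l c v w. v \<noteq> 0 \<and> (\<forall>z. w \<noteq> z *s v) \<and> A *v v = l *s v \<and> A *v w = l *s w + c *s v}"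

lemma matrix_vector_mult_scale: "A *v (z *s v) = z *s (A *v v)" for A :: "complex^'n^'m"
  by (simp add: vec_eq_iff matrix_vector_mult_def sum_distrib_left mult_ac)

lemma hinner_self: "hinner v v = of_real ((norm v)\<^sup>2)"
  by (simp add: hinner_eq_bdot bdot_vcnj)

lemma hinner_self_ne_0: "v \<noteq> 0 \<Longrightarrow> hinner v v \<noteq> 0"
  by (simp add: hinner_self)

lemma hinner_diff: "hinner v (x - y) = hinner v x - hinner v y"
  by (simp add: hinner_def algebra_simps sum_subtractf)

lemma hinner_add: "hinner v (x + y) = hinner v x + hinner v y"
  by (simp add: hinner_def algebra_simps sum.distrib)

lemma hinner_scale: "hinner v (z *s x) = z * hinner v x"
  by (simp add: hinner_def sum_distrib_left mult_ac)

lemma hperp_iff: "w \<in> hperp v \<longleftrightarrow> hinner v w = 0"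
  by (simp add: hperp_def)

lemma proj_perp_in_hperp: "v \<noteq> 0 \<Longrightarrow> proj_perp v w \<in> hperp v"
  by (simp add: hperp_iff proj_perp_def hinner_diff hinner_scale hinner_self_ne_0)

lemma proj_perp_id: "w \<in> hperp v \<Longrightarrow> proj_perp v w = w"
  by (simp add: hperp_iff proj_perp_def)

lemma proj_perp_eq_0: "proj_perp v x = 0 \<longleftrightarrow> x = (hinner v x / hinner v v) *s v"
  by (simp add: proj_perp_def)

lemma proj_perp_add: "proj_perp v (x + y) = proj_perp v x + proj_perp v y"
  by (simp add: proj_perp_def hinner_add vec_eq_iff add_divide_distrib algebra_simps)

lemma proj_perp_scale: "proj_perp v (z *s x) = z *s proj_perp v x"
  by (simp add: proj_perp_def hinner_scale vec_eq_iff algebra_simps)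

lemma A_lv_add: "A_lv A l v (x + y) = A_lv A l v x + A_lv A l v y"
proof -
  have "l *s (x + y) - A *v (x + y) = (l *s x - A *v x) + (l *s y - A *v y)"
    by (simp add: matrix_vector_right_distrib vec_eq_iff algebra_simps)
  then show ?thesis by (simp only: A_lv_def proj_perp_add)
qed

lemma A_lv_scale: "A_lv A l v (z *s x) = z *s A_lv A l v x"
proof -
  have "l *s (z *s x) - A *v (z *s x) = z *s (l *s x - A *v x)"
    by (simp add: matrix_vector_mult_scale vec_eq_iff algebra_simps)
  then show ?thesis by (simp only: A_lv_def proj_perp_scale)
qed

lemma A_lv_in_hperp: "v \<noteq> 0 \<Longrightarrow> A_lv A l v w \<in> hperp v"
  by (simp add: A_lv_def proj_perp_in_hperp)

lemma hperp_add: "x \<in> hperp v \<Longrightarrow> y \<in> hperp v \<Longrightarrow> x + y \<in> hperp v"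
  by (simp add: hperp_iff hinner_add)

lemma hperp_scale: "x \<in> hperp v \<Longrightarrow> z *s x \<in> hperp v"
  by (simp add: hperp_iff hinner_scale)

lemma scaleR_scale: "r *\<^sub>R x = of_real r *s (x :: complex^'n)"
  by (simp add: vec_eq_iff) (simp add: scaleR_conv_of_real)

lemma norm_scale_vec: "norm (z *s x) = cmod z * norm (x :: complex^'n)"
  by (simp add: norm_vec_def L2_set_def norm_mult power_mult_distrib real_sqrt_mult flip: sum_distrib_left)

text \<open>A kernel vector w satisfies (l - A) w = c v and is orthogonal to v; if nonzero, it
  witnesses degeneracy. Injectivity then gives surjectivity by real dimension.\<close>

lemma A_lv_invertible_of_nondegenerate:
  fixes A :: "complex^'n^'n"
  assumes A: "A \<notin> degenerate" and v: "v \<noteq> 0" "A *v v = l *s v"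
  shows "A_lv_invertible A l v"
proof -
  have lin: "linear (A_lv A l v)"
    by (rule linearI) (simp_all add: A_lv_add A_lv_scale scaleR_scale)
  have sub: "subspace (hperp v)"
    by (auto simp: subspace_def hperp_add scaleR_scale hperp_scale) (simp add: hperp_iff hinner_def)
  have ker: "w = 0" if w: "w \<in> hperp v" "A_lv A l v w = 0" for w
  proof (rule ccontr)
    assume "w \<noteq> 0"
    obtain c where c: "l *s w - A *v w = c *s v"
      using w(2) unfolding A_lv_def proj_perp_eq_0 by blast
    have "A *v w = l *s w + (- c) *s v" using c by (simp add: vec_eq_iff algebra_simps)
    moreover have "w \<noteq> z *s v" for z
    proof
      assume "w = z *s v"
      then have "z * hinner v v = 0" using w(1) by (simp add: hperp_iff hinner_scale)
      then show False using hinner_self_ne_0[OF v(1)] \<open>w = z *s v\<close> \<open>w \<noteq> 0\<close> by auto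
    qed
    ultimately show False using A v unfolding degenerate_def by blast
  qed
  have inj: "inj_on (A_lv A l v) (hperp v)"
    using linear_injective_on_subspace_0[OF lin sub] ker by blast
  have "A_lv A l v ` hperp v = hperp v"
  proof (rule subspace_dim_equal)
    show "subspace (A_lv A l v ` hperp v)" using lin sub by (rule linear_subspace_image)
    show "subspace (hperp v)" by fact
    show "A_lv A l v ` hperp v \<subseteq> hperp v" using A_lv_in_hperp[OF v(1)] by auto
    show "dim (A_lv A l v ` hperp v) \<ge> dim (hperp v)"
      using dim_image_eq[OF lin, of "hperp v"] inj sub by (simp add: span_eq_iff[THEN iffD2])
  qed
  then show ?thesis unfolding A_lv_invertible_def bij_betw_def using inj by simp
qed

context
  fixes A :: "complex^'n^'n" and l :: complex and v :: "complex^'n"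
  assumes v: "v \<noteq> 0" "A *v v = l *s v" and inv: "A_lv_invertible A l v"
begin

lemma inv_ext_in_hperp: "A_lv_inv_ext A l v w \<in> hperp v"
  using inv proj_perp_in_hperp[OF v(1)] unfolding A_lv_invertible_def A_lv_inv_ext_def bij_betw_def
  by (metis inv_into_into)

lemma A_lv_inv_ext: "A_lv A l v (A_lv_inv_ext A l v w) = proj_perp v w"
  using inv proj_perp_in_hperp[OF v(1)] unfolding A_lv_invertible_def A_lv_inv_ext_def bij_betw_def
  by (metis f_inv_into_f)

lemma inv_ext_A_lv: "x \<in> hperp v \<Longrightarrow> A_lv_inv_ext A l v (A_lv A l v x) = x"
  using inv unfolding A_lv_invertible_def A_lv_inv_ext_def bij_betw_def
  by (metis A_lv_in_hperp[OF v(1)] inv_into_f_f proj_perp_id)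

lemma inv_ext_unique: "x \<in> hperp v \<Longrightarrow> A_lv A l v x = proj_perp v w \<Longrightarrow> A_lv_inv_ext A l v w = x"
  using inv unfolding A_lv_invertible_def A_lv_inv_ext_def bij_betw_def by (metis inv_into_f_f)

lemma inv_ext_add: "A_lv_inv_ext A l v (x + y) = A_lv_inv_ext A l v x + A_lv_inv_ext A l v y"
  by (rule inv_ext_unique) (simp_all add: hperp_add inv_ext_in_hperp A_lv_add A_lv_inv_ext proj_perp_add)

lemma inv_ext_scale: "A_lv_inv_ext A l v (z *s x) = z *s A_lv_inv_ext A l v x"
  by (rule inv_ext_unique) (simp_all add: hperp_scale inv_ext_in_hperp A_lv_scale A_lv_inv_ext proj_perp_scale)

text \<open>First-order perturbation of an eigenpair: for \<open>w = N *v v\<close> the inverse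
  applied to w is the motion of v, and \<open>l'\<close> is the motion of the eigenvalue.\<close>

lemma inv_ext_eq: obtains l' where "l *s A_lv_inv_ext A l v w - A *v A_lv_inv_ext A l v w = w - l' *s v"
proof -
  define x where "x = A_lv_inv_ext A l v w"
  have "proj_perp v (l *s x - A *v x) = proj_perp v w" using A_lv_inv_ext[of w] unfolding A_lv_def x_def .
  then obtain a b where "l *s x - A *v x - a *s v = w - b *s v" unfolding proj_perp_def by blast
  then have "l *s x - A *v x = w - (b - a) *s v" by (simp add: vec_eq_iff algebra_simps)
  then show ?thesis using that unfolding x_def by blast
qed

lemma inv_ext_sum: "A_lv_inv_ext A l v w = (\<Sum>j\<in>UNIV. w $ j *s A_lv_inv_ext A l v (axis j 1))"
proof -
  have 0: "A_lv_inv_ext A l v 0 = 0" using inv_ext_scale[of 0 0] by simp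
  have s: "A_lv_inv_ext A l v (sum f S) = (\<Sum>j\<in>S. A_lv_inv_ext A l v (f j))" if "finite S" for f :: "'n \<Rightarrow> complex^'n" and S
    using that by (induction S) (simp_all add: 0 inv_ext_add)
  have "w = (\<Sum>j\<in>UNIV. w $ j *s axis j 1)" by (simp add: basis_expansion)
  then have "A_lv_inv_ext A l v w = A_lv_inv_ext A l v (\<Sum>j\<in>UNIV. w $ j *s axis j 1)" by simp
  also have "\<dots> = (\<Sum>j\<in>UNIV. w $ j *s A_lv_inv_ext A l v (axis j 1))" by (simp add: s inv_ext_scale)
  finally show ?thesis .
qed

lemma norm_inv_ext_le: "norm (A_lv_inv_ext A l v w) \<le> frob_norm_inv A l v * norm w"
proof -
  have "norm (A_lv_inv_ext A l v w) \<le> (\<Sum>j\<in>UNIV. cmod (w $ j) * norm (A_lv_inv_ext A l v (axis j 1)))"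
    by (subst inv_ext_sum) (simp add: norm_sum[THEN order_trans] norm_scale_vec sum_norm_le)
  also have "\<dots> \<le> L2_set (\<lambda>j. cmod (w $ j)) UNIV * L2_set (\<lambda>j. norm (A_lv_inv_ext A l v (axis j 1))) UNIV"
    using L2_set_mult_ineq[of "\<lambda>j. cmod (w $ j)" "\<lambda>j. norm (A_lv_inv_ext A l v (axis j 1))" UNIV] by simp
  also have "\<dots> = frob_norm_inv A l v * norm w"
    by (simp add: frob_norm_inv_def norm_vec_def L2_set_def mult.commute)
  finally show ?thesis .
qed

lemma frob_norm_inv_nonneg: "0 \<le> frob_norm_inv A l v"
  unfolding frob_norm_inv_def by (simp add: sum_nonneg)

lemma op_norm_inv_le: "op_norm_inv A l v \<le> frob_norm_inv A l v"
  unfolding op_norm_inv_def by (rule onorm_le) (rule norm_inv_ext_le)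

end

section \<open>A lower bound for the Frobenius norm of the inverse\<close>

lemma frob_norm_eq: "frob_norm A = norm A"
  by (simp add: frob_norm_def norm_vec_def L2_set_def sum_nonneg)

lemma norm_proj_perp_le: "norm (proj_perp v w) \<le> norm w"
proof (cases "v = 0")
  case True
  then show ?thesis by (simp add: proj_perp_def)
next
  case False
  define b where "b = of_real (1 / norm v) *s v"
  have nb: "norm b = 1" using False unfolding b_def scaleR_scale[symmetric] by simp
  have yb: "bdot w (vcnj b) = hinner v w / of_real (norm v)"
    by (simp add: b_def bdot_def hinner_def sum_divide_distrib mult.commute)
  have "proj_perp v w = w - bdot w (vcnj b) *s b"
    unfolding proj_perp_def yb unfolding hinner_self b_def by (simp add: vec_eq_iff power2_eq_square)
  then have "(norm (proj_perp v w))\<^sup>2 = (norm w)\<^sup>2 - (cmod (bdot w (vcnj b)))\<^sup>2"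
    using norm_diff_scale_sq[OF nb, of w "bdot w (vcnj b)"] by simp
  then have "(norm (proj_perp v w))\<^sup>2 \<le> (norm w)\<^sup>2" by simp
  then show ?thesis by (rule power2_le_imp_le) simp
qed

lemma scale_matrix_vector: "(\<Sum>j\<in>UNIV. A $ i $ j * w $ j) = (A *v w) $ i" for A :: "complex^'n^'m"
  by (simp add: matrix_vector_mult_def)

lemma bessel_2:
  fixes b w r :: "complex^'n"
  assumes b: "norm b = 1" and w: "norm w = 1" and perp: "bdot w (vcnj b) = 0"
  shows "(cmod (bdot r (vcnj b)))\<^sup>2 + (cmod (bdot r (vcnj w)))\<^sup>2 \<le> (norm r)\<^sup>2"
proof -
  define r' where "r' = r - bdot r (vcnj b) *s b"
  have "(norm r')\<^sup>2 = (norm r)\<^sup>2 - (cmod (bdot r (vcnj b)))\<^sup>2"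
    unfolding r'_def using norm_diff_scale_sq[OF b, of r "bdot r (vcnj b)"] by simp
  moreover have "bdot b (vcnj w) = cnj (bdot w (vcnj b))" by (simp add: bdot_def mult.commute)
  then have "bdot r' (vcnj w) = bdot r (vcnj w)"
    unfolding r'_def bdot_diff_left bdot_scale_left perp by simp
  moreover have "(norm (r' - bdot r' (vcnj w) *s w))\<^sup>2 = (norm r')\<^sup>2 - (cmod (bdot r' (vcnj w)))\<^sup>2"
    using norm_diff_scale_sq[OF w, of r' "bdot r' (vcnj w)"] by simp
  then have "(cmod (bdot r' (vcnj w)))\<^sup>2 \<le> (norm r')\<^sup>2" by (smt (verit) zero_le_power2)
  ultimately show ?thesis by simp
qed

text \<open>Bessel's inequality for the pair b, w, applied to every conjugated row of A and
  summed.\<close>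

lemma norm_orthonormal_images_le:
  fixes A :: "complex^'n^'n"
  assumes b: "norm b = 1" and w: "norm w = 1" and perp: "hinner b w = 0"
  shows "(norm (A *v b))\<^sup>2 + (norm (A *v w))\<^sup>2 \<le> (norm A)\<^sup>2"
proof -
  define r where "r i = vcnj (A $ i)" for i
  have Ab: "(A *v x) $ i = cnj (bdot (r i) (vcnj x))" for x i
    unfolding r_def by (simp add: bdot_def matrix_vector_mult_def)
  have nv: "(norm (A *v x))\<^sup>2 = (\<Sum>i\<in>UNIV. (cmod (bdot (r i) (vcnj x)))\<^sup>2)" for x
    by (simp add: norm_vec_def L2_set_def sum_nonneg Ab)
  have nA: "(norm A)\<^sup>2 = (\<Sum>i\<in>UNIV. (norm (r i))\<^sup>2)"
    unfolding r_def norm_vcnj by (simp add: norm_vec_def[of A] L2_set_def sum_nonneg)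
  have p: "bdot w (vcnj b) = 0" using perp by (simp add: hinner_eq_bdot bdot_commute)
  show ?thesis unfolding nv nA sum.distrib[symmetric] by (intro sum_mono bessel_2 b w p)
qed

lemma exists_unit_hperp:
  fixes v :: "complex^'n"
  assumes card: "CARD('n) \<ge> 2" and v: "v \<noteq> 0"
  obtains w where "w \<in> hperp v" "norm w = 1"
proof -
  obtain p q :: 'n where pq: "p \<noteq> q"
    using card by (metis One_nat_def Suc_1 card_le_Suc0_iff_eq finite not_less_eq_eq UNIV_I)
  have "\<exists>x. \<forall>z. x \<noteq> z *s v"
  proof (rule ccontr)
    assume "\<not> ?thesis"
    then have all: "\<exists>z. x = z *s v" for x by blast
    obtain a where "axis p 1 = a *s v" using all by blast
    moreover obtain b where "axis q 1 = b *s v" using all by blast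
    ultimately have "(a *s v) $ p = 1" "(a *s v) $ q = 0" "(b *s v) $ q = 1"
      using pq by (simp_all add: axis_def flip: \<open>axis p 1 = a *s v\<close> \<open>axis q 1 = b *s v\<close>)
    then show False by auto
  qed
  then obtain x where x: "x \<noteq> z *s v" for z by blast
  then have "proj_perp v x \<noteq> 0" unfolding proj_perp_eq_0 by blast
  then show thesis
    using proj_perp_in_hperp[OF v, of x]
    by (intro that[of "(1 / norm (proj_perp v x)) *\<^sub>R proj_perp v x"]) (simp_all add: scaleR_scale[of _ "proj_perp v x"] hperp_scale norm_scale_vec norm_divide)
qed

text \<open>For a unit vector w orthogonal to v, the inverse maps A_lv w back to w, whence 1 \<le> f
  (|l| + |A w|) with f the Frobenius norm of the inverse. Moreover |l| = |A b| for b = v / |v|, and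
  the images of the orthonormal pair b, w satisfy (|A b| + |A w|)^2 \<le> 2 |A|^2.\<close>

lemma one_le_frob_norm_inv:
  fixes A :: "complex^'n^'n"
  assumes card: "CARD('n) \<ge> 2" and v: "v \<noteq> 0" "A *v v = l *s v" and inv: "A_lv_invertible A l v"
  shows "1 \<le> 2 * (norm A)\<^sup>2 * (frob_norm_inv A l v)\<^sup>2"
proof -
  obtain w where w: "w \<in> hperp v" "norm w = 1" using exists_unit_hperp[OF card v(1)] by blast
  define b where "b = of_real (1 / norm v) *s v"
  have nb: "norm b = 1" using v unfolding b_def scaleR_scale[symmetric] by simp
  have bw: "hinner b w = 0" using w(1) unfolding hperp_iff b_def
    by (simp add: hinner_def sum_divide_distrib[symmetric])
  have Ab: "A *v b = l *s b" unfolding b_def matrix_vector_mult_scale v(2) by (simp add: vec_eq_iff)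
  have nl: "norm (A *v b) = cmod l" unfolding Ab norm_scale_vec nb by simp
  define f where "f = frob_norm_inv A l v"
  have f0: "0 \<le> f" unfolding f_def using frob_norm_inv_nonneg[OF v inv] .
  have "1 = norm (A_lv_inv_ext A l v (A_lv A l v w))" using inv_ext_A_lv[OF v inv w(1)] w(2) by simp
  also have "\<dots> \<le> f * norm (A_lv A l v w)" unfolding f_def by (rule norm_inv_ext_le[OF v inv])
  also have "norm (A_lv A l v w) \<le> norm (l *s w - A *v w)" unfolding A_lv_def by (rule norm_proj_perp_le)
  also have "norm (l *s w - A *v w) \<le> cmod l + norm (A *v w)"
    using norm_triangle_ineq4[of "l *s w" "A *v w"] w(2) by (simp add: norm_scale_vec)
  finally have "1 \<le> f * (norm (A *v b) + norm (A *v w))" unfolding nl using f0 by (simp add: mult_left_mono)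
  then have 1: "1 \<le> f\<^sup>2 * (norm (A *v b) + norm (A *v w))\<^sup>2" by (simp add: one_le_power flip: power_mult_distrib)
  have "(norm (A *v b) + norm (A *v w))\<^sup>2 \<le> 2 * ((norm (A *v b))\<^sup>2 + (norm (A *v w))\<^sup>2)"
    using sum_squares_bound[of "norm (A *v b)" "norm (A *v w)"] by (simp add: power2_sum)
  also have "\<dots> \<le> 2 * (norm A)\<^sup>2"
    using norm_orthonormal_images_le[OF nb w(2) bw, of A] by simp
  finally have "f\<^sup>2 * (norm (A *v b) + norm (A *v w))\<^sup>2 \<le> f\<^sup>2 * (2 * (norm A)\<^sup>2)"
    by (rule mult_left_mono) simp
  with 1 show ?thesis unfolding f_def by (simp add: mult_ac)
qed

section \<open>Matrices with a multiple eigenvalue\<close>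

text \<open>Normalizing \<open>v $ p = 1\<close>, \<open>w $ p = 0\<close>, \<open>w $ q = 1\<close>, the relations \<open>A v = l v\<close>, \<open>A w = l w + c v\<close>
  determine the columns \<open>p\<close>, \<open>q\<close> of \<open>A\<close> from the other columns and from \<open>l\<close>, \<open>c\<close>, \<open>v\<close>, \<open>w\<close>. These
  parameters are stored in the columns \<open>p\<close>, \<open>q\<close> of a matrix whose entry \<open>(p, q)\<close> remains unused.\<close>
definition param_v :: "'n \<Rightarrow> complex^'n^'n \<Rightarrow> 'n \<Rightarrow> complex" where
  "param_v p P i = (if i = p then 1 else P $ i $ p)"

definition param_w :: "'n \<Rightarrow> 'n \<Rightarrow> complex^'n^'n \<Rightarrow> 'n \<Rightarrow> complex" where
  "param_w p q P i = (if i = p then 0 else if i = q then 1 else P $ i $ q)"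

definition param_colq :: "'n \<Rightarrow> 'n \<Rightarrow> complex^'n^'n \<Rightarrow> 'n \<Rightarrow> complex" where
  "param_colq p q P i = P $ p $ p * param_w p q P i + P $ q $ q * param_v p P i
     - (\<Sum>j\<in>UNIV - {p, q}. P $ i $ j * param_w p q P j)"

definition param_colp :: "'n \<Rightarrow> 'n \<Rightarrow> complex^'n^'n \<Rightarrow> 'n \<Rightarrow> complex" where
  "param_colp p q P i = P $ p $ p * param_v p P i - param_colq p q P i * param_v p P q
     - (\<Sum>j\<in>UNIV - {p, q}. P $ i $ j * param_v p P j)"

definition param_matrix :: "'n \<Rightarrow> 'n \<Rightarrow> complex^'n^'n \<Rightarrow> complex^'n^'n" where
  "param_matrix p q P = (\<chi> i j. if j = p then param_colp p q P i else if j = q then param_colq p q P i else P $ i $ j)"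

lemma differentiable_entry: "(\<lambda>P :: complex^'n^'n. P $ i $ j) differentiable at A"
  by (intro bounded_linear_imp_differentiable bounded_linear_compose[OF bounded_linear_vec_nth bounded_linear_vec_nth])

lemma differentiable_param_matrix:
  fixes A :: "complex^'n^'n"
  shows "param_matrix p q differentiable at A"
proof -
  have d0: "(\<lambda>P. if b then f P else g P) differentiable at A"
    if "f differentiable at A" "g differentiable at A" for b and f g :: "complex^'n^'n \<Rightarrow> complex"
    using that by (cases b) auto
  have v: "(\<lambda>P. param_v p P i) differentiable at A" for i
    unfolding param_v_def by (intro d0 differentiable_const differentiable_entry)
  have w: "(\<lambda>P. param_w p q P i) differentiable at A" for i
    unfolding param_w_def by (intro d0 differentiable_const differentiable_entry)
  have cq: "(\<lambda>P. param_colq p q P i) differentiable at A" for i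
    unfolding param_colq_def by (intro differentiable_diff differentiable_add differentiable_mult differentiable_entry v w differentiable_sum finite ballI)
  have cp: "(\<lambda>P. param_colp p q P i) differentiable at A" for i
    unfolding param_colp_def by (intro differentiable_diff differentiable_add differentiable_mult differentiable_entry v cq differentiable_sum finite ballI)
  have e: "(\<lambda>P. param_matrix p q P $ i $ j) differentiable at A" for i j
  proof -
    have "(\<lambda>P. param_matrix p q P $ i $ j) = (\<lambda>P. if j = p then param_colp p q P i else if j = q then param_colq p q P i else P $ i $ j)"
      by (simp add: param_matrix_def)
    then show ?thesis by (simp only:) (intro d0 cp cq differentiable_entry)
  qed
  show ?thesis
  proof (subst differentiable_componentwise_within, intro ballI)
    fix b :: "complex^'n^'n" assume "b \<in> Basis"
    then obtain i j u where b: "b = axis i (axis j u)" by (auto simp: Basis_vec_def)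
    have "(\<lambda>P. param_matrix p q P \<bullet> b) = (\<lambda>P. param_matrix p q P $ i $ j \<bullet> u)"
      unfolding b by (simp add: inner_axis)
    then show "(\<lambda>P. param_matrix p q P \<bullet> b) differentiable at A"
      using bounded_linear_imp_differentiable[OF bounded_linear_inner_left]
        differentiable_compose[of "\<lambda>z. z \<bullet> u" "\<lambda>P. param_matrix p q P $ i $ j" A UNIV] e[of i j] by simp
  qed
qed

lemma degenerate_param:
  fixes A :: "complex^'n^'n"
  assumes "A \<in> degenerate"
  shows "\<exists>p q P. P $ p $ q = 0 \<and> A = param_matrix p q P"
proof -
  obtain l c v w where v: "v \<noteq> 0" and w: "\<And>z. w \<noteq> z *s v" and Av: "A *v v = l *s v" and Aw: "A *v w = l *s w + c *s v"
    using assms unfolding degenerate_def by blast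
  obtain p where p: "v $ p \<noteq> 0" using v by (auto simp: vec_eq_iff)
  define v' where "v' = (1 / v $ p) *s v"
  define w1 where "w1 = w - w $ p *s v'"
  have "w1 \<noteq> 0" using w[of "w $ p / v $ p"] unfolding w1_def v'_def by auto
  then obtain q where q: "w1 $ q \<noteq> 0" by (auto simp: vec_eq_iff)
  have v'p: "v' $ p = 1" using p by (simp add: v'_def)
  have w1p: "w1 $ p = 0" by (simp add: w1_def v'p)
  then have pq: "p \<noteq> q" using q by auto
  define w' where "w' = (1 / w1 $ q) *s w1"
  have w'p: "w' $ p = 0" and w'q: "w' $ q = 1" using w1p q by (simp_all add: w'_def)
  \<comment> \<open>Dividing v by \<open>v $ p\<close> multiplies the coefficient by
    \<open>v $ p\<close>, dividing w1 by \<open>w1 $ q\<close> divides it, and the passage from w to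
    w1 leaves it unchanged.\<close>
  define c' where "c' = c * v $ p / w1 $ q"
  have Av': "A *v v' = l *s v'"
    unfolding v'_def matrix_vector_mult_scale Av by (simp add: vec_eq_iff)
  have "A *v w1 = l *s w1 + (c * v $ p) *s v'"
    unfolding w1_def matrix_vector_mult_diff_distrib matrix_vector_mult_scale Aw Av'
    using p by (simp add: vec_eq_iff v'_def algebra_simps)
  then have Aw': "A *v w' = l *s w' + c' *s v'"
    unfolding w'_def matrix_vector_mult_scale by (simp add: vec_eq_iff c'_def algebra_simps add_divide_distrib)
  \<comment> \<open>\<open>l\<close> and \<open>c'\<close> take the slots (p, p) and (q, q), which
    are free because \<open>v' $ p = 1\<close> and \<open>w' $ q = 1\<close> are fixed; the slot of
    \<open>w' $ p = 0\<close> is the entry (p, q).\<close>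
  define P where "P = (\<chi> i j. if j = p then (if i = p then l else v' $ i)
     else if j = q then (if i = p then 0 else if i = q then c' else w' $ i) else A $ i $ j)"
  have pv: "param_v p P i = v' $ i" for i unfolding param_v_def P_def using v'p by simp
  have pw: "param_w p q P i = w' $ i" for i unfolding param_w_def P_def using w'p w'q pq by simp
  have l: "P $ p $ p = l" and cc: "P $ q $ q = c'" unfolding P_def using pq by simp_all
  have split: "(\<Sum>j\<in>UNIV. f j) = f p + f q + (\<Sum>j\<in>UNIV - {p, q}. f j)" for f :: "'n \<Rightarrow> complex"
  proof -
    have "(\<Sum>j\<in>UNIV. f j) = f p + (\<Sum>j\<in>UNIV - {p}. f j)" by (rule sum.remove) auto
    also have "(\<Sum>j\<in>UNIV - {p}. f j) = f q + (\<Sum>j\<in>UNIV - {p} - {q}. f j)" using pq by (intro sum.remove) auto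
    also have "UNIV - {p} - {q} = UNIV - {p, q}" by auto
    finally show ?thesis by (simp add: add.assoc)
  qed
  have Pij: "(\<Sum>j\<in>UNIV - {p, q}. P $ i $ j * f j) = (\<Sum>j\<in>UNIV - {p, q}. A $ i $ j * f j)" for i f
    by (rule sum.cong) (auto simp: P_def)
  have colq: "param_colq p q P i = A $ i $ q" for i
  proof -
    have "(A *v w') $ i = A $ i $ q + (\<Sum>j\<in>UNIV - {p, q}. A $ i $ j * w' $ j)"
      unfolding scale_matrix_vector[symmetric] split using w'p w'q by simp
    then show ?thesis unfolding param_colq_def pv pw l cc Pij Aw' by simp
  qed
  have colp: "param_colp p q P i = A $ i $ p" for i
  proof -
    have "(A *v v') $ i = A $ i $ p + A $ i $ q * v' $ q + (\<Sum>j\<in>UNIV - {p, q}. A $ i $ j * v' $ j)"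
      unfolding scale_matrix_vector[symmetric] split using v'p by simp
    then show ?thesis unfolding param_colp_def pv l colq Pij Av' by simp
  qed
  have "A = param_matrix p q P"
    unfolding param_matrix_def by (simp add: vec_eq_iff colp colq) (simp add: P_def)
  moreover have "P $ p $ q = 0" unfolding P_def using pq by simp
  ultimately show ?thesis by blast
qed

text \<open>For each of the finitely many pairs p, q the parameters lie in a real hyperplane of the
  matrix space, and a differentiable map of this space into itself preserves null sets.\<close>

lemma negligible_degenerate: "negligible (degenerate :: (complex^'n^'n) set)"
proof -
  have "negligible (\<Union>((\<lambda>(p::'n, q). param_matrix p q ` {P. P $ p $ q = 0}) ` UNIV))"
  proof (rule negligible_Union)
    fix T assume "T \<in> (\<lambda>(p::'n, q). param_matrix p q ` {P. P $ p $ q = 0}) ` UNIV"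
    then obtain p q :: 'n where T: "T = param_matrix p q ` {P. P $ p $ q = 0}" by auto
    have "munit p q \<bullet> x = Re (x $ p $ q)" for x :: "complex^'n^'n"
      using inner_smat_munit[of x 1 p q] by (simp add: inner_commute inner_complex_def)
    then have "{P. P $ p $ q = 0} \<subseteq> {x :: complex^'n^'n. munit p q \<bullet> x = 0}" by auto
    moreover have "munit p q \<noteq> (0 :: complex^'n^'n)" by (metis munit_nth zero_index zero_neq_one)
    ultimately have "negligible {P :: complex^'n^'n. P $ p $ q = 0}"
      using negligible_hyperplane negligible_subset by blast
    then have "negligible (param_matrix p q ` {P. P $ p $ q = 0})"
      by (rule negligible_differentiable_image_negligible[OF order_refl])
        (meson differentiable_at_imp_differentiable_on differentiable_param_matrix)
    then show "negligible T" by (simp add: T)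
  qed simp
  moreover have "degenerate \<subseteq> (\<Union>((\<lambda>(p::'n, q). param_matrix p q ` {P. P $ p $ q = 0}) ` UNIV))"
    using degenerate_param by fastforce
  ultimately show ?thesis by (rule negligible_subset)
qed

lemma AE_nondegenerate: "AE A in lborel. A \<notin> degenerate"
  by (rule AE_lborel_notin_negligible[OF negligible_degenerate])

section \<open>Eigenbases of nondegenerate matrices\<close>

definition poly_apply :: "complex^'n^'n \<Rightarrow> complex poly \<Rightarrow> complex^'n \<Rightarrow> complex^'n" where
  "poly_apply A p x = (\<Sum>i\<le>degree p. coeff p i *s (((*v) A) ^^ i) x)"

lemma poly_apply_eq: "degree p \<le> m \<Longrightarrow> poly_apply A p x = (\<Sum>i\<le>m. coeff p i *s (((*v) A) ^^ i) x)"
  unfolding poly_apply_def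
  by (rule sum.mono_neutral_left) (auto simp: coeff_eq_0 not_le)

lemma poly_apply_root:
  "poly_apply A ([:- \<mu>, 1:] * q) x = A *v poly_apply A q x - \<mu> *s poly_apply A q x"
proof -
  define m where "m = degree q"
  have "degree ([:- \<mu>, 1:] * q) \<le> Suc m"
    unfolding m_def using degree_mult_le[of "[:- \<mu>, 1:]" q] by simp
  then have "poly_apply A ([:- \<mu>, 1:] * q) x = (\<Sum>i\<le>Suc m. coeff ([:- \<mu>, 1:] * q) i *s (((*v) A) ^^ i) x)"
    by (rule poly_apply_eq)
  also have "\<dots> = (\<Sum>i\<le>Suc m. coeff (pCons 0 q) i *s (((*v) A) ^^ i) x) - \<mu> *s (\<Sum>i\<le>Suc m. coeff q i *s (((*v) A) ^^ i) x)"
    by (simp add: vec_eq_iff sum_distrib_left sum_subtractf algebra_simps sum.distrib)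
  also have "(\<Sum>i\<le>Suc m. coeff q i *s (((*v) A) ^^ i) x) = poly_apply A q x"
    by (rule poly_apply_eq[symmetric]) (simp add: m_def)
  also have "(\<Sum>i\<le>Suc m. coeff (pCons 0 q) i *s (((*v) A) ^^ i) x) = (\<Sum>i\<le>m. coeff q i *s (A *v (((*v) A) ^^ i) x))"
    by (subst sum.atMost_Suc_shift) simp
  also have "\<dots> = A *v poly_apply A q x"
    unfolding poly_apply_def m_def
    by (simp add: linear_sum[OF matrix_vector_mul_linear] matrix_vector_mult_scale)
  finally show ?thesis .
qed

text \<open>x, A x, ..., A^n x are n + 1 vectors in dimension n. The type \<open>'n option\<close>
  has n + 1 elements, so their dependence is a kernel vector of a linear map between vector
  types.\<close>

lemma exists_annihilating_poly:
  fixes A :: "complex^'n^'n"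
  obtains p where "p \<noteq> 0" "poly_apply A p x = 0"
proof -
  define m where "m = CARD('n)"
  obtain e :: "'n option \<Rightarrow> nat" where e: "bij_betw e UNIV {..m}"
    using finite_same_card_bij[of "UNIV :: 'n option set" "{..m}"] by (auto simp: m_def)
  define L :: "complex^('n option) \<Rightarrow> complex^'n" where "L c = (\<Sum>i\<in>UNIV. c $ i *s (((*v) A) ^^ e i) x)" for c
  have lin: "linear L"
    unfolding L_def by (rule linearI) (simp_all add: vec_eq_iff algebra_simps sum.distrib scaleR_sum_right)
  have "\<not> inj L"
  proof
    assume "inj L"
    then have "dim (L ` UNIV) = DIM(complex^('n option))"
      using dim_image_eq[OF lin, of UNIV] by (simp add: dim_UNIV)
    moreover have "dim (L ` UNIV) \<le> DIM(complex^'n)" by (rule dim_subset_UNIV)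
    ultimately show False by (simp add: card_option)
  qed
  then obtain c where c: "L c = 0" "c \<noteq> 0" using linear_injective_0[OF lin] by blast
  define p where "p = (\<Sum>i\<in>UNIV. monom (c $ i) (e i))"
  have inj_e: "e i = e j \<longleftrightarrow> i = j" for i j using e by (auto simp: bij_betw_def inj_on_def)
  have co: "coeff p (e j) = c $ j" for j
    unfolding p_def by (simp add: coeff_sum inj_e)
  obtain j where "c $ j \<noteq> 0" using c(2) by (auto simp: vec_eq_iff)
  then have "p \<noteq> 0" using co[of j] by auto
  have "degree p \<le> m"
    unfolding p_def
  proof (rule degree_sum_le)
    fix i have "e i \<in> {..m}" using e by (auto simp: bij_betw_def)
    then show "degree (monom (c $ i) (e i)) \<le> m" using degree_monom_le[of "c $ i" "e i"] by simp
  qed simp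
  then have "poly_apply A p x = (\<Sum>k\<le>m. coeff p k *s (((*v) A) ^^ k) x)" by (rule poly_apply_eq)
  also have "\<dots> = (\<Sum>i\<in>UNIV. coeff p (e i) *s (((*v) A) ^^ e i) x)"
    by (rule sum.reindex_bij_betw[OF e, symmetric])
  also have "\<dots> = 0" using c(1) unfolding co L_def .
  finally show thesis using that \<open>p \<noteq> 0\<close> by blast
qed

text \<open>Without passing to the quotient by \<open>W\<close>: a polynomial of least degree that maps \<open>x\<close> into \<open>W\<close>
  has a root \<open>\<mu>\<close>, and dividing by \<open>t - \<mu>\<close> gives a vector outside \<open>W\<close> that \<open>A - \<mu>\<close> maps into \<open>W\<close>.\<close>
lemma exists_eigenvector_mod_subspace:
  fixes A :: "complex^'n^'n"
  assumes W: "vec.subspace W" and x: "x \<notin> W"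
  obtains w \<mu> where "w \<notin> W" "A *v w - \<mu> *s w \<in> W"
proof -
  obtain p0 where p0: "p0 \<noteq> 0" "poly_apply A p0 x = 0" using exists_annihilating_poly by blast
  define good where "good p \<longleftrightarrow> p \<noteq> 0 \<and> poly_apply A p x \<in> W" for p
  have "good p0" using p0 vec.subspace_0[OF W] by (simp add: good_def)
  then obtain p where p: "good p" and least: "\<And>q. good q \<Longrightarrow> degree p \<le> degree q"
    using ex_has_least_nat[of good p0 degree] by blast
  have "degree p \<noteq> 0"
  proof
    assume d: "degree p = 0"
    then obtain c where c: "p = [:c:]" by (rule degree_eq_zeroE)
    then have c0: "c \<noteq> 0" and "c *s x \<in> W" using p by (auto simp: good_def poly_apply_def)
    from vec.subspace_scale[OF W this(2), of "1 / c"] show False using x c0 by simp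
  qed
  then have "\<not> constant (poly p)" by (simp add: constant_degree)
  then obtain \<mu> where "poly p \<mu> = 0" using fundamental_theorem_of_algebra by blast
  then obtain q where q: "p = [:- \<mu>, 1:] * q" by (meson dvdE poly_eq_0_iff_dvd)
  have "q \<noteq> 0" using p q by (auto simp: good_def)
  then have "degree p = Suc (degree q)" unfolding q by (subst degree_mult_eq) auto
  then have "\<not> good q" using least by fastforce
  then have "poly_apply A q x \<notin> W" using \<open>q \<noteq> 0\<close> by (simp add: good_def)
  moreover have "A *v poly_apply A q x - \<mu> *s poly_apply A q x \<in> W"
    using p unfolding good_def q poly_apply_root by simp
  ultimately show thesis using that by blast
qed

lemma eigenvectors_independent:
  fixes A :: "complex^'n^'n"
  assumes "finite F" "\<And>l. l \<in> F \<Longrightarrow> e l \<noteq> 0 \<and> A *v e l = l *s e l" "(\<Sum>l\<in>F. c l *s e l) = 0" "l \<in> F"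
  shows "c l = 0"
  using assms
proof (induction F arbitrary: c l rule: finite_induct)
  case (insert m F)
  have 0: "A *v (\<Sum>l\<in>insert m F. c l *s e l) - m *s (\<Sum>l\<in>insert m F. c l *s e l) = (\<Sum>l\<in>insert m F. ((l - m) * c l) *s e l)"
  proof -
    have "A *v (\<Sum>l\<in>insert m F. c l *s e l) = (\<Sum>l\<in>insert m F. c l *s (l *s e l))"
      unfolding linear_sum[OF matrix_vector_mul_linear] matrix_vector_mult_scale
      by (rule sum.cong) (simp_all add: insert.prems(1))
    then show ?thesis
      by (simp only: vec.scale_sum_right sum_subtractf[symmetric]) (simp add: vec_eq_iff algebra_simps)
  qed
  have "(\<Sum>l\<in>F. ((l - m) * c l) *s e l) = 0"
    using 0 unfolding insert.prems(2) using insert.hyps by simp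
  then have z: "(l - m) * c l = 0" if "l \<in> F" for l
    using insert.IH[of "\<lambda>l. (l - m) * c l" l] insert.prems(1) that by blast
  then have cF: "c l = 0" if "l \<in> F" for l
    using z[OF that] that insert.hyps(2) by auto
  then have "(\<Sum>l\<in>F. c l *s e l) = 0" by simp
  then have "c m *s e m = 0" using insert.prems(2) insert.hyps by simp
  then have "c m = 0" using insert.prems(1)[of m] by simp
  then show ?case using cF insert.prems(3) by blast
qed simp

lemma line_rep_cline:
  assumes "v \<noteq> 0"
  obtains z where "z \<noteq> 0" "line_rep (cline v) = z *s v"
proof -
  have "v \<in> cline v" unfolding cline_def by (auto intro!: exI[of _ 1])
  then have "line_rep (cline v) \<in> cline v \<and> line_rep (cline v) \<noteq> 0"
    unfolding line_rep_def using assms by (intro someI[of "\<lambda>w. w \<in> cline v \<and> w \<noteq> 0"]) simp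
  then show thesis using that unfolding cline_def by auto
qed

lemma cline_scale: "z \<noteq> 0 \<Longrightarrow> cline (z *s v) = cline v"
proof -
  assume z: "z \<noteq> 0"
  have "c *s v = (c / z) *s (z *s v)" for c using z by simp
  then have "\<exists>d. c *s v = d *s (z *s v)" for c by blast
  moreover have "\<exists>d. c *s (z *s v) = d *s v" for c by (intro exI[of _ "c * z"]) simp
  ultimately show ?thesis unfolding cline_def by (intro Collect_cong) metis
qed

definition column_matrix :: "('n \<Rightarrow> complex^'n) \<Rightarrow> complex^'n^'n" where
  "column_matrix v = (\<chi> i j. v j $ i)"

text \<open>One eigenvector is chosen for each eigenvalue. If their span \<open>W\<close> were
  proper, a vector w outside it would be an eigenvector modulo \<open>W\<close>; correcting w inside
  \<open>W\<close> produces either a new eigenvalue or a Jordan chain, both impossible.\<close>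

lemma nondegenerate_eigenbasis:
  fixes A :: "complex^'n^'n"
  assumes A: "A \<notin> degenerate"
  obtains lam :: "'n \<Rightarrow> complex" and v :: "'n \<Rightarrow> complex^'n"
  where "inj lam" "\<And>i. v i \<noteq> 0" "\<And>i. A *v v i = lam i *s v i" "\<And>i. line_rep (cline (v i)) = v i"
    "eigenpairs A = (\<lambda>i. (lam i, cline (v i))) ` UNIV" "det (column_matrix v) \<noteq> 0"
proof -
  define Lam where "Lam = {l. \<exists>v. v \<noteq> 0 \<and> A *v v = l *s v}"
  \<comment> \<open>The eigenvector is replaced by the selected representative of its line, so that
    sums over eigenpairs become sums over indices with the same vectors.\<close>
  have "\<exists>v. v \<noteq> 0 \<and> A *v v = l *s v \<and> line_rep (cline v) = v" if lL: "l \<in> Lam" for l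
  proof -
    obtain v where v: "v \<noteq> 0" "A *v v = l *s v" using lL unfolding Lam_def by blast
    obtain z where z: "z \<noteq> 0" "line_rep (cline v) = z *s v" using line_rep_cline[OF v(1)] .
    have "A *v (z *s v) = l *s (z *s v)" unfolding matrix_vector_mult_scale v(2) by (simp add: mult.commute)
    then show ?thesis using v z cline_scale[OF z(1), of v] by (intro exI[of _ "z *s v"]) simp
  qed
  then obtain e where e: "\<And>l. l \<in> Lam \<Longrightarrow> e l \<noteq> 0 \<and> A *v e l = l *s e l \<and> line_rep (cline (e l)) = e l" by metis
  have e_inj: "inj_on e Lam"
  proof (rule inj_onI)
    fix l m assume lm: "l \<in> Lam" "m \<in> Lam" "e l = e m"
    then have "l *s e l = m *s e l" using e by metis
    then show "l = m" using e[OF lm(1)] by simp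
  qed
  have indep: "vec.independent (e ` F)" if F: "finite F" "F \<subseteq> Lam" for F
  proof -
    have "(\<Sum>w\<in>e ` F. u w *s w) = (\<Sum>l\<in>F. u (e l) *s e l)" for u
      using inj_on_subset[OF e_inj F(2)] by (simp add: sum.reindex)
    then show ?thesis using F eigenvectors_independent[OF F(1), of e A "\<lambda>l. u (e l)" for u] e
      by (auto simp: vec.dependent_finite) blast
  qed
  have card_le: "card F \<le> CARD('n)" if F: "finite F" "F \<subseteq> Lam" for F
    using vec.independent_bound_general[OF indep[OF F]] card_image[OF inj_on_subset[OF e_inj F(2)]]
      vec.dim_subset[OF subset_UNIV, of "e ` F"] by (simp add: vec_dim_card del: vec.dim_UNIV)
  have finL: "finite Lam"
  proof (rule ccontr)
    assume "infinite Lam"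
    then obtain F where "finite F" "F \<subseteq> Lam" "card F = Suc (CARD('n))"
      using infinite_arbitrarily_large by blast
    then show False using card_le[of F] by simp
  qed
  define W where "W = vec.span (e ` Lam)"
  have "W = UNIV"
  proof (rule ccontr)
    assume "W \<noteq> UNIV"
    then obtain x where "x \<notin> W" by blast
    moreover have sW: "vec.subspace W" unfolding W_def by (rule vec.subspace_span)
    ultimately obtain w \<mu> where w: "w \<notin> W" "A *v w - \<mu> *s w \<in> W"
      using exists_eigenvector_mod_subspace by blast
    then obtain u where u: "A *v w - \<mu> *s w = (\<Sum>b\<in>e ` Lam. u b *s b)"
      unfolding W_def vec.span_finite[OF finite_imageI[OF finL]] by blast
    define c where "c l = u (e l)" for l
    have Aw: "A *v w = \<mu> *s w + (\<Sum>l\<in>Lam. c l *s e l)"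
      using u unfolding sum.reindex[OF e_inj] o_def c_def by (simp add: algebra_simps)
    \<comment> \<open>Subtracting c l / (l - \<mu>) times an eigenvector removes its contribution.
      The resonant term l = \<mu> cannot be removed and is left untouched; it is the Jordan
      coefficient.\<close>
    define a where "a l = (if l = \<mu> then 0 else c l / (l - \<mu>))" for l
    define w' where "w' = w - (\<Sum>l\<in>Lam. a l *s e l)"
    have "(\<Sum>l\<in>Lam. a l *s e l) \<in> W" unfolding W_def
      by (intro vec.span_sum vec.span_scale vec.span_base) auto
    then have w'W: "w' \<notin> W" using w(1) vec.subspace_add[OF sW] unfolding w'_def by fastforce
    have al: "c l = a l * l - a l * \<mu> + (if l = \<mu> then c l else 0)" for l
      unfolding a_def by (simp add: field_simps)
    have "A *v w' = \<mu> *s w' + (\<Sum>l\<in>Lam. (if l = \<mu> then c l else 0) *s e l)"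
    proof -
      have "A *v (\<Sum>l\<in>Lam. a l *s e l) = (\<Sum>l\<in>Lam. a l *s (l *s e l))"
        unfolding linear_sum[OF matrix_vector_mul_linear] matrix_vector_mult_scale
        by (rule sum.cong) (simp_all add: e)
      then have "A *v w' = \<mu> *s w + ((\<Sum>l\<in>Lam. c l *s e l) - (\<Sum>l\<in>Lam. a l *s (l *s e l)))"
        unfolding w'_def matrix_vector_mult_diff_distrib Aw by simp
      also have "(\<Sum>l\<in>Lam. c l *s e l) - (\<Sum>l\<in>Lam. a l *s (l *s e l)) = (\<Sum>l\<in>Lam. (if l = \<mu> then c l else 0) *s e l) - \<mu> *s (\<Sum>l\<in>Lam. a l *s e l)"
        unfolding vec.scale_sum_right sum_subtractf[symmetric]
      proof (rule sum.cong[OF refl])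
        fix l
        have "(a l * l - a l * \<mu> + r) *s e l - a l *s (l *s e l) = r *s e l - \<mu> *s (a l *s e l)" for r
          by (simp add: vec_eq_iff algebra_simps)
        then show "c l *s e l - a l *s (l *s e l) = (if l = \<mu> then c l else 0) *s e l - \<mu> *s (a l *s e l)"
          by (metis al)
      qed
      finally show ?thesis unfolding w'_def by (simp add: vec_eq_iff algebra_simps)
    qed
    then have Aw': "A *v w' = \<mu> *s w' + (if \<mu> \<in> Lam then c \<mu> *s e \<mu> else 0)"
      using finL by (simp add: if_distrib[of "\<lambda>z. z *s _"] sum.delta cong: if_cong)
    have w'0: "w' \<noteq> 0" using w'W vec.subspace_0[OF sW] by metis
    have mL: "\<mu> \<in> Lam"
    proof (rule ccontr)
      assume "\<mu> \<notin> Lam"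
      then have "A *v w' = \<mu> *s w'" using Aw' by simp
      then have "\<mu> \<in> Lam" using w'0 unfolding Lam_def by blast
      then show False using \<open>\<mu> \<notin> Lam\<close> by simp
    qed
    have "w' \<noteq> z *s e \<mu>" for z
      using w'W mL unfolding W_def by (metis imageI vec.span_base vec.span_scale)
    moreover have "A *v w' = \<mu> *s w' + c \<mu> *s e \<mu>" using Aw' mL by simp
    ultimately have "A \<in> degenerate" using e[OF mL] unfolding degenerate_def by blast
    then show False using A by simp
  qed
  have iL: "vec.independent (e ` Lam)" by (rule indep[OF finL order_refl])
  have "card (e ` Lam) = CARD('n)"
    using vec.basis_card_eq_dim[of "e ` Lam" UNIV] iL \<open>W = UNIV\<close> unfolding W_def by (simp add: vec_dim_card del: vec.dim_UNIV)
  then have "card Lam = CARD('n)" using card_image[OF e_inj] by simp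
  then obtain lam :: "'n \<Rightarrow> complex" where lam: "bij_betw lam UNIV Lam"
    using finite_same_card_bij[of "UNIV :: 'n set" Lam] finL by auto
  define v where "v i = e (lam i)" for i
  have lamL: "lam i \<in> Lam" for i using lam by (auto simp: bij_betw_def)
  have 1: "inj lam" using lam by (simp add: bij_betw_def)
  have 2: "v i \<noteq> 0" "A *v v i = lam i *s v i" "line_rep (cline (v i)) = v i" for i
    using e[OF lamL[of i]] by (auto simp: v_def)
  have 3: "eigenpairs A = (\<lambda>i. (lam i, cline (v i))) ` UNIV"
  proof
    show "(\<lambda>i. (lam i, cline (v i))) ` UNIV \<subseteq> eigenpairs A"
      unfolding eigenpairs_def using 2 by blast
    show "eigenpairs A \<subseteq> (\<lambda>i. (lam i, cline (v i))) ` UNIV"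
    proof
      fix p assume "p \<in> eigenpairs A"
      then obtain l w where p: "p = (l, cline w)" and w: "w \<noteq> 0" "A *v w = l *s w"
        unfolding eigenpairs_def by blast
      then have "l \<in> Lam" by (auto simp: Lam_def)
      then obtain i where i: "l = lam i" using lam by (auto simp: bij_betw_def)
      have "\<exists>z. w = z *s v i"
      proof (rule ccontr)
        assume "\<not> ?thesis"
        then have "A \<in> degenerate" unfolding degenerate_def using 2[of i] w i
          by (intro CollectI exI[of _ "lam i"] exI[of _ "0::complex"] exI[of _ "v i"] exI[of _ w]) auto
        then show False using A by simp
      qed
      then obtain z where z: "w = z *s v i" by blast
      then have "z \<noteq> 0" using w(1) by auto
      then have "cline w = cline (v i)" unfolding z by (rule cline_scale)
      then show "p \<in> (\<lambda>i. (lam i, cline (v i))) ` UNIV" unfolding p i by auto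
    qed
  qed
  have 4: "det (column_matrix v) \<noteq> 0"
  proof -
    have "c i = 0" if "(\<Sum>i\<in>UNIV. c i *s column i (column_matrix v)) = 0" for c i
    proof -
      have col: "column i (column_matrix v) = e (lam i)" for i
        by (simp add: column_def column_matrix_def v_def vec_eq_iff)
      have "(\<Sum>l\<in>Lam. c (inv lam l) *s e l) = (\<Sum>i\<in>UNIV. c (inv lam (lam i)) *s e (lam i))"
        by (rule sum.reindex_bij_betw[OF lam, symmetric])
      also have "\<dots> = 0" using that 1 unfolding col by simp
      finally have "c (inv lam (lam i)) = 0"
        using eigenvectors_independent[OF finL, of e A "\<lambda>l. c (inv lam l)" "lam i"] e lamL by blast
      then show ?thesis using 1 by simp
    qed
    then show ?thesis
      using matrix_left_invertible_independent_columns[of "column_matrix v"]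
      by (metis invertible_det_nz invertible_left_inverse)
  qed
  show thesis using that[OF 1 2(1) 2(2) 2(3) 3 4] .
qed

section \<open>Krylov determinants\<close>

text \<open>The row u A^k over any commutative ring: it is used with complex entries, and with
  polynomial entries along a line A + z N, where the determinant becomes a polynomial in z.\<close>

definition krow :: "'a::comm_ring_1^'n \<Rightarrow> 'a^'n^'n \<Rightarrow> nat \<Rightarrow> 'a^'n" where
  "krow u A k = ((\<lambda>x. x v* A) ^^ k) u"

text \<open>The index type carries no order, so an arbitrary enumeration assigns the exponents 0,
  ..., n - 1 to the rows.\<close>

definition expo :: "'n \<Rightarrow> nat" where
  "expo = (SOME e. bij_betw e (UNIV :: 'n set) {..<CARD('n)})"

lemma bij_expo: "bij_betw (expo :: 'n::finite \<Rightarrow> nat) UNIV {..<CARD('n)}"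
proof -
  have "\<exists>e. bij_betw e (UNIV :: 'n set) {..<CARD('n)}"
    by (rule finite_same_card_bij) auto
  then show ?thesis unfolding expo_def by (rule someI_ex)
qed

definition krylov :: "'a::comm_ring_1^'n \<Rightarrow> 'a^'n^'n \<Rightarrow> 'a^'n^'n" where
  "krylov u A = (\<chi> i. krow u A (expo i))"

definition line_vec :: "complex^'n \<Rightarrow> complex poly^'n" where
  "line_vec u = (\<chi> i. [:u $ i:])"

definition line_mat :: "complex^'n^'n \<Rightarrow> complex^'n^'n \<Rightarrow> complex poly^'n^'n" where
  "line_mat A N = (\<chi> i j. [:A $ i $ j, N $ i $ j:])"

definition krylov_poly :: "complex^'n \<Rightarrow> complex^'n^'n \<Rightarrow> complex^'n^'n \<Rightarrow> complex poly" where
  "krylov_poly u A N = det (krylov (line_vec u) (line_mat A N))"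

lemma krow_Suc: "krow u A (Suc k) $ i = (\<Sum>j\<in>UNIV. A $ j $ i * krow u A k $ j)"
  by (simp add: krow_def vector_matrix_mult_def mult.commute)

lemma krow_0: "krow u A 0 = u"
  by (simp add: krow_def)

lemma poly_krow: "poly (krow (line_vec u) (line_mat A N) k $ i) z = krow u (A + smat z N) k $ i"
  by (induction k arbitrary: i) (simp_all add: krow_Suc krow_0 line_vec_def line_mat_def poly_sum algebra_simps)

lemma poly_krylov_poly: "poly (krylov_poly u A N) z = det (krylov u (A + smat z N))"
  unfolding krylov_poly_def det_def krylov_def
  by (simp add: poly_sum poly_prod poly_krow)

lemma degree_krow: "degree (krow (line_vec u) (line_mat A N) k $ i) \<le> k"
proof (induction k arbitrary: i)
  case 0
  then show ?case by (simp add: krow_0 line_vec_def)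
next
  case (Suc k)
  show ?case unfolding krow_Suc
  proof (rule degree_sum_le)
    fix j
    have "degree (line_mat A N $ j $ i) \<le> 1" by (simp add: line_mat_def)
    then show "degree (line_mat A N $ j $ i * krow (line_vec u) (line_mat A N) k $ j) \<le> Suc k"
      using degree_mult_le[of "line_mat A N $ j $ i" "krow (line_vec u) (line_mat A N) k $ j"] Suc.IH[of j] by linarith
  qed simp
qed

lemma sum_expo: "(\<Sum>i\<in>(UNIV :: 'n::finite set). expo i) = CARD('n) * (CARD('n) - 1) div 2"
proof -
  have "(\<Sum>i\<in>(UNIV :: 'n set). expo i) = (\<Sum>k<CARD('n). k)"
    by (rule sum.reindex_bij_betw[OF bij_expo])
  then show ?thesis by (simp add: Sum_Ico_nat lessThan_atLeast0)
qed

text \<open>Entries of row i have degree at most \<open>expo i\<close>, so each product in the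
  determinant has degree at most 0 + 1 + ... + (n - 1).\<close>

lemma degree_krylov_poly: "degree (krylov_poly u A N) \<le> CARD('n) * (CARD('n) - 1) div 2"
  for u :: "complex^'n"
  unfolding krylov_poly_def det_def
proof (rule degree_sum_le)
  fix p :: "'n \<Rightarrow> 'n"
  define M where "M = krylov (line_vec u) (line_mat A N)"
  have "degree (of_int (sign p) * (\<Prod>i\<in>UNIV. M $ i $ p i)) \<le> degree (of_int (sign p) :: complex poly) + degree (\<Prod>i\<in>UNIV. M $ i $ p i)"
    by (rule degree_mult_le)
  also have "degree (\<Prod>i\<in>UNIV. M $ i $ p i) \<le> (\<Sum>i\<in>UNIV. degree (M $ i $ p i))"
    by (rule degree_prod_sum_le[unfolded o_def]) simp
  also have "\<dots> \<le> (\<Sum>i\<in>(UNIV :: 'n set). expo i)"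
    unfolding M_def krylov_def by (intro sum_mono) (simp add: degree_krow)
  finally show "degree (of_int (sign p) * (\<Prod>i\<in>UNIV. M $ i $ p i)) \<le> CARD('n) * (CARD('n) - 1) div 2"
    by (simp add: sum_expo)
qed (simp add: finite_permutations)

section \<open>Continuity and linearity of the coefficients\<close>

definition cont_coeffs :: "('x::topological_space \<Rightarrow> complex poly) \<Rightarrow> bool" where
  "cont_coeffs f \<longleftrightarrow> (\<forall>k. continuous_on UNIV (\<lambda>x. coeff (f x) k))"

lemma cont_coeffs_const: "cont_coeffs (\<lambda>_. p)"
  by (simp add: cont_coeffs_def)

lemma cont_coeffs_mult: "cont_coeffs f \<Longrightarrow> cont_coeffs g \<Longrightarrow> cont_coeffs (\<lambda>x. f x * g x)"
  unfolding cont_coeffs_def coeff_mult by (intro allI continuous_intros) auto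

lemma cont_coeffs_sum: "(\<And>i. i \<in> S \<Longrightarrow> cont_coeffs (f i)) \<Longrightarrow> cont_coeffs (\<lambda>x. \<Sum>i\<in>S. f i x)"
  unfolding cont_coeffs_def coeff_sum by (intro allI continuous_intros) auto

lemma cont_coeffs_prod: "(\<And>i. i \<in> S \<Longrightarrow> cont_coeffs (f i)) \<Longrightarrow> cont_coeffs (\<lambda>x. \<Prod>i\<in>S. f i x)"
  by (induction S rule: infinite_finite_induct) (auto intro: cont_coeffs_const cont_coeffs_mult)

lemma cont_coeffs_krylov_poly: "cont_coeffs (\<lambda>(u :: complex^'n, A, N). krylov_poly u A N)"
proof -
  have pc: "cont_coeffs (\<lambda>x. [:f x, g x:])" if "continuous_on UNIV f" "continuous_on UNIV g"
    for f g :: "'x::topological_space \<Rightarrow> complex"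
    unfolding cont_coeffs_def
  proof
    fix k show "continuous_on UNIV (\<lambda>x. coeff [:f x, g x:] k)"
      using that by (cases k; cases "k - 1") (simp_all add: coeff_pCons)
  qed
  have m: "cont_coeffs (\<lambda>x. line_mat (fst (snd x)) (snd (snd x)) $ i $ j)" for i j :: 'n
    unfolding line_mat_def by (simp, rule pc; intro continuous_intros)
  have k: "cont_coeffs (\<lambda>x. krow (line_vec (fst x)) (line_mat (fst (snd x)) (snd (snd x))) k $ i)" for k and i :: 'n
  proof (induction k arbitrary: i)
    case 0
    have "cont_coeffs (\<lambda>x. [:fst x $ i, 0:])" by (rule pc; intro continuous_intros)
    then show ?case by (simp add: krow_0 line_vec_def)
  next
    case (Suc k)
    then show ?case unfolding krow_Suc by (intro cont_coeffs_sum cont_coeffs_mult m)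
  qed
  show ?thesis unfolding krylov_poly_def det_def krylov_def split_beta
    by (intro cont_coeffs_sum cont_coeffs_mult cont_coeffs_const cont_coeffs_prod) (simp add: k)
qed

lemma differentiable_prod:
  fixes f :: "'i \<Rightarrow> 'a::real_normed_vector \<Rightarrow> complex"
  assumes "\<And>i. i \<in> S \<Longrightarrow> f i differentiable at A"
  shows "(\<lambda>x. \<Prod>i\<in>S. f i x) differentiable at A"
  using assms by (induction S rule: infinite_finite_induct) auto

lemma differentiable_det_krylov: "(\<lambda>A. det (krylov u A)) differentiable at A" for A :: "complex^'n^'n"
proof -
  have "(\<lambda>A. krow u A k $ i) differentiable at A" for k i
  proof (induction k arbitrary: i)
    case (Suc k)
    then show ?case unfolding krow_Suc by (intro differentiable_sum finite ballI differentiable_mult differentiable_entry)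
  qed (simp add: krow_0)
  then show ?thesis unfolding det_def krylov_def
    by (intro differentiable_sum finite_permutations finite ballI differentiable_mult differentiable_const differentiable_prod) simp
qed

lemma matrix_eq_sum_munit: "N = (\<Sum>i\<in>UNIV. \<Sum>j\<in>UNIV. smat (N $ i $ j) (munit i j))"
proof -
  have "(\<Sum>i\<in>UNIV. \<Sum>j\<in>UNIV. smat (N $ i $ j) (munit i j)) $ k $ l = N $ k $ l" for k l
  proof -
    have "(\<Sum>j\<in>UNIV. smat (N $ i $ j) (munit i j) $ k $ l) = (if i = k then N $ k $ l else 0)" for i
    proof -
      have "smat (N $ i $ j) (munit i j) $ k $ l = (if j = l then (if i = k then N $ k $ l else 0) else 0)" for j
        by auto
      then show ?thesis by (simp only: sum.delta finite UNIV_I if_True)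
    qed
    then show ?thesis by (simp only: sum_component sum.delta finite UNIV_I if_True)
  qed
  then show ?thesis by (simp add: vec_eq_iff)
qed

interpretation krylov: holomorphic_lines "\<lambda>A. det (krylov u A)" "krylov_poly u" "CARD('n) * (CARD('n) - 1) div 2"
  for u :: "complex^'n"
proof
  show "det (krylov u (A + smat z N)) = poly (krylov_poly u A N) z" for A z N
    by (rule poly_krylov_poly[symmetric])
  show "degree (krylov_poly u A N) \<le> CARD('n) * (CARD('n) - 1) div 2" for A N
    by (rule degree_krylov_poly)
  show "continuous_on UNIV (\<lambda>(A, N). coeff (krylov_poly u A N) k)" for k
  proof -
    have "continuous_on UNIV (\<lambda>x. coeff (case x of (u, A, N) \<Rightarrow> krylov_poly u A N) k)"
      using cont_coeffs_krylov_poly unfolding cont_coeffs_def by blast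
    moreover have "continuous_on UNIV (\<lambda>x. (u, fst x, snd x))" by (intro continuous_intros)
    ultimately show ?thesis using continuous_on_compose2[of UNIV _ UNIV "\<lambda>x. (u, fst x, snd x)"] by (fastforce simp: split_beta)
  qed
  \<comment> \<open>Linearity in the direction cannot be read off from the separate polynomials on
    lines. It comes from the total derivative \<open>F\<close> of the determinant, whose value at
    \<open>N\<close> is coefficient 1.\<close>
  show "coeff (krylov_poly u A N) 1 = (\<Sum>i\<in>UNIV. \<Sum>j\<in>UNIV. N $ i $ j * coeff (krylov_poly u A (munit i j)) 1)" for A N
  proof -
    obtain F where F: "((\<lambda>A. det (krylov u A)) has_derivative F) (at A)"
      using differentiable_det_krylov unfolding differentiable_def by blast
    have lF: "linear F" using F by (rule has_derivative_linear)
    have FN: "F (smat z N) = z * coeff (krylov_poly u A N) 1" for z N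
    proof -
      have 1: "((\<lambda>t. A + t *\<^sub>R smat z N) has_vector_derivative smat z N) (at 0)"
        by (auto intro!: derivative_eq_intros)
      have "((\<lambda>t. det (krylov u (A + t *\<^sub>R smat z N))) has_vector_derivative F (smat z N)) (at 0)"
        using vector_derivative_diff_chain_within[OF 1, of "\<lambda>A. det (krylov u A)" F] F
        by (simp add: o_def has_derivative_at_withinI)
      moreover have "((\<lambda>t. poly (krylov_poly u A N) (of_real t * z)) has_vector_derivative z * coeff (krylov_poly u A N) 1) (at 0)"
        by (rule poly_real_line)
      ultimately show ?thesis
        unfolding scaleR_smat poly_krylov_poly by (rule vector_derivative_unique_at)
    qed
    have "coeff (krylov_poly u A N) 1 = F N" using FN[of 1 N] by simp
    also have "\<dots> = F (\<Sum>i\<in>UNIV. \<Sum>j\<in>UNIV. smat (N $ i $ j) (munit i j))" using matrix_eq_sum_munit[of N] by simp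
    also have "\<dots> = (\<Sum>i\<in>UNIV. \<Sum>j\<in>UNIV. N $ i $ j * coeff (krylov_poly u A (munit i j)) 1)"
      by (simp add: linear_sum[OF lF] FN)
    finally show ?thesis .
  qed
qed

section \<open>Krylov determinants in an eigenbasis\<close>

lemma bdot_scale_right: "bdot u (z *s m) = z * bdot u m"
  by (simp add: bdot_def sum_distrib_left mult_ac)

lemma bdot_vector_matrix_mult: "bdot (x v* A) v = bdot x (A *v v)" for A :: "complex^'n^'n"
proof -
  have "bdot (x v* A) v = (\<Sum>j\<in>UNIV. \<Sum>i\<in>UNIV. x $ i * A $ i $ j * v $ j)"
    unfolding bdot_def vector_matrix_mult_def by (simp add: sum_distrib_right)
  also have "\<dots> = (\<Sum>i\<in>UNIV. \<Sum>j\<in>UNIV. x $ i * A $ i $ j * v $ j)" by (rule sum.swap)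
  also have "\<dots> = bdot x (A *v v)"
    unfolding bdot_def matrix_vector_mult_def by (simp add: sum_distrib_left mult.assoc)
  finally show ?thesis .
qed

lemma bdot_krow: "bdot (krow u A k) v = bdot u (((*v) A ^^ k) v)"
proof (induction k arbitrary: v)
  case 0
  then show ?case by (simp add: krow_0)
next
  case (Suc k)
  have "krow u A (Suc k) = krow u A k v* A" by (simp add: krow_def)
  then have "bdot (krow u A (Suc k)) v = bdot (krow u A k) (A *v v)" by (simp add: bdot_vector_matrix_mult)
  also have "\<dots> = bdot u (((*v) A ^^ k) (A *v v))" by (rule Suc.IH)
  finally show ?case by (simp add: funpow_swap1)
qed

lemma matrix_power_eigenvector: "A *v v = l *s v \<Longrightarrow> ((*v) A ^^ k) v = l ^ k *s v" for A :: "complex^'n^'n"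
  by (induction k) (simp_all add: matrix_vector_mult_scale mult.commute)

lemma krylov_mult_columns: "(krylov u A ** column_matrix v) $ i $ j = bdot (krow u A (expo i)) (v j)"
  by (simp add: matrix_matrix_mult_def krylov_def column_matrix_def bdot_def)

definition vandermonde :: "('n \<Rightarrow> complex) \<Rightarrow> complex^'n^'n" where
  "vandermonde lam = (\<chi> i j. lam j ^ expo i)"

lemma det_scale_columns: "det (\<chi> i j. M $ i $ j * c j) = (\<Prod>j\<in>UNIV. c j) * det M" for M :: "complex^'n^'n"
proof -
  have "transpose (\<chi> i j. M $ i $ j * c j) = (\<chi> j. c j *s transpose M $ j)"
    by (simp add: vec_eq_iff transpose_def)
  then have "det (\<chi> i j. M $ i $ j * c j) = det (\<chi> j. c j *s transpose M $ j)"
    by (simp only: flip: det_transpose[of "\<chi> i j. M $ i $ j * c j"])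
  also have "\<dots> = prod c UNIV * det (\<chi> j. transpose M $ j)" by (rule det_rows_mul)
  also have "(\<chi> j. transpose M $ j) = transpose M" by (simp add: vec_eq_iff)
  finally show ?thesis by simp
qed

lemma det_scale_column: "det (\<chi> r c. if c = i then z * f r else X r c) = z * det (\<chi> r c. if c = i then f r else X r c)"
  for X :: "'n::finite \<Rightarrow> 'n \<Rightarrow> complex"
proof -
  have e: "(\<chi> r c. if c = i then z * f r else X r c) = (\<chi> r c. (\<chi> r c. if c = i then f r else X r c) $ r $ c * (if c = i then z else 1))"
    by (auto simp: vec_eq_iff)
  show ?thesis unfolding e det_scale_columns by simp
qed

text \<open>The coefficients of a linear dependence between the rows form a polynomial of degree
  below n with the n distinct roots \<open>lam j\<close>.\<close>

lemma det_vandermonde_ne_0: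
  fixes lam :: "'n::finite \<Rightarrow> complex"
  assumes "inj lam"
  shows "det (vandermonde lam) \<noteq> 0"
proof -
  have "c i = 0" if c: "(\<Sum>i\<in>UNIV. c i *s row i (vandermonde lam)) = 0" for c :: "'n \<Rightarrow> complex" and i
  proof -
    define p where "p = (\<Sum>i\<in>UNIV. monom (c i) (expo i))"
    have roots: "poly p (lam j) = 0" for j
    proof -
      have "poly p (lam j) = (\<Sum>i\<in>UNIV. c i *s row i (vandermonde lam)) $ j"
        by (simp add: p_def poly_sum poly_monom row_def vandermonde_def)
      then show ?thesis unfolding c by simp
    qed
    have inj_e: "expo i = expo j \<longleftrightarrow> i = j" for i j :: 'n
      using bij_expo[where 'n='n] by (auto simp: bij_betw_def inj_on_def)
    have lt: "expo i < CARD('n)" for i :: 'n using bij_expo[where 'n='n] by (auto simp: bij_betw_def)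
    have co: "coeff p (expo j) = c j" for j unfolding p_def by (simp add: coeff_sum inj_e)
    have deg: "degree p \<le> CARD('n) - 1"
      unfolding p_def
    proof (rule degree_sum_le)
      fix i :: 'n
      show "degree (monom (c i) (expo i)) \<le> CARD('n) - 1"
        using degree_monom_le[of "c i" "expo i"] lt[of i] by linarith
    qed simp
    have "p = 0"
    proof (rule ccontr)
      assume p0: "p \<noteq> 0"
      have "CARD('n) = card (range lam)" using card_image[OF assms] by simp
      also have "\<dots> \<le> card {x. poly p x = 0}"
        using roots by (intro card_mono poly_roots_finite[OF p0]) auto
      also have "\<dots> \<le> degree p" by (rule card_poly_roots_bound[OF p0])
      finally show False using deg zero_less_card_finite[where 'a='n] by linarith
    qed
    then show "c i = 0" using co[of i] by simp
  qed
  then show ?thesis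
    unfolding invertible_det_nz[symmetric] invertible_right_inverse matrix_right_invertible_independent_rows
    by blast
qed

lemma continuous_on_det:
  fixes f :: "'a::topological_space \<Rightarrow> complex^'n^'n"
  assumes "\<And>i j. continuous_on S (\<lambda>x. f x $ i $ j)"
  shows "continuous_on S (\<lambda>x. det (f x))"
  unfolding det_def by (intro continuous_intros assms)

context
  fixes A :: "complex^'n^'n" and lam :: "'n \<Rightarrow> complex" and v :: "'n \<Rightarrow> complex^'n"
  assumes eig: "\<And>i. A *v v i = lam i *s v i" and V: "det (column_matrix v) \<noteq> 0"
begin

definition kconst :: complex where
  "kconst = det (vandermonde lam) / det (column_matrix v)"

text \<open>In the basis of eigenvectors the Krylov matrix is the Vandermonde matrix of the
  eigenvalues with column j multiplied by \<open>bdot u (v j)\<close>.\<close>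

lemma det_krylov_eigen: "det (krylov u A) = kconst * (\<Prod>i\<in>UNIV. bdot u (v i))"
proof -
  have "krylov u A ** column_matrix v = (\<chi> i j. vandermonde lam $ i $ j * bdot u (v j))"
    by (simp add: vec_eq_iff krylov_mult_columns bdot_krow matrix_power_eigenvector[OF eig] vandermonde_def bdot_scale_right)
  from arg_cong[OF this, of det]
  have "det (krylov u A) * det (column_matrix v) = (\<Prod>i\<in>UNIV. bdot u (v i)) * det (vandermonde lam)"
    by (simp only: det_mul det_scale_columns)
  then show ?thesis unfolding kconst_def using V by (simp add: field_simps)
qed

text \<open>By hypothesis, v i + z x is an eigenvector of A + z N for lam i + z l' up to order z^2.
  The first-order effect of l' on the powers is a multiple \<open>a\<close> of v i, which
  \<open>u\<close> later annihilates; the remainder is kept as z^2 times a continuous function so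
  that it can be divided by z.\<close>

lemma power_perturbed_eigenvector:
  assumes x: "lam i *s x - A *v x = N *v v i - l' *s v i"
  shows "\<exists>a s. continuous_on UNIV s \<and> (\<forall>z. ((*v) (A + smat z N) ^^ k) (v i + z *s x)
     = lam i ^ k *s v i + z *s (lam i ^ k *s x + a *s v i) + z\<^sup>2 *s s z)"
proof (induction k)
  case 0
  show ?case by (rule exI[of _ 0], rule exI[of _ "\<lambda>_. 0"]) auto
next
  case (Suc k)
  then obtain a s where s: "continuous_on UNIV s" and eq: "\<And>z. ((*v) (A + smat z N) ^^ k) (v i + z *s x)
     = lam i ^ k *s v i + z *s (lam i ^ k *s x + a *s v i) + z\<^sup>2 *s s z" by blast
  define s' where "s' z = A *v s z + N *v (lam i ^ k *s x + a *s v i) + z *s (N *v s z)" for z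
  have sm: "smat z N *v y = z *s (N *v y)" for z y
    by (simp add: vec_eq_iff matrix_vector_mult_def sum_distrib_left mult.assoc)
  have Ax: "A *v x = lam i *s x - N *v v i + l' *s v i" using x by (simp add: algebra_simps)
  have cm: "continuous_on UNIV (\<lambda>z. M *v s z)" for M
    unfolding matrix_vector_mult_def
    by (intro continuous_intros continuous_on_compose2[OF s]) auto
  have "((*v) (A + smat z N) ^^ Suc k) (v i + z *s x)
     = lam i ^ Suc k *s v i + z *s (lam i ^ Suc k *s x + (lam i ^ k * l' + a * lam i) *s v i) + z\<^sup>2 *s s' z" for z
    unfolding funpow.simps o_apply eq matrix_vector_mult_add_rdistrib sm matrix_vector_right_distrib
      matrix_vector_mult_scale eig Ax s'_def
    by (simp add: vec_eq_iff algebra_simps power2_eq_square)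
  moreover have "continuous_on UNIV s'" unfolding s'_def by (intro continuous_intros cm)
  ultimately show ?case by blast
qed

text \<open>The Krylov matrix of A + z N is multiplied by the eigenvector matrix of A in which
  column i is moved to v i + z x. Since u annihilates v i, column i of the product is divisible by
  z. Dividing by z and letting z tend to 0 gives the previous determinant formula with
  \<open>bdot u (v i)\<close> replaced by \<open>bdot u x\<close>.\<close>

lemma coeff_1_krylov_poly:
  assumes u: "bdot u (v i) = 0" and x: "lam i *s x - A *v x = N *v v i - l' *s v i"
  shows "coeff (krylov_poly u A N) 1 = kconst * (\<Prod>j\<in>UNIV - {i}. bdot u (v j)) * bdot u x"
proof -
  define p where "p = krylov_poly u A N"
  have "(\<Prod>i\<in>UNIV. bdot u (v i)) = 0" using u by (intro prod_zero) auto
  then have "poly p 0 = 0"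
    unfolding p_def poly_krylov_poly by (simp add: det_krylov_eigen)
  then have c0: "coeff p 0 = 0" by (simp add: poly_0_coeff_0)
  obtain q where q: "p = pCons 0 q" using c0 by (cases p) auto
  have c1: "coeff p 1 = poly q 0" unfolding q by (simp add: poly_0_coeff_0)
  have "\<exists>a s. continuous_on UNIV s \<and> (\<forall>z. ((*v) (A + smat z N) ^^ k) (v i + z *s x)
     = lam i ^ k *s v i + z *s (lam i ^ k *s x + a *s v i) + z\<^sup>2 *s s z)" for k
    by (rule power_perturbed_eigenvector[OF x])
  then obtain a s where s: "\<And>k. continuous_on UNIV (s k)" and eq: "\<And>k z. ((*v) (A + smat z N) ^^ k) (v i + z *s x)
     = lam i ^ k *s v i + z *s (lam i ^ k *s x + a k *s v i) + z\<^sup>2 *s s k z" by metis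
  define R where "R k z = lam i ^ k * bdot u x + z * bdot u (s k z)" for k z
  have bR: "bdot (krow u (A + smat z N) k) (v i + z *s x) = z * R k z" for k z
    unfolding bdot_krow eq R_def bdot_commute[of u] bdot_add_left bdot_scale_left
    using u by (simp add: bdot_commute algebra_simps power2_eq_square)
  define w where "w z j = (if j = i then v i + z *s x else v j)" for z j
  define E :: "complex \<Rightarrow> complex^'n^'n" where "E z = (\<chi> r c. if c = i then R (expo r) z else bdot (krow u (A + smat z N) (expo r)) (v c))" for z
  have prod_eq: "poly p z * det (column_matrix (w z)) = z * det (E z)" for z
  proof -
    have "krylov u (A + smat z N) ** column_matrix (w z) =
        (\<chi> r c. if c = i then z * R (expo r) z else bdot (krow u (A + smat z N) (expo r)) (v c))"
      by (simp add: vec_eq_iff krylov_mult_columns w_def bR)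
    from arg_cong[OF this, of det] show ?thesis
      unfolding p_def poly_krylov_poly E_def det_scale_column[symmetric] by (simp only: det_mul)
  qed
  have "poly q z * det (column_matrix (w z)) = det (E z)" if "z \<noteq> 0" for z
    using prod_eq[of z] that unfolding q by simp
  moreover have cont_w: "continuous_on UNIV (\<lambda>z. det (column_matrix (w z)))"
  proof (rule continuous_on_det)
    fix r c
    show "continuous_on UNIV (\<lambda>z. column_matrix (w z) $ r $ c)"
      unfolding column_matrix_def w_def by (cases "c = i") (auto intro!: continuous_intros)
  qed
  have cont_E: "continuous_on UNIV (\<lambda>z. det (E z))"
  proof (rule continuous_on_det)
    fix r c
    have k: "continuous_on UNIV (\<lambda>z. krow u (A + smat z N) k $ j)" for k j
      unfolding poly_krow[symmetric] by (intro continuous_intros)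
    have "continuous_on UNIV (\<lambda>z. bdot (krow u (A + smat z N) k) (v c))" for k
      unfolding bdot_def by (intro continuous_intros k)
    moreover have "continuous_on UNIV (R k)" for k
      unfolding R_def by (intro continuous_intros s)
    ultimately show "continuous_on UNIV (\<lambda>z. E z $ r $ c)"
      unfolding E_def by (cases "c = i") simp_all
  qed
  ultimately have "poly q 0 * det (column_matrix (w 0)) = det (E 0)"
  proof -
    assume ne: "\<And>z. z \<noteq> 0 \<Longrightarrow> poly q z * det (column_matrix (w z)) = det (E z)"
    have "((\<lambda>z. poly q z * det (column_matrix (w z))) \<longlongrightarrow> poly q 0 * det (column_matrix (w 0))) (at 0)"
      using cont_w by (intro tendsto_intros) (auto simp: continuous_on_def)
    moreover have "((\<lambda>z. det (E z)) \<longlongrightarrow> det (E 0)) (at 0)" using cont_E by (auto simp: continuous_on_def)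
    then have "((\<lambda>z. poly q z * det (column_matrix (w z))) \<longlongrightarrow> det (E 0)) (at 0)"
      by (rule Lim_transform_eventually) (auto simp: eventually_at ne intro!: exI[of _ 1])
    ultimately show ?thesis using tendsto_unique[of "at (0::complex)"] by auto
  qed
  moreover have "w 0 = v" unfolding w_def by auto
  moreover have "E 0 = (\<chi> r c. vandermonde lam $ r $ c * (if c = i then bdot u x else bdot u (v c)))"
    unfolding E_def R_def
    by (auto simp: vec_eq_iff bdot_krow matrix_power_eigenvector[OF eig] vandermonde_def bdot_scale_right)
  then have "det (E 0) = (\<Prod>c\<in>UNIV. if c = i then bdot u x else bdot u (v c)) * det (vandermonde lam)"
    by (simp only: det_scale_columns)
  moreover have "(\<Prod>c\<in>UNIV. if c = i then bdot u x else bdot u (v c)) = bdot u x * (\<Prod>c\<in>UNIV - {i}. bdot u (v c))"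
    by (subst prod.remove[of UNIV i]) (auto intro!: prod.cong)
  ultimately have "coeff p 1 * det (column_matrix v) = bdot u x * (\<Prod>c\<in>UNIV - {i}. bdot u (v c)) * det (vandermonde lam)"
    unfolding c1 by simp
  then show ?thesis unfolding p_def kconst_def using V by (simp add: field_simps)
qed

end

section \<open>Averages over matrices\<close>

text \<open>The Laplacian \<open>psi\<close> of the Krylov determinant, freed from the context
  parameters so that \<open>u\<close> and \<open>A\<close> may vary jointly.\<close>

definition krylov_energy :: "real \<Rightarrow> complex^'n \<Rightarrow> complex^'n^'n \<Rightarrow> real" where
  "krylov_energy e u A = (\<Sum>i\<in>UNIV. \<Sum>j\<in>UNIV. e * (cmod (coeff (krylov_poly u A (munit i j)) 1))\<^sup>2
     / ((cmod (det (krylov u A)))\<^sup>2 + e)\<^sup>2)"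

lemma krylov_energy_nonneg: "e > 0 \<Longrightarrow> 0 \<le> krylov_energy e u A"
  unfolding krylov_energy_def by (intro sum_nonneg) auto

lemma krylov_energy_ball_le:
  fixes u :: "complex^'n"
  assumes e: "e > 0" and q: "q > 0"
  shows "(\<integral>\<^sup>+A. ennreal (krylov_energy e u A * max 0 (q - (norm (A - C))\<^sup>2)) \<partial>lborel)
     \<le> ennreal (real (CARD('n) * (CARD('n) - 1) div 2) * measure lborel (ball C (sqrt q)))"
  using krylov.nn_integral_psi_le[OF e q, of u C]
  unfolding krylov.psi_def[OF e q] krylov.Q_def[OF e] krylov_energy_def .

lemma continuous_krylov_energy:
  assumes e: "e > 0"
  shows "continuous_on UNIV (\<lambda>x. krylov_energy e (fst x) (snd x))"
proof -
  have c: "continuous_on UNIV (\<lambda>x. coeff (krylov_poly (fst x) (snd x) N) k)" for N :: "complex^'n^'n" and k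
  proof -
    have "continuous_on UNIV (\<lambda>x. coeff (case x of (u, A, N) \<Rightarrow> krylov_poly u A N) k)"
      using cont_coeffs_krylov_poly unfolding cont_coeffs_def by blast
    moreover have "continuous_on UNIV (\<lambda>x :: (complex^'n) \<times> (complex^'n^'n). (fst x, snd x, N))" by (intro continuous_intros)
    ultimately show ?thesis
      using continuous_on_compose2[of UNIV "\<lambda>x. coeff (case x of (u, A, N) \<Rightarrow> krylov_poly u A N) k" UNIV "\<lambda>x. (fst x, snd x, N)"] by simp
  qed
  have d: "det (krylov u A) = coeff (krylov_poly u A 0) 0" for u and A :: "complex^'n^'n"
    using poly_krylov_poly[of u A 0 0] by (simp add: poly_0_coeff_0)
  have "(cmod z)\<^sup>2 + e \<noteq> 0" for z using e by (smt (verit) zero_le_power2)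
  then show ?thesis unfolding krylov_energy_def d by (intro continuous_intros c) auto
qed

definition eig_energy :: "complex^'n^'n \<Rightarrow> ennreal" where
  "eig_energy A = eigsum (\<lambda>A l v. ennreal ((frob_norm_inv A l v)\<^sup>2)) A"

lemma eigsum_finite:
  assumes "finite (eigenpairs A)"
  shows "eigsum f A = (\<Sum>p\<in>eigenpairs A. f A (fst p) (line_rep (snd p)))"
  unfolding eigsum_def by (rule nn_integral_count_space_finite[OF assms])

lemma finite_eigenpairs: "A \<notin> degenerate \<Longrightarrow> finite (eigenpairs A)" for A :: "complex^'n^'n"
  by (rule nondegenerate_eigenbasis[of A]) auto

lemma eigenpair_line_rep:
  assumes "p \<in> eigenpairs A"
  shows "line_rep (snd p) \<noteq> 0" "A *v line_rep (snd p) = fst p *s line_rep (snd p)"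
proof -
  obtain l v where p: "p = (l, cline v)" and v: "v \<noteq> 0" "A *v v = l *s v"
    using assms unfolding eigenpairs_def by blast
  obtain z where z: "z \<noteq> 0" "line_rep (cline v) = z *s v" using line_rep_cline[OF v(1)] .
  show "line_rep (snd p) \<noteq> 0" "A *v line_rep (snd p) = fst p *s line_rep (snd p)"
    using z v by (simp_all add: p matrix_vector_mult_scale mult.commute)
qed

lemma gauss_const_eq: "(\<integral>\<^sup>+u. ennreal (exp (- (norm u)\<^sup>2)) \<partial>(lborel :: (complex^'n) measure)) = ennreal (sqrt pi ^ DIM(complex^'n))"
  using nn_integral_gaussian[of 1 "0 :: complex^'n"] by simp

text \<open>The directions are the matrix units. The unit at (a, b) maps v to \<open>v $ b\<close>
  times the basis vector a, so summing the squared motions of v over all units gives |v|^2 times the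
  squared Frobenius norm of the inverse; the factor |v|^2 cancels the denominator of the
  concentration limit.\<close>

lemma eig_energy_le_liminf:
  fixes A :: "complex^'n^'n"
  assumes A: "A \<notin> degenerate"
  shows "eig_energy A * ennreal (sqrt pi ^ DIM(complex^'n))
    \<le> liminf (\<lambda>k. \<integral>\<^sup>+u. ennreal (krylov_energy ((1 / real (Suc k))\<^sup>2) u A) * ennreal (exp (- (norm u)\<^sup>2)) \<partial>lborel)"
proof -
  obtain lam :: "'n \<Rightarrow> complex" and v :: "'n \<Rightarrow> complex^'n"
    where lam: "inj lam" and v0: "\<And>i. v i \<noteq> 0" and Av: "\<And>i. A *v v i = lam i *s v i"
      and rep: "\<And>i. line_rep (cline (v i)) = v i"
      and ep: "eigenpairs A = (\<lambda>i. (lam i, cline (v i))) ` UNIV" and V: "det (column_matrix v) \<noteq> 0"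
    by (rule nondegenerate_eigenbasis[OF A]) (rule that)
  have inv: "A_lv_invertible A (lam i) (v i)" for i
    by (rule A_lv_invertible_of_nondegenerate[OF A v0 Av])
  define M where "M i = (\<lambda>(a, b). A_lv_inv_ext A (lam i) (v i) (munit a b *v v i))" for i
  define G where "G = (\<lambda>(a, b) u. coeff (krylov_poly u A (munit a b)) 1)"
  interpret P: linear_form_product v "kconst lam v" "\<lambda>u. det (krylov u A)" G M
  proof
    show "v i \<noteq> 0" for i by (rule v0)
    show "v j \<noteq> z *s v i" if "i \<noteq> j" for i j z
    proof
      assume "v j = z *s v i"
      then have "lam j *s v j = lam i *s v j"
        using Av[of j] Av[of i] by (metis matrix_vector_mult_scale vector_smult_assoc mult.commute)
      then have "lam j = lam i" using v0[of j] by simp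
      then show False using lam that by (auto simp: inj_def)
    qed
    show "kconst lam v \<noteq> 0"
      unfolding kconst_def[OF Av V] using det_vandermonde_ne_0[OF lam] V by simp
    show "det (krylov u A) = kconst lam v * (\<Prod>i\<in>UNIV. bdot u (v i))" for u
      by (rule det_krylov_eigen[OF Av V])
    show "continuous_on UNIV (G a)" for a
    proof -
      have "continuous_on UNIV (\<lambda>x. coeff (case x of (u, A, N) \<Rightarrow> krylov_poly u A N) 1)"
        using cont_coeffs_krylov_poly unfolding cont_coeffs_def by blast
      moreover have "continuous_on UNIV (\<lambda>u :: complex^'n. (u, A, munit (fst a) (snd a)))" by (intro continuous_intros)
      ultimately show ?thesis
        using continuous_on_compose2[of UNIV "\<lambda>x. coeff (case x of (u, A, N) \<Rightarrow> krylov_poly u A N) 1" UNIV "\<lambda>u. (u, A, munit (fst a) (snd a))"]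
        by (simp add: G_def split_beta)
    qed
    show "G a u = kconst lam v * (\<Prod>j\<in>UNIV - {i}. bdot u (v j)) * bdot u (M i a)" if "bdot u (v i) = 0" for u i a
    proof -
      obtain l' where "lam i *s M i a - A *v M i a = munit (fst a) (snd a) *v v i - l' *s v i"
        using inv_ext_eq[OF v0 Av inv, of i "munit (fst a) (snd a) *v v i"] unfolding M_def split_beta by blast
      from coeff_1_krylov_poly[OF Av V that this] show ?thesis by (simp add: G_def split_beta)
    qed
    show "bdot (vcnj (v i)) (M i a) = 0" for i a
      using inv_ext_in_hperp[OF v0 Av inv, of i "munit (fst a) (snd a) *v v i"]
      unfolding hperp_iff hinner_eq_bdot M_def split_beta .
  qed
  have Psi: "P.Psi k u = krylov_energy ((1 / real (Suc k))\<^sup>2) u A" for k u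
    unfolding P.Psi_def P.h_def
    unfolding krylov_energy_def G_def sum.cartesian_product UNIV_Times_UNIV by (simp add: split_beta)
  have MF: "(\<Sum>a\<in>UNIV. (norm (M i a))\<^sup>2) / (norm (v i))\<^sup>2 = (frob_norm_inv A (lam i) (v i))\<^sup>2" for i
  proof -
    have ml: "munit a b *v v i = v i $ b *s axis a 1" for a b
      by (simp add: vec_eq_iff matrix_vector_mult_def axis_def if_distrib[of "\<lambda>x. x * _"] cong: if_cong)
    have "norm (M i (a, b)) = cmod (v i $ b) * norm (A_lv_inv_ext A (lam i) (v i) (axis a 1))" for a b
      unfolding M_def by (simp add: ml inv_ext_scale[OF v0 Av inv] norm_scale_vec)
    moreover have "(\<Sum>a\<in>UNIV. (norm (M i a))\<^sup>2) = (\<Sum>a\<in>UNIV. \<Sum>b\<in>UNIV. (norm (M i (a, b)))\<^sup>2)"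
      unfolding sum.cartesian_product UNIV_Times_UNIV by (simp add: split_beta)
    ultimately have "(\<Sum>a\<in>UNIV. (norm (M i a))\<^sup>2) = (\<Sum>a\<in>UNIV. \<Sum>b\<in>UNIV. (cmod (v i $ b))\<^sup>2 * (norm (A_lv_inv_ext A (lam i) (v i) (axis a 1)))\<^sup>2)"
      by (simp add: power_mult_distrib)
    also have "\<dots> = (norm (v i))\<^sup>2 * (\<Sum>a\<in>UNIV. (norm (A_lv_inv_ext A (lam i) (v i) (axis a 1)))\<^sup>2)"
      by (simp add: norm_vec_def[of "v i"] L2_set_def sum_nonneg sum_distrib_right[symmetric] sum_distrib_left[symmetric])
    also have "\<dots> = (norm (v i))\<^sup>2 * (frob_norm_inv A (lam i) (v i))\<^sup>2"
      by (simp add: frob_norm_inv_def sum_nonneg)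
    finally show ?thesis using v0[of i] by simp
  qed
  have "inj (\<lambda>i. (lam i, cline (v i)))" using lam by (auto simp: inj_def)
  then have "eig_energy A = (\<Sum>i\<in>UNIV. ennreal ((frob_norm_inv A (lam i) (v i))\<^sup>2))"
    unfolding eig_energy_def eigsum_finite[OF finite_eigenpairs[OF A]] ep by (simp add: sum.reindex rep del: sum_ennreal)
  then show ?thesis
    using P.liminf_Psi unfolding MF Psi P.gauss_const_def gauss_const_eq by simp
qed

text \<open>The last clause is a transfer principle: by Fubini and Fatou, any bound on the weighted
  integral of the energies that is uniform in \<open>e\<close> and \<open>u\<close> passes to
  \<open>L\<close>. The weight stays arbitrary because the Gaussian density and the truncated weight
  on the ball are both inserted later.\<close>

lemma eig_energy_majorant:
  "\<exists>L :: complex^'n^'n \<Rightarrow> ennreal. L \<in> borel_measurable borel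
    \<and> (AE A in lborel. A \<notin> degenerate \<and> eig_energy A \<le> L A)
    \<and> (\<forall>w K. w \<in> borel_measurable borel \<longrightarrow>
      (\<forall>e u. e > 0 \<longrightarrow> (\<integral>\<^sup>+A. ennreal (krylov_energy e u A) * w A \<partial>lborel) \<le> K) \<longrightarrow> (\<integral>\<^sup>+A. L A * w A \<partial>lborel) \<le> K)"
proof -
  define e where "e k = (1 / real (Suc k))\<^sup>2" for k
  have e: "e k > 0" for k by (simp add: e_def)
  define g where "g u = ennreal (exp (- (norm u)\<^sup>2))" for u :: "complex^'n"
  have [measurable]: "g \<in> borel_measurable borel" unfolding g_def by measurable
  define c where "c = sqrt pi ^ DIM(complex^'n)"
  have c: "c > 0" by (simp add: c_def)
  have gc: "(\<integral>\<^sup>+u. g u \<partial>lborel) = ennreal c" unfolding g_def c_def by (rule gauss_const_eq)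
  define I where "I k A = (\<integral>\<^sup>+u. ennreal (krylov_energy (e k) u A) * g u \<partial>lborel)" for k and A :: "complex^'n^'n"
  have [measurable]: "(\<lambda>x. krylov_energy (e k) (fst x) (snd x)) \<in> borel_measurable (borel \<Otimes>\<^sub>M borel)" for k
    unfolding borel_prod by (rule borel_measurable_continuous_onI[OF continuous_krylov_energy[OF e]])
  have m1[measurable]: "(\<lambda>(u, A). krylov_energy (e k) u A) \<in> borel_measurable (borel \<Otimes>\<^sub>M borel)" for k
    by (simp add: split_beta')
  have m2[measurable]: "(\<lambda>(A, u). krylov_energy (e k) u A) \<in> borel_measurable (borel \<Otimes>\<^sub>M borel)" for k
    using measurable_compose[OF measurable_pair_swap' m1[of k]] by (simp add: split_beta')
  have mI[measurable]: "I k \<in> borel_measurable borel" for k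
    unfolding I_def by measurable
  define L where "L A = liminf (\<lambda>k. I k A) * ennreal (1 / c)" for A
  have mL: "L \<in> borel_measurable borel" unfolding L_def by measurable
  have maj: "AE A in lborel. A \<notin> degenerate \<and> eig_energy A \<le> L A"
    using AE_nondegenerate
  proof eventually_elim
    fix A :: "complex^'n^'n" assume A: "A \<notin> degenerate"
    have "eig_energy A * ennreal c \<le> liminf (\<lambda>k. I k A)"
      using eig_energy_le_liminf[OF A] unfolding I_def g_def e_def c_def .
    then have "eig_energy A * ennreal c * ennreal (1 / c) \<le> L A"
      unfolding L_def by (rule mult_right_mono) simp
    moreover have "ennreal c * ennreal (1 / c) = 1" using c by (simp flip: ennreal_mult)
    ultimately show "A \<notin> degenerate \<and> eig_energy A \<le> L A" using A by (simp add: mult.assoc)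
  qed
  have bound: "(\<integral>\<^sup>+A. L A * w A \<partial>lborel) \<le> K"
    if [measurable]: "w \<in> borel_measurable borel" and K: "\<And>e u. e > 0 \<Longrightarrow> (\<integral>\<^sup>+A. ennreal (krylov_energy e u A) * w A \<partial>lborel) \<le> K" for w K
  proof -
    have step: "(\<integral>\<^sup>+A. w A * I k A \<partial>lborel) \<le> K * ennreal c" for k
    proof -
      have "(\<integral>\<^sup>+A. w A * I k A \<partial>lborel) = (\<integral>\<^sup>+A. (\<integral>\<^sup>+u. w A * (ennreal (krylov_energy (e k) u A) * g u) \<partial>lborel) \<partial>lborel)"
        unfolding I_def by (intro nn_integral_cong nn_integral_cmult[symmetric]) measurable
      also have "\<dots> = (\<integral>\<^sup>+u. (\<integral>\<^sup>+A. w A * (ennreal (krylov_energy (e k) u A) * g u) \<partial>lborel) \<partial>lborel)"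
        by (rule lborel_pair.Fubini') measurable
      also have "\<dots> = (\<integral>\<^sup>+u. (\<integral>\<^sup>+A. ennreal (krylov_energy (e k) u A) * w A \<partial>lborel) * g u \<partial>lborel)"
      proof (rule nn_integral_cong)
        fix u
        have "(\<integral>\<^sup>+A. w A * (ennreal (krylov_energy (e k) u A) * g u) \<partial>lborel) = (\<integral>\<^sup>+A. ennreal (krylov_energy (e k) u A) * w A * g u \<partial>lborel)"
          by (simp add: mult_ac)
        also have "\<dots> = (\<integral>\<^sup>+A. ennreal (krylov_energy (e k) u A) * w A \<partial>lborel) * g u"
          by (rule nn_integral_multc) measurable
        finally show "(\<integral>\<^sup>+A. w A * (ennreal (krylov_energy (e k) u A) * g u) \<partial>lborel) = (\<integral>\<^sup>+A. ennreal (krylov_energy (e k) u A) * w A \<partial>lborel) * g u" .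
      qed
      also have "\<dots> \<le> (\<integral>\<^sup>+u. K * g u \<partial>lborel)"
        by (intro nn_integral_mono mult_right_mono K e) simp
      also have "\<dots> = K * ennreal c" by (simp add: nn_integral_cmult gc)
      finally show ?thesis .
    qed
    have "(\<integral>\<^sup>+A. L A * w A \<partial>lborel) = (\<integral>\<^sup>+A. ennreal (1 / c) * (w A * liminf (\<lambda>k. I k A)) \<partial>lborel)"
      unfolding L_def by (simp add: mult_ac)
    also have "\<dots> = ennreal (1 / c) * (\<integral>\<^sup>+A. w A * liminf (\<lambda>k. I k A) \<partial>lborel)"
      by (rule nn_integral_cmult) measurable
    also have "(\<integral>\<^sup>+A. w A * liminf (\<lambda>k. I k A) \<partial>lborel) \<le> (\<integral>\<^sup>+A. liminf (\<lambda>k. w A * I k A) \<partial>lborel)"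
      by (intro nn_integral_mono mult_liminf_le)
    also have "\<dots> \<le> liminf (\<lambda>k. \<integral>\<^sup>+A. w A * I k A \<partial>lborel)"
      by (rule nn_integral_liminf) measurable
    also have "\<dots> \<le> liminf (\<lambda>k. K * ennreal c)"
      by (intro Liminf_mono always_eventually allI step)
    also have "\<dots> = K * ennreal c" by (simp add: Liminf_const)
    finally have "(\<integral>\<^sup>+A. L A * w A \<partial>lborel) \<le> ennreal (1 / c) * (K * ennreal c)"
      by (simp add: mult_left_mono)
    moreover have "ennreal c * ennreal (1 / c) = 1" using c by (simp flip: ennreal_mult)
    ultimately show ?thesis by (simp add: mult_ac)
  qed
  show ?thesis using mL maj bound by blast
qed

section \<open>From the energy to the condition numbers\<close>

lemma eigsum_mono:
  assumes "\<And>l v. v \<noteq> 0 \<Longrightarrow> A *v v = l *s v \<Longrightarrow> f A l v \<le> g A l v"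
  shows "eigsum f A \<le> eigsum g A"
  unfolding eigsum_def
proof (rule nn_integral_mono)
  fix p assume "p \<in> space (count_space (eigenpairs A))"
  then have "p \<in> eigenpairs A" by simp
  from assms[OF eigenpair_line_rep[OF this]]
  show "f A (fst p) (line_rep (snd p)) \<le> g A (fst p) (line_rep (snd p))" .
qed

lemma mu_le_mu_F:
  assumes "v \<noteq> 0" "A *v v = l *s v"
  shows "mu A l v \<le> mu_F A l v"
proof (cases "A_lv_invertible A l v")
  case True
  have "frob_norm A * op_norm_inv A l v \<le> frob_norm A * frob_norm_inv A l v"
    using op_norm_inv_le[OF assms True] by (intro mult_left_mono) (auto simp: frob_norm_eq)
  then show ?thesis using True unfolding mu_def mu_F_def by (auto intro!: ennreal_leI max.mono)
qed (simp add: mu_def mu_F_def)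

text \<open>The squares of both arguments of the maximum lie below the bound: that of 1 by the lower
  bound for the inverse, the other one trivially.\<close>

lemma mu_F_square_le:
  fixes A :: "complex^'n^'n"
  assumes card: "CARD('n) \<ge> 2" and A: "A \<notin> degenerate" and v: "v \<noteq> 0" "A *v v = l *s v"
  shows "(mu_F A l v)\<^sup>2 \<le> 2 * ennreal ((norm A)\<^sup>2) * ennreal ((frob_norm_inv A l v)\<^sup>2)" and "A \<noteq> 0"
proof -
  have inv: "A_lv_invertible A l v" by (rule A_lv_invertible_of_nondegenerate[OF A v])
  define x where "x = frob_norm_inv A l v"
  have one: "1 \<le> 2 * (norm A)\<^sup>2 * x\<^sup>2" unfolding x_def by (rule one_le_frob_norm_inv[OF card v inv])
  then show "A \<noteq> 0" by auto
  have "(max 1 (norm A * x))\<^sup>2 \<le> 2 * (norm A)\<^sup>2 * x\<^sup>2"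
    using one by (simp add: max_def power_mult_distrib)
  then have "ennreal ((max 1 (norm A * x))\<^sup>2) \<le> ennreal (2 * (norm A)\<^sup>2 * x\<^sup>2)" by (rule ennreal_leI)
  also have "\<dots> = 2 * ennreal ((norm A)\<^sup>2) * ennreal (x\<^sup>2)"
    by (simp add: ennreal_mult)
  also have "ennreal ((max 1 (norm A * x))\<^sup>2) = (mu_F A l v)\<^sup>2"
    using inv unfolding mu_F_def x_def frob_norm_eq by (simp add: ennreal_power)
  finally show "(mu_F A l v)\<^sup>2 \<le> 2 * ennreal ((norm A)\<^sup>2) * ennreal ((frob_norm_inv A l v)\<^sup>2)" unfolding x_def .
qed

lemma eigsum_cmult:
  assumes "finite (eigenpairs A)"
  shows "eigsum (\<lambda>A l v. c * f A l v) A = c * eigsum f A"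
  unfolding eigsum_finite[OF assms] by (simp add: sum_distrib_left)

lemma eigsum_mu_F_le:
  fixes A :: "complex^'n^'n"
  assumes card: "CARD('n) \<ge> 2" and A: "A \<notin> degenerate"
  shows "eigsum (\<lambda>A l v. (mu_F A l v)\<^sup>2) A \<le> 2 * ennreal ((norm A)\<^sup>2) * eig_energy A"
    and "eigsum (\<lambda>A l v. (mu_F A l v)\<^sup>2 / ennreal ((frob_norm A)\<^sup>2)) A \<le> 2 * eig_energy A"
proof -
  have "eigsum (\<lambda>A l v. (mu_F A l v)\<^sup>2) A \<le> eigsum (\<lambda>_ l v. 2 * ennreal ((norm A)\<^sup>2) * ennreal ((frob_norm_inv A l v)\<^sup>2)) A"
    by (rule eigsum_mono) (rule mu_F_square_le(1)[OF card A])
  also have "\<dots> = 2 * ennreal ((norm A)\<^sup>2) * eigsum (\<lambda>_ l v. ennreal ((frob_norm_inv A l v)\<^sup>2)) A"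
    by (rule eigsum_cmult[OF finite_eigenpairs[OF A]])
  finally show "eigsum (\<lambda>A l v. (mu_F A l v)\<^sup>2) A \<le> 2 * ennreal ((norm A)\<^sup>2) * eig_energy A"
    unfolding eig_energy_def eigsum_def .
  have "eigsum (\<lambda>A l v. (mu_F A l v)\<^sup>2 / ennreal ((frob_norm A)\<^sup>2)) A \<le> eigsum (\<lambda>A l v. 2 * ennreal ((frob_norm_inv A l v)\<^sup>2)) A"
  proof (rule eigsum_mono)
    fix l v assume v: "v \<noteq> 0" "A *v v = l *s v"
    \<comment> \<open>The lower bound for the inverse excludes A = 0, so the norm may be
      cancelled.\<close>
    have a: "ennreal ((norm A)\<^sup>2) \<noteq> 0" using mu_F_square_le(2)[OF card A v] by simp
    have "(mu_F A l v)\<^sup>2 / ennreal ((frob_norm A)\<^sup>2) \<le> (2 * ennreal ((norm A)\<^sup>2) * ennreal ((frob_norm_inv A l v)\<^sup>2)) / ennreal ((norm A)\<^sup>2)"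
      unfolding frob_norm_eq by (rule divide_right_mono_ennreal[OF mu_F_square_le(1)[OF card A v]])
    also have "\<dots> = 2 * ennreal ((frob_norm_inv A l v)\<^sup>2) * ennreal ((norm A)\<^sup>2) / ennreal ((norm A)\<^sup>2)"
      by (simp add: mult_ac)
    also have "\<dots> = 2 * ennreal ((frob_norm_inv A l v)\<^sup>2)"
      using a by (intro ennreal_mult_divide_eq) simp_all
    finally show "(mu_F A l v)\<^sup>2 / ennreal ((frob_norm A)\<^sup>2) \<le> 2 * ennreal ((frob_norm_inv A l v)\<^sup>2)" .
  qed
  then show "eigsum (\<lambda>A l v. (mu_F A l v)\<^sup>2 / ennreal ((frob_norm A)\<^sup>2)) A \<le> 2 * eig_energy A"
    unfolding eig_energy_def eigsum_cmult[OF finite_eigenpairs[OF A], of 2] .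
qed

section \<open>Homogeneity of eigenpairs and energy\<close>

lemma scale_matrix_mult: "(c *\<^sub>R A) *v w = of_real c *s (A *v w)" for A :: "complex^'n^'n"
  by (simp add: vec_eq_iff matrix_vector_mult_def sum_distrib_left) (simp add: scaleR_conv_of_real mult.assoc)

lemma degenerate_scale:
  fixes A :: "complex^'n^'n"
  assumes c: "c > 0" and A: "c *\<^sub>R A \<in> degenerate"
  shows "A \<in> degenerate"
proof -
  obtain l d v w where h: "v \<noteq> 0" "\<And>z. w \<noteq> z *s v" "(c *\<^sub>R A) *v v = l *s v" "(c *\<^sub>R A) *v w = l *s w + d *s v"
    using A unfolding degenerate_def by blast
  have inv: "x = of_real (1 / c) *s (of_real c *s x)" for x :: "complex^'n" using c by simp
  have "A *v v = of_real (1 / c) *s (l *s v)" using inv[of "A *v v"] h(3) unfolding scale_matrix_mult by simp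
  moreover have "A *v w = of_real (1 / c) *s (l *s w + d *s v)" using inv[of "A *v w"] h(4) unfolding scale_matrix_mult by simp
  ultimately have "A *v v = (of_real (1 / c) * l) *s v" "A *v w = (of_real (1 / c) * l) *s w + (of_real (1 / c) * d) *s v"
    by (simp_all add: vector_add_ldistrib)
  then show ?thesis using h(1,2) unfolding degenerate_def by blast
qed

lemma eigenpairs_scale:
  assumes c: "c > 0"
  shows "(\<lambda>p. (of_real c * fst p, snd p)) ` eigenpairs A \<subseteq> eigenpairs (c *\<^sub>R A)"
proof clarify
  fix l L assume "(l, L) \<in> eigenpairs A"
  then obtain v where v: "L = cline v" "v \<noteq> 0" "A *v v = l *s v" unfolding eigenpairs_def by blast
  have "(c *\<^sub>R A) *v v = (of_real c * l) *s v" unfolding scale_matrix_mult v(3) by simp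
  then show "(of_real c * fst (l, L), snd (l, L)) \<in> eigenpairs (c *\<^sub>R A)"
    unfolding eigenpairs_def using v(1,2) by auto
qed

lemma eigenpairs_scale_eq:
  assumes c: "c > 0"
  shows "eigenpairs (c *\<^sub>R A) = (\<lambda>p. (of_real c * fst p, snd p)) ` eigenpairs A"
proof
  have "(\<lambda>p. (of_real (1 / c) * fst p, snd p)) ` eigenpairs (c *\<^sub>R A) \<subseteq> eigenpairs A"
    using eigenpairs_scale[of "1 / c" "c *\<^sub>R A"] c by simp
  moreover have "p = (\<lambda>p. (of_real c * fst p, snd p)) ((\<lambda>p. (of_real (1 / c) * fst p, snd p)) p)" for p :: "complex \<times> (complex^'a) set"
    using c by simp
  ultimately show "eigenpairs (c *\<^sub>R A) \<subseteq> (\<lambda>p. (of_real c * fst p, snd p)) ` eigenpairs A"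
    by blast
qed (rule eigenpairs_scale[OF c])

lemma frob_norm_inv_scale:
  fixes A :: "complex^'n^'n"
  assumes c: "c > 0" and A: "A \<notin> degenerate" and v: "v \<noteq> 0" "A *v v = l *s v"
  shows "frob_norm_inv (c *\<^sub>R A) (of_real c * l) v = frob_norm_inv A l v / c"
proof -
  have v': "(c *\<^sub>R A) *v v = (of_real c * l) *s v" unfolding scale_matrix_mult v(2) by simp
  have inv: "A_lv_invertible A l v" by (rule A_lv_invertible_of_nondegenerate[OF A v])
  have inv': "A_lv_invertible (c *\<^sub>R A) (of_real c * l) v"
    using A_lv_invertible_of_nondegenerate[OF _ v(1) v'] degenerate_scale[OF c] A by blast
  have sc: "A_lv (c *\<^sub>R A) (of_real c * l) v w = of_real c *s A_lv A l v w" for w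
  proof -
    have "(of_real c * l) *s w - (c *\<^sub>R A) *v w = of_real c *s (l *s w - A *v w)"
      unfolding scale_matrix_mult by (simp add: vec_eq_iff algebra_simps)
    then show ?thesis unfolding A_lv_def by (simp only: proj_perp_scale)
  qed
  have "A_lv_inv_ext (c *\<^sub>R A) (of_real c * l) v w = of_real (1 / c) *s A_lv_inv_ext A l v w" for w
  proof (rule inv_ext_unique[OF v(1) v' inv'])
    show "of_real (1 / c) *s A_lv_inv_ext A l v w \<in> hperp v"
      by (intro hperp_scale inv_ext_in_hperp[OF v inv])
    show "A_lv (c *\<^sub>R A) (of_real c * l) v (of_real (1 / c) *s A_lv_inv_ext A l v w) = proj_perp v w"
      unfolding sc A_lv_scale A_lv_inv_ext[OF v inv] using c by simp
  qed
  then have "(norm (A_lv_inv_ext (c *\<^sub>R A) (of_real c * l) v w))\<^sup>2 = (norm (A_lv_inv_ext A l v w))\<^sup>2 / c\<^sup>2" for w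
    using c by (simp add: norm_scale_vec norm_divide power_divide)
  then show ?thesis unfolding frob_norm_inv_def
    using c by (simp add: sum_divide_distrib[symmetric] real_sqrt_divide)
qed

text \<open>Eigenvalues are multiplied by c, eigenlines stay, and each inverse is divided by c. The
  resulting degree -2 matches the weight used for the sphere.\<close>

lemma eig_energy_scale:
  fixes A :: "complex^'n^'n"
  assumes c: "c > 0" and A: "A \<notin> degenerate"
  shows "eig_energy (c *\<^sub>R A) = ennreal (1 / c\<^sup>2) * eig_energy A"
proof -
  have inj: "inj_on (\<lambda>p. (of_real c * fst p, snd p)) (eigenpairs A)"
    using c by (auto intro!: inj_onI simp: prod_eq_iff)
  have A': "c *\<^sub>R A \<notin> degenerate" using degenerate_scale[OF c] A by blast
  have "eig_energy (c *\<^sub>R A) = (\<Sum>p\<in>eigenpairs A. ennreal ((frob_norm_inv (c *\<^sub>R A) (of_real c * fst p) (line_rep (snd p)))\<^sup>2))"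
    unfolding eig_energy_def eigsum_finite[OF finite_eigenpairs[OF A']] eigenpairs_scale_eq[OF c] sum.reindex[OF inj] by simp
  also have "\<dots> = (\<Sum>p\<in>eigenpairs A. ennreal (1 / c\<^sup>2) * ennreal ((frob_norm_inv A (fst p) (line_rep (snd p)))\<^sup>2))"
  proof (rule sum.cong[OF refl])
    fix p assume "p \<in> eigenpairs A"
    note v = eigenpair_line_rep[OF this]
    show "ennreal ((frob_norm_inv (c *\<^sub>R A) (of_real c * fst p) (line_rep (snd p)))\<^sup>2) = ennreal (1 / c\<^sup>2) * ennreal ((frob_norm_inv A (fst p) (line_rep (snd p)))\<^sup>2)"
      unfolding frob_norm_inv_scale[OF c A v] using c by (simp add: power_divide flip: ennreal_mult)
  qed
  also have "\<dots> = ennreal (1 / c\<^sup>2) * eig_energy A"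
    unfolding eig_energy_def eigsum_finite[OF finite_eigenpairs[OF A]] by (simp add: sum_distrib_left del: sum_ennreal)
  finally show ?thesis .
qed

lemma gauss_density_eq:
  fixes A Ahat :: "complex^'n^'n"
  assumes s: "s > 0"
  shows "gauss_density s Ahat A = exp (- (norm (A - Ahat))\<^sup>2 / s\<^sup>2) / (sqrt pi * s) ^ DIM(complex^'n^'n)"
proof -
  have n: "(norm (A - Ahat))\<^sup>2 = (\<Sum>i\<in>UNIV. \<Sum>j\<in>UNIV. (cmod (A $ i $ j - Ahat $ i $ j))\<^sup>2)"
    by (simp add: norm_vec_def L2_set_def sum_nonneg)
  have dim: "DIM(complex^'n^'n) = 2 * (CARD('n) * CARD('n))" by simp
  have "(sqrt pi * s) ^ DIM(complex^'n^'n) = ((sqrt pi * s)\<^sup>2) ^ (CARD('n) * CARD('n))"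
    unfolding dim by (rule power_mult)
  also have "(sqrt pi * s)\<^sup>2 = pi * s\<^sup>2" by (simp add: power_mult_distrib)
  finally have "(sqrt pi * s) ^ DIM(complex^'n^'n) = (pi * s\<^sup>2) ^ (CARD('n) * CARD('n))" .
  then show ?thesis
    unfolding gauss_density_def n
    by (simp add: prod_dividef exp_sum[symmetric] sum_negf sum_divide_distrib power_mult)
qed

lemma real_half_le: "real (n * (n - 1) div 2) \<le> real n * (real n - 1) / 2"
proof -
  have "real (2 * (n * (n - 1) div 2)) \<le> real (n * (n - 1))"
    unfolding of_nat_le_iff by (rule times_div_less_eq_dividend)
  then have "2 * real (n * (n - 1) div 2) \<le> real (n * (n - 1))" by (simp only: of_nat_mult of_nat_numeral)
  moreover have "real (n * (n - 1)) = real n * (real n - 1)" by (cases n) (simp_all add: algebra_simps)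
  ultimately show ?thesis by linarith
qed

theorem theorem2:
  fixes s :: real and Ahat :: "complex^'n^'n"
  assumes "CARD('n) \<ge> 2" and "s > 0"
  shows "(\<integral>\<^sup>+ A. (eigsum (\<lambda>A l v. (mu A l v)^2 / ennreal ((frob_norm A)^2)) A) / of_nat CARD('n) \<partial>gauss_matrix s Ahat)
         \<le> (\<integral>\<^sup>+ A. (eigsum (\<lambda>A l v. (mu_F A l v)^2 / ennreal ((frob_norm A)^2)) A) / of_nat CARD('n) \<partial>gauss_matrix s Ahat)
       \<and> (\<integral>\<^sup>+ A. (eigsum (\<lambda>A l v. (mu_F A l v)^2 / ennreal ((frob_norm A)^2)) A) / of_nat CARD('n) \<partial>gauss_matrix s Ahat)
         \<le> ennreal (real CARD('n) / s^2)
       \<and> (\<integral>\<^sup>+ A. eigsum (\<lambda>A l v. (mu A l v)^2) A / of_nat CARD('n) \<partial>(sphere_uniform :: (complex^'n^'n) measure))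
         \<le> (\<integral>\<^sup>+ A. eigsum (\<lambda>A l v. (mu_F A l v)^2) A / of_nat CARD('n) \<partial>(sphere_uniform :: (complex^'n^'n) measure))
       \<and> (\<integral>\<^sup>+ A. eigsum (\<lambda>A l v. (mu_F A l v)^2) A / of_nat CARD('n) \<partial>(sphere_uniform :: (complex^'n^'n) measure))
         \<le> ennreal (real CARD('n) ^ 3)"
proof -
  define n where "n = real CARD('n)"
  define d where "d = real (CARD('n) * (CARD('n) - 1) div 2)"
  have n2: "n \<ge> 2" using assms(1) by (simp add: n_def)
  have d: "d \<le> n * (n - 1) / 2" unfolding d_def n_def by (rule real_half_le)
  have d0: "0 \<le> d" by (simp add: d_def)
  have on: "of_nat CARD('n) = ennreal n" by (simp add: n_def ennreal_of_nat_eq_real_of_nat)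
  have div_n: "x / ennreal n = ennreal (1 / n) * x" for x
    using n2 by (simp add: divide_ennreal_def inverse_ennreal divide_inverse mult.commute)
  obtain L :: "complex^'n^'n \<Rightarrow> ennreal" where [measurable]: "L \<in> borel_measurable borel"
    and L: "AE A in lborel. A \<notin> degenerate \<and> eig_energy A \<le> L A"
    and bound: "\<And>w K. w \<in> borel_measurable borel \<Longrightarrow>
      (\<And>e u. e > 0 \<Longrightarrow> (\<integral>\<^sup>+A. ennreal (krylov_energy e u A) * w A \<partial>lborel) \<le> K) \<Longrightarrow> (\<integral>\<^sup>+A. L A * w A \<partial>lborel) \<le> K"
    using eig_energy_majorant by blast
  have mk: "(\<lambda>A. krylov_energy e u A) \<in> borel_measurable borel" if "e > 0" for e and u :: "complex^'n"
  proof -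
    have "continuous_on UNIV (\<lambda>A. (u, A))" by (intro continuous_intros)
    from continuous_on_compose2[OF continuous_krylov_energy[OF that] this]
    show ?thesis by (intro borel_measurable_continuous_onI) simp
  qed
  have eig_le: "eigsum (\<lambda>A l v. f (mu A l v) A) A / of_nat CARD('n) \<le> eigsum (\<lambda>A l v. f (mu_F A l v) A) A / of_nat CARD('n)"
    if "\<And>x y A. x \<le> y \<Longrightarrow> f x A \<le> f y A" for f and A :: "complex^'n^'n"
    by (intro divide_right_mono_ennreal eigsum_mono that mu_le_mu_F)
  have part1: "(\<integral>\<^sup>+ A. (eigsum (\<lambda>A l v. (mu A l v)^2 / ennreal ((frob_norm A)^2)) A) / of_nat CARD('n) \<partial>gauss_matrix s Ahat)
         \<le> (\<integral>\<^sup>+ A. (eigsum (\<lambda>A l v. (mu_F A l v)^2 / ennreal ((frob_norm A)^2)) A) / of_nat CARD('n) \<partial>gauss_matrix s Ahat)"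
    by (intro nn_integral_mono eig_le[of "\<lambda>x A. x^2 / ennreal ((frob_norm A)^2)"] divide_right_mono_ennreal power_mono) simp_all
  have part3: "(\<integral>\<^sup>+ A. eigsum (\<lambda>A l v. (mu A l v)^2) A / of_nat CARD('n) \<partial>(sphere_uniform :: (complex^'n^'n) measure))
         \<le> (\<integral>\<^sup>+ A. eigsum (\<lambda>A l v. (mu_F A l v)^2) A / of_nat CARD('n) \<partial>(sphere_uniform :: (complex^'n^'n) measure))"
    by (intro nn_integral_mono eig_le[of "\<lambda>x A. x^2"] power_mono) simp_all
  have part2: "(\<integral>\<^sup>+ A. (eigsum (\<lambda>A l v. (mu_F A l v)^2 / ennreal ((frob_norm A)^2)) A) / of_nat CARD('n) \<partial>gauss_matrix s Ahat)
         \<le> ennreal (real CARD('n) / s^2)"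
  proof -
    define c where "c = (sqrt pi * s) ^ DIM(complex^'n^'n)"
    have c: "c > 0" using assms by (simp add: c_def)
    define w where "w A = ennreal (gauss_density s Ahat A)" for A
    have w: "w A = ennreal (1 / c) * ennreal (exp (- (norm (A - Ahat))\<^sup>2 / s\<^sup>2))" for A
      unfolding w_def gauss_density_eq[OF assms(2)] c_def[symmetric] using c by (simp flip: ennreal_mult)
    have [measurable]: "w \<in> borel_measurable borel" unfolding w by measurable
    have Lw: "(\<integral>\<^sup>+A. L A * w A \<partial>lborel) \<le> ennreal (d / s\<^sup>2)"
    proof (rule bound)
      fix e :: real and u :: "complex^'n" assume e: "e > 0"
      note [measurable] = mk[OF e, of u]
      have "(\<integral>\<^sup>+A. ennreal (krylov_energy e u A) * w A \<partial>lborel) = (\<integral>\<^sup>+A. ennreal (1 / c) * ennreal (krylov_energy e u A * exp (- (norm (A - Ahat))\<^sup>2 / s\<^sup>2)) \<partial>lborel)"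
        unfolding w ennreal_mult[OF krylov_energy_nonneg[OF e] exp_ge_zero] by (simp only: mult.left_commute)
      also have "\<dots> = ennreal (1 / c) * (\<integral>\<^sup>+A. ennreal (krylov_energy e u A * exp (- (norm (A - Ahat))\<^sup>2 / s\<^sup>2)) \<partial>lborel)"
        by (rule nn_integral_cmult) measurable
      also have "\<dots> \<le> ennreal (1 / c) * (ennreal (d / s\<^sup>2) * ennreal c)"
      proof (rule mult_left_mono)
        show "(\<integral>\<^sup>+A. ennreal (krylov_energy e u A * exp (- (norm (A - Ahat))\<^sup>2 / s\<^sup>2)) \<partial>lborel) \<le> ennreal (d / s\<^sup>2) * ennreal c"
          unfolding c_def nn_integral_gaussian[OF assms(2), of Ahat, symmetric]
          by (rule nn_integral_gaussian_le_of_balls[OF mk[OF e] krylov_energy_nonneg[OF e] d0 assms(2)])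
            (use krylov_energy_ball_le[OF e] in \<open>simp add: d_def\<close>)
      qed simp
      also have "\<dots> = ennreal (d / s\<^sup>2)" using c d0 by (simp flip: ennreal_mult)
      finally show "(\<integral>\<^sup>+A. ennreal (krylov_energy e u A) * w A \<partial>lborel) \<le> ennreal (d / s\<^sup>2)" .
    qed measurable
    have "(\<integral>\<^sup>+ A. (eigsum (\<lambda>A l v. (mu_F A l v)^2 / ennreal ((frob_norm A)^2)) A) / of_nat CARD('n) \<partial>gauss_matrix s Ahat)
       \<le> (\<integral>\<^sup>+ A. ennreal (2 / n) * L A \<partial>gauss_matrix s Ahat)"
    proof (rule nn_integral_mono_AE)
      have "AE A in lborel. 0 < w A \<longrightarrow> (eigsum (\<lambda>A l v. (mu_F A l v)^2 / ennreal ((frob_norm A)^2)) A) / of_nat CARD('n) \<le> ennreal (2 / n) * L A"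
        using L
      proof eventually_elim
        fix A :: "complex^'n^'n" assume A: "A \<notin> degenerate \<and> eig_energy A \<le> L A"
        have "eigsum (\<lambda>A l v. (mu_F A l v)^2 / ennreal ((frob_norm A)^2)) A \<le> 2 * L A"
          using eigsum_mu_F_le(2)[OF assms(1), of A] A by (meson mult_left_mono order_trans zero_le)
        then have "ennreal (1 / n) * eigsum (\<lambda>A l v. (mu_F A l v)^2 / ennreal ((frob_norm A)^2)) A \<le> ennreal (1 / n) * (2 * L A)"
          by (rule mult_left_mono) simp
        also have "\<dots> = ennreal (2 / n) * L A"
          using n2 by (simp add: mult.assoc[symmetric] ennreal_mult[of 2 "1 / n", simplified] mult.commute[of _ 2])
        finally show "0 < w A \<longrightarrow> (eigsum (\<lambda>A l v. (mu_F A l v)^2 / ennreal ((frob_norm A)^2)) A) / of_nat CARD('n) \<le> ennreal (2 / n) * L A"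
          unfolding on div_n by simp
      qed
      then show "AE A in gauss_matrix s Ahat. (eigsum (\<lambda>A l v. (mu_F A l v)^2 / ennreal ((frob_norm A)^2)) A) / of_nat CARD('n) \<le> ennreal (2 / n) * L A"
        unfolding gauss_matrix_def w_def[symmetric] by (subst AE_density) auto
    qed
    also have "\<dots> = (\<integral>\<^sup>+ A. w A * (ennreal (2 / n) * L A) \<partial>lborel)"
      unfolding gauss_matrix_def w_def[symmetric] by (rule nn_integral_density) measurable
    also have "\<dots> = (\<integral>\<^sup>+ A. ennreal (2 / n) * (L A * w A) \<partial>lborel)" by (simp add: mult_ac)
    also have "\<dots> = ennreal (2 / n) * (\<integral>\<^sup>+ A. L A * w A \<partial>lborel)" by (rule nn_integral_cmult) measurable
    also have "\<dots> \<le> ennreal (2 / n) * ennreal (d / s\<^sup>2)" by (rule mult_left_mono[OF Lw]) simp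
    also have "\<dots> = ennreal (2 / n * (d / s\<^sup>2))" using n2 d0 by (subst ennreal_mult) auto
    \<comment> \<open>2 stems from the maximum in \<open>mu_F\<close> and 1 / n from the average;
      with d at most n (n - 1) / 2 the value is at most (n - 1) / s^2.\<close>
    also have "\<dots> \<le> ennreal (n / s\<^sup>2)"
    proof (rule ennreal_leI)
      have "2 / n * d \<le> 2 / n * (n * (n - 1) / 2)" using d n2 by (intro mult_left_mono) auto
      also have "\<dots> \<le> n" using n2 by simp
      finally have "(2 / n * d) / s\<^sup>2 \<le> n / s\<^sup>2" by (rule divide_right_mono) simp
      then show "2 / n * (d / s\<^sup>2) \<le> n / s\<^sup>2" by (simp only: times_divide_eq_right)
    qed
    finally show ?thesis by (simp add: n_def)
  qed
  have part4: "(\<integral>\<^sup>+ A. eigsum (\<lambda>A l v. (mu_F A l v)^2) A / of_nat CARD('n) \<partial>(sphere_uniform :: (complex^'n^'n) measure))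
         \<le> ennreal (real CARD('n) ^ 3)"
  proof -
    define V where "V = measure lborel (ball (0 :: complex^'n^'n) 1)"
    have V: "V > 0" unfolding V_def by simp
    have eV: "emeasure lborel (ball (0 :: complex^'n^'n) 1) = ennreal V"
      unfolding V_def using emeasure_lborel_ball_finite[of "0 :: complex^'n^'n" 1] by (simp add: emeasure_eq_ennreal_measure less_top)
    define w where "w A = ennreal (max 0 (1 - (norm A)\<^sup>2))" for A :: "complex^'n^'n"
    have [measurable]: "w \<in> borel_measurable borel" unfolding w_def by measurable
    have Lw: "(\<integral>\<^sup>+A. L A * w A \<partial>lborel) \<le> ennreal (d * V)"
    proof (rule bound)
      fix e :: real and u :: "complex^'n" assume e: "e > 0"
      show "(\<integral>\<^sup>+A. ennreal (krylov_energy e u A) * w A \<partial>lborel) \<le> ennreal (d * V)"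
        using krylov_energy_ball_le[OF e zero_less_one, of u 0]
        unfolding w_def d_def V_def ennreal_mult[OF krylov_energy_nonneg[OF e] max.cobounded1] diff_zero real_sqrt_one .
    qed measurable
    define g where "g A = eigsum (\<lambda>A l v. (mu_F A l v)^2) A / of_nat CARD('n)" for A :: "complex^'n^'n"
    \<comment> \<open>A / |A| has norm 1, so its sum is at most twice its energy, which by
      homogeneity is |A|^2 times that of A. This |A|^2 turns 1 / |A|^2 - 1 into 1 - |A|^2, the
      truncated weight with q = 1 and center 0.\<close>
    have gL: "AE A in lborel. g (A /\<^sub>R norm A) * ennreal (1 / (norm A)\<^sup>2 - 1) * indicator (ball 0 1) A \<le> ennreal (2 / n) * (L A * w A)"
      using L AE_lborel_singleton[of "0 :: complex^'n^'n"]
    proof eventually_elim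
      fix A :: "complex^'n^'n" assume A: "A \<notin> degenerate \<and> eig_energy A \<le> L A" and A0: "A \<noteq> 0"
      show "g (A /\<^sub>R norm A) * ennreal (1 / (norm A)\<^sup>2 - 1) * indicator (ball 0 1) A \<le> ennreal (2 / n) * (L A * w A)"
      proof (cases "A \<in> ball 0 1")
        case True
        define r where "r = norm A"
        have r: "0 < r" "r < 1" using A0 True by (auto simp: r_def)
        have ir: "0 < inverse r" using r by simp
        have nd: "A /\<^sub>R r \<notin> degenerate"
          using degenerate_scale[OF ir] A by blast
        have "norm (A /\<^sub>R r) = 1" using r by (simp add: r_def)
        then have "eigsum (\<lambda>A l v. (mu_F A l v)^2) (A /\<^sub>R r) \<le> 2 * eig_energy (A /\<^sub>R r)"
          using eigsum_mu_F_le(1)[OF assms(1) nd] by simp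
        also have "eig_energy (A /\<^sub>R r) = ennreal (r\<^sup>2) * eig_energy A"
        proof -
          have "1 / (inverse r)\<^sup>2 = r\<^sup>2" using r by (simp add: field_simps)
          then show ?thesis using eig_energy_scale[OF ir, of A] A by (simp only: not_False_eq_True simp_thms)
        qed
        also have "2 * (ennreal (r\<^sup>2) * eig_energy A) \<le> 2 * (ennreal (r\<^sup>2) * L A)"
          using A by (intro mult_left_mono) auto
        finally have 1: "g (A /\<^sub>R r) \<le> ennreal (1 / n) * (2 * (ennreal (r\<^sup>2) * L A))"
          unfolding g_def on div_n by (rule mult_left_mono) simp
        have rr: "ennreal (r\<^sup>2) * ennreal (1 / r\<^sup>2 - 1) = w A"
        proof -
          have "r\<^sup>2 \<le> 1" using r by (simp add: power_le_one)
          then have "r\<^sup>2 * (1 / r\<^sup>2 - 1) = max 0 (1 - r\<^sup>2)" "0 \<le> 1 / r\<^sup>2 - 1" using r by (simp_all add: field_simps)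
          then show ?thesis unfolding w_def r_def[symmetric] by (simp flip: ennreal_mult)
        qed
        have "g (A /\<^sub>R r) * ennreal (1 / r\<^sup>2 - 1) \<le> ennreal (1 / n) * (2 * (ennreal (r\<^sup>2) * L A)) * ennreal (1 / r\<^sup>2 - 1)"
          using 1 by (rule mult_right_mono) simp
        also have "\<dots> = (2 * ennreal (1 / n)) * (L A * (ennreal (r\<^sup>2) * ennreal (1 / r\<^sup>2 - 1)))" by (simp add: mult_ac)
        also have "2 * ennreal (1 / n) = ennreal (2 / n)" using n2 ennreal_mult[of 2 "1 / n"] by simp
        finally show ?thesis using True unfolding rr unfolding r_def by simp
      qed simp
    qed
    have "(\<integral>\<^sup>+ A. g A \<partial>sphere_uniform) \<le> ennreal (n\<^sup>2 - 1) / ennreal V * (\<integral>\<^sup>+A. g (A /\<^sub>R norm A) * ennreal (1 / (norm A)\<^sup>2 - 1) * indicator (ball 0 1) A \<partial>lborel)"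
      using nn_integral_sphere_uniform_le[OF assms(1), of g] unfolding eV n_def .
    also have "\<dots> \<le> ennreal (n\<^sup>2 - 1) / ennreal V * (\<integral>\<^sup>+A. ennreal (2 / n) * (L A * w A) \<partial>lborel)"
      by (intro mult_left_mono nn_integral_mono_AE gL) simp
    also have "(\<integral>\<^sup>+A. ennreal (2 / n) * (L A * w A) \<partial>lborel) = ennreal (2 / n) * (\<integral>\<^sup>+A. L A * w A \<partial>lborel)"
      by (rule nn_integral_cmult) measurable
    also have "ennreal (n\<^sup>2 - 1) / ennreal V * (ennreal (2 / n) * (\<integral>\<^sup>+A. L A * w A \<partial>lborel)) \<le> ennreal (n\<^sup>2 - 1) / ennreal V * (ennreal (2 / n) * ennreal (d * V))"
      by (intro mult_left_mono Lw) auto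
    also have "\<dots> = ennreal ((n\<^sup>2 - 1) / V * (2 / n * (d * V)))"
    proof -
      have "0 \<le> n\<^sup>2 - 1" using n2 by (simp add: one_le_power)
      then show ?thesis using V n2 d0 by (simp add: divide_ennreal ennreal_mult del: ennreal_mult'' flip: ennreal_mult)
    qed
    \<comment> \<open>The volume of the ball cancels, and the remaining value is at most (n^2 - 1)
      (n - 1).\<close>
    also have "\<dots> \<le> ennreal (n ^ 3)"
    proof (rule ennreal_leI)
      have n1: "0 \<le> n\<^sup>2 - 1" using n2 by (simp add: one_le_power)
      have "(n\<^sup>2 - 1) / V * (2 / n * (d * V)) = (n\<^sup>2 - 1) * (2 / n * d)" using V by simp
      also have "\<dots> \<le> n\<^sup>2 * n"
      proof (rule mult_mono)
        have "2 / n * d \<le> 2 / n * (n * (n - 1) / 2)" using d n2 by (intro mult_left_mono) auto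
        also have "\<dots> \<le> n" using n2 by simp
        finally show "2 / n * d \<le> n" .
      qed (use n1 n2 d0 in auto)
      also have "\<dots> = n ^ 3" by (simp add: power2_eq_square power3_eq_cube)
      finally show "(n\<^sup>2 - 1) / V * (2 / n * (d * V)) \<le> n ^ 3" .
    qed
    finally show ?thesis unfolding g_def n_def .
  qed
  show ?thesis using part1 part2 part3 part4 by blast
qed

end
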